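(* Let $N\ge1$ and let $\boldsymbol{\xi}\in(\overline{\mathbb{Q}}^{\times})^N$. If $h_{\mathcal{D}}(\boldsymbol{\xi})\le e^{-1}$, then $$\Delta(\boldsymbol{\xi})\le\Big(9\big(\tfrac32\big)^N+14N\Big)\,h_{\mathcal{D}}(\boldsymbol{\xi})^{1/3}\,\big|\log h_{\mathcal{D}}(\boldsymbol{\xi})\big|^{2(N-1)/3}.$$
   Context: Fix $\overline{\mathbb{Q}}\subset\mathbb{C}$, the algebraic closure of $\mathbb{Q}$; $\overline{\mathbb{Q}}^\times$ is its multiplicative group. Heights. For $\xi\in\overline{\mathbb{Q}}$ let $P_\xi(x)=c_d\prod_{j=1}^d(x-\alpha_j)\in\mathbb{Z}[x]$ be its minimal polynomial (primitive, with integer coefficients), $d=\deg(\xi)=[\mathbb{Q}(\xi):\mathbb{Q}]$. Its Weil height is $h(\xi)=\frac1d\big(\log|c_d|+\sum_{j=1}^d\log^+|\alpha_j|\big)$, where $\log^+x=\max\{0,\log x\}$ (and $\log^+0=0$). For $\boldsymbol{\xi}=(\xi_1,\dots,\xi_N)\in(\overline{\mathbb{Q}}^\times)^N$, $h(\boldsymbol{\xi}):=h(\xi_1)+\dots+h(\xi_N)$. For $\boldsymbol{n}\in\mathbb{Z}^N$, $\chi^{\boldsymbol{n}}(\boldsymbol{\xi}):=\xi_1^{n_1}\cdots\xi_N^{n_N}$. The generalized degree is $\mathcal{D}(\boldsymbol{\xi}):=\min_{\boldsymbol{n}\in\mathbb{Z}^N\setminus\{\boldsymbol{0}\}}\{\|\boldsymbol{n}\|_1\deg(\chi^{\boldsymbol{n}}(\boldsymbol{\xi}))\}$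 with $\|\boldsymbol{n}\|_1=\sum_j|n_j|$, and $h_{\mathcal{D}}(\boldsymbol{\xi}):=h(\boldsymbol{\xi})+\frac{\log(2\mathcal{D}(\boldsymbol{\xi}))}{3\mathcal{D}(\boldsymbol{\xi})}$. Angular discrepancy. Let $\mathbb{T}=\mathbb{R}/\mathbb{Z}$. Let $S=\{(\sigma\xi_1,\dots,\sigma\xi_N):\sigma\in\mathrm{Gal}(\overline{\mathbb{Q}}/\mathbb{Q})\}$ be the (finite) Galois orbit of $\boldsymbol{\xi}$, and for $\boldsymbol{\alpha}=(\alpha_1,\dots,\alpha_N)\in S$ let $\boldsymbol{\theta}(\boldsymbol{\alpha}):=\big(\frac{\arg(\alpha_1)}{2\pi},\dots,\frac{\arg(\alpha_N)}{2\pi}\big)\in\mathbb{T}^N$. The multidimensional angular discrepancy of the Galois orbit of $\boldsymbol{\xi}$ is $$\Delta(\boldsymbol{\xi}):=\sup_{I\subset\mathbb{T}^N}\Big|\frac1{|S|}\sum_{\boldsymbol{\alpha}\in S}\chi_I(\boldsymbol{\theta}(\boldsymbol{\alpha}))-|I|\Big|,$$ where the supremum is over all products of intervals $I=\prod_{j=1}^NI_j$ with each $I_j\subset\mathbb{T}$ an interval, $\chi_I$ is the characteristic function of $I$, and $|I|=\prod_{j=1}^N|I_j|$ is its volume ($|I_j|$ being the usual measure of $I_j\subset\mathbb{T}$). *)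

theory Defs
  imports "HOL-Analysis.Analysis" "HOL-Computational_Algebra.Computational_Algebra"
begin

definition is_min_int_poly :: "complex \<Rightarrow> int poly \<Rightarrow> bool" where
  "is_min_int_poly x p \<longleftrightarrow>
     p \<noteq> 0 \<and> poly (map_poly of_int p) x = 0 \<and> Polynomial.content p = 1 \<and> lead_coeff p > 0 \<and>
     (\<forall>q::int poly. q \<noteq> 0 \<longrightarrow> poly (map_poly of_int q) x = 0 \<longrightarrow> degree p \<le> degree q)"

(* The sign of the primitive minimal polynomial is normalised by a positive leading
   coefficient; meaningful only for algebraic x, see ex1_min_int_poly. *)
definition min_int_poly :: "complex \<Rightarrow> int poly" where
  "min_int_poly x = (THE p. is_min_int_poly x p)"

lemma map_poly_of_int_smult:
  "map_poly of_int (smult c p) = smult (of_int c) (map_poly of_int p :: complex poly)"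
  by (intro poly_eqI) (simp add: coeff_map_poly)

lemma map_poly_of_int_diff:
  "map_poly of_int (p - q) = (map_poly of_int p - map_poly of_int q :: complex poly)"
  by (intro poly_eqI) (simp add: coeff_map_poly)

lemma ex1_min_int_poly:
  assumes "algebraic x"
  shows "\<exists>!p. is_min_int_poly x p"
proof -
  let ?R = "\<lambda>p :: int poly. p \<noteq> 0 \<and> poly (map_poly of_int p) x = 0"
  obtain p0 where p0: "\<And>i. coeff p0 i \<in> \<int>" "p0 \<noteq> 0" "poly p0 x = 0"
    using assms by (rule algebraicE) blast
  have "\<exists>q :: int poly. map_poly of_int q = p0"
  proof
    show "map_poly of_int (map_poly (\<lambda>z. \<lfloor>Re z\<rfloor>) p0) = p0"
      using p0(1) by (intro poly_eqI) (metis Re_complex_of_real complex_Re_of_int coeff_map_poly floor_of_int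
        Ints_cases of_int_0 zero_complex.sel(1) floor_zero)
  qed
  then obtain q0 :: "int poly" where "map_poly of_int q0 = p0" by blast
  then have "?R q0" using p0 by auto
  then obtain q where q: "?R q" and qmin: "\<And>r. ?R r \<Longrightarrow> degree q \<le> degree r"
    using ex_has_least_nat[of ?R q0 degree] by blast
  define p where "p = smult (sgn (lead_coeff q)) (primitive_part q)"
  have s0: "sgn (lead_coeff q) \<noteq> 0" using q by (simp add: sgn_0_0)
  have decomp: "q = smult (Polynomial.content q) (primitive_part q)" by simp
  have cpos: "Polynomial.content q > 0"
  proof -
    have "Polynomial.content q \<noteq> 0" using q by simp
    moreover have "Polynomial.content q \<ge> 0" by (metis abs_ge_zero normalize_content normalize_int_def)
    ultimately show ?thesis by linarith
  qed
  have lc: "lead_coeff q = Polynomial.content q * lead_coeff (primitive_part q)"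
    by (metis decomp lead_coeff_smult)
  have "is_min_int_poly x p"
    unfolding is_min_int_poly_def
  proof (intro conjI allI impI)
    show "p \<noteq> 0" using q s0 by (simp add: p_def)
    have "poly (map_poly of_int q) x
          = of_int (Polynomial.content q) * poly (map_poly of_int (primitive_part q)) x"
      by (subst decomp) (simp only: map_poly_of_int_smult poly_smult)
    then have "poly (map_poly of_int (primitive_part q)) x = 0"
      using q cpos by simp
    then show "poly (map_poly of_int p) x = 0"
      by (simp add: p_def map_poly_of_int_smult)
    show "Polynomial.content p = 1"
      using q by (simp add: p_def sgn_if)
    show "lead_coeff p > 0"
      using s0 cpos unfolding p_def lead_coeff_smult lc by (auto simp: sgn_if zero_less_mult_iff mult_less_0_iff)
    fix r :: "int poly" assume "r \<noteq> 0" "poly (map_poly of_int r) x = 0"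
    then show "degree p \<le> degree r" using qmin[of r] by (simp add: p_def)
  qed
  moreover have "r = s" if r: "is_min_int_poly x r" and s: "is_min_int_poly x s" for r s
  proof -
    have deg: "degree r = degree s"
      using r s unfolding is_min_int_poly_def by (meson order_antisym)
    define t where "t = smult (lead_coeff s) r - smult (lead_coeff r) s"
    have root: "poly (map_poly of_int t) x = 0"
      using r s unfolding is_min_int_poly_def t_def
      by (simp add: map_poly_of_int_diff map_poly_of_int_smult)
    have c0: "coeff t (degree r) = 0" by (simp add: t_def deg)
    have dle: "degree t \<le> degree r"
      unfolding t_def by (rule degree_diff_le) (simp_all add: deg)
    have "t = 0"
    proof (rule ccontr)
      assume "t \<noteq> 0"
      then have "degree r \<le> degree t" using r root by (simp add: is_min_int_poly_def)
      then have "degree t = degree r" using dle by simp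
      with c0 \<open>t \<noteq> 0\<close> show False by (metis leading_coeff_0_iff)
    qed
    then have eq: "smult (lead_coeff s) r = smult (lead_coeff r) s" by (simp add: t_def)
    then have "Polynomial.content (smult (lead_coeff s) r) = Polynomial.content (smult (lead_coeff r) s)" by simp
    then have "lead_coeff s = lead_coeff r"
      using r s by (simp add: is_min_int_poly_def)
    with eq have "lead_coeff r * coeff r i = lead_coeff r * coeff s i" for i
      by (metis coeff_smult)
    with r show "r = s" by (intro poly_eqI) (simp add: is_min_int_poly_def)
  qed
  ultimately show ?thesis by blast
qed

definition alg_degree :: "complex \<Rightarrow> nat" where
  "alg_degree x = degree (min_int_poly x)"

(* Since ln 0 = 0 for type real, this gives log_plus 0 = 0. *)
definition log_plus :: "real \<Rightarrow> real" where
  "log_plus x = max 0 (ln x)"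

definition weil_height :: "complex \<Rightarrow> real" where
  "weil_height x =
     (ln (of_int \<bar>lead_coeff (min_int_poly x)\<bar>) +
      (\<Sum>\<alpha>\<in>#proots (map_poly of_int (min_int_poly x) :: complex poly). log_plus (cmod \<alpha>))) /
     of_nat (alg_degree x)"

definition weil_height_vec :: "complex ^ 'n \<Rightarrow> real" where
  "weil_height_vec \<xi> = (\<Sum>j\<in>UNIV. weil_height (\<xi> $ j))"

definition torus_char :: "int ^ 'n \<Rightarrow> complex ^ 'n \<Rightarrow> complex" where
  "torus_char n \<xi> = (\<Prod>j\<in>UNIV. (\<xi> $ j) powi (n $ j))"

definition norm1 :: "int ^ 'n \<Rightarrow> nat" where
  "norm1 n = (\<Sum>j\<in>UNIV. nat \<bar>n $ j\<bar>)"

(* The infimum of a nonempty set of naturals is its minimum. *)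
definition gen_degree :: "complex ^ 'n \<Rightarrow> nat" where
  "gen_degree \<xi> = (INF n\<in>{n. n \<noteq> 0}. norm1 n * alg_degree (torus_char n \<xi>))"

definition height_D :: "complex ^ 'n \<Rightarrow> real" where
  "height_D \<xi> =
     weil_height_vec \<xi> + ln (2 * real (gen_degree \<xi>)) / (3 * real (gen_degree \<xi>))"

definition Qbar :: "complex set" where
  "Qbar = {x. algebraic x}"

(* Field automorphisms of Qbar over the rationals. They are represented by total functions on
   the complex numbers whose values outside Qbar are irrelevant. *)
definition galois_Qbar :: "(complex \<Rightarrow> complex) set" where
  "galois_Qbar = {\<sigma>. bij_betw \<sigma> Qbar Qbar \<and> (\<forall>q\<in>\<rat>. \<sigma> q = q) \<and>
     (\<forall>x\<in>Qbar. \<forall>y\<in>Qbar. \<sigma> (x + y) = \<sigma> x + \<sigma> y \<and> \<sigma> (x * y) = \<sigma> x * \<sigma> y)}"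

definition galois_orbit :: "complex ^ 'n \<Rightarrow> (complex ^ 'n) set" where
  "galois_orbit \<xi> = (\<lambda>\<sigma>. \<chi> j. \<sigma> (\<xi> $ j)) ` galois_Qbar"

(* R/Z is represented by its fundamental domain [0,1), with frac as the quotient map.
   An interval of R/Z is the image of an interval of R, so it may wrap around 0, and it may be
   open, closed or half-open, degenerate, or all of R/Z. *)
definition circle_interval :: "real set \<Rightarrow> bool" where
  "circle_interval I \<longleftrightarrow> (\<exists>J. is_interval J \<and> I = frac ` J)"

definition torus_angle :: "complex ^ 'n \<Rightarrow> real ^ 'n" where
  "torus_angle \<alpha> = (\<chi> j. frac (Arg (\<alpha> $ j) / (2 * pi)))"

definition angular_discrepancy :: "complex ^ 'n \<Rightarrow> real" where
  "angular_discrepancy \<xi> =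
     (SUP I\<in>{I :: 'n \<Rightarrow> real set. \<forall>j. circle_interval (I j)}.
        \<bar>(\<Sum>\<alpha>\<in>galois_orbit \<xi>. indicator {\<theta>. \<forall>j. \<theta> $ j \<in> I j} (torus_angle \<alpha>))
           / real (card (galois_orbit \<xi>))
         - (\<Prod>j\<in>UNIV. measure lborel (I j))\<bar>)"

end

theory Submission
  imports Defs "Jordan_Normal_Form.Char_Poly"
begin

text \<open>
Write \<open>S\<close> for the Galois orbit of \<open>\<xi>\<close>, \<open>N\<close> for the dimension and \<open>h\<close> for \<open>height_D \<xi>\<close>. The proof bounds the averages
over \<open>\<alpha> \<in> S\<close> of the unitary characters \<open>x(\<alpha>) / |x(\<alpha>)|\<close>, where \<open>x = torus_char n\<close> and \<open>n \<noteq> 0\<close>, and then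
passes from characters to boxes by Fourier analysis.

Averages of characters. The values of \<open>x\<close> on \<open>S\<close> are the \<open>d\<close> conjugates of \<open>x(\<xi>)\<close>, each taken equally
often (\<open>equivariant_fibres\<close>). Multiplied by suitable powers of the leading and the constant coefficients
of the minimal polynomials of the \<open>\<xi>\<^sub>j\<close>, the product of all nonzero differences \<open>x(\<alpha>) - x(\<beta>)\<close> becomes an
algebraic integer that every automorphism fixes, hence a nonzero rational integer. So the logarithmic
energy of the values of \<open>x\<close> is bounded above in terms of the heights of the \<open>\<xi>\<^sub>j\<close>. Clearing the
denominators of the coordinates replaces any estimate for the height of \<open>x(\<xi>)\<close>.
In the other direction, the power series of \<open>log |1 - z|\<close> writes the energy as a sum over \<open>k \<ge> 1\<close>
of positive semidefinite forms, the first of which is nearly the squared modulus of the sum of the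
\<open>x(\<alpha>) / |x(\<alpha>)|\<close> (\<open>energy_inequality\<close>, \<open>norm_sum_directions_le\<close>); replacing \<open>z\<close> by \<open>(1 - 1/d) z\<close> makes the
diagonal terms finite, at a cost of order \<open>log d / d\<close>. Together these give \<open>mean_character_bound\<close>, and
then, with \<open>\<parallel>n\<parallel>\<close> the 1-norm of \<open>n\<close>, a bound \<open>(6 \<parallel>n\<parallel> h)\<^sup>1\<^sup>/\<^sup>2\<close> for the average (\<open>fourier_coefficient_bound\<close>).

Boxes. The indicator of an arc is at most a trapezoidal function with sides of slope \<open>K\<close>. Its Fourier
coefficients are \<open>O(min(1/|k|, K/k\<^sup>2))\<close>: their sum is \<open>O(log K)\<close>, and with weights \<open>|k|\<^sup>1\<^sup>/\<^sup>2\<close> it is still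
only \<open>O(K\<^sup>1\<^sup>/\<^sup>2)\<close>. Multiplying one trapezoid for each coordinate bounds the proportion of \<open>S\<close> in a box
from above, with an error of order \<open>1/K + (h K)\<^sup>1\<^sup>/\<^sup>2 (log K)\<^sup>N\<^sup>-\<^sup>1\<close>.
The lower bound follows from the upper one: removing the coordinates one at a time writes the complement
of a box as a disjoint union of boxes whose last side is a complementary arc (\<open>proportion_in_box_ge\<close>). The choice \<open>1/K = h\<^sup>1\<^sup>/\<^sup>3 |log h|\<^sup>2\<^sup>(\<^sup>N\<^sup>-\<^sup>1\<^sup>)\<^sup>/\<^sup>3\<close> balances the two
errors. If the asserted bound is at least 1 it holds trivially; otherwise \<open>h\<close> is so small that
all constants fit (\<open>total_disc_error_le\<close>).
\<close>

section \<open>Algebraic integers\<close>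

text \<open>The symbol \<open>$\<close> is left to the components of \<open>complex ^ 'n\<close>.\<close>
no_notation vec_index (infixl "$" 100)

definition int_span :: "complex set \<Rightarrow> complex set" where
  "int_span V = range (\<lambda>c :: complex \<Rightarrow> int. \<Sum>v\<in>V. of_int (c v) * v)"

lemma int_span_add: "x \<in> int_span V \<Longrightarrow> y \<in> int_span V \<Longrightarrow> x + y \<in> int_span V"
proof -
  assume "x \<in> int_span V" "y \<in> int_span V"
  then obtain c d where "x = (\<Sum>v\<in>V. of_int (c v) * v)" "y = (\<Sum>v\<in>V. of_int (d v) * v)"
    unfolding int_span_def by blast
  then have "x + y = (\<Sum>v\<in>V. of_int (c v + d v) * v)"
    by (simp add: sum.distrib ring_distribs)
  then show ?thesis unfolding int_span_def by (rule range_eqI[where x="\<lambda>v. c v + d v"])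
qed

lemma int_span_of_int_mult: "x \<in> int_span V \<Longrightarrow> of_int k * x \<in> int_span V"
proof -
  assume "x \<in> int_span V"
  then obtain c where "x = (\<Sum>v\<in>V. of_int (c v) * v)"
    unfolding int_span_def by blast
  then have "of_int k * x = (\<Sum>v\<in>V. of_int (k * c v) * v)"
    by (simp add: sum_distrib_left mult.assoc)
  then show ?thesis unfolding int_span_def by (rule range_eqI[where x="\<lambda>v. k * c v"])
qed

lemma int_span_0: "0 \<in> int_span V"
  unfolding int_span_def by (rule image_eqI[where x="\<lambda>_. 0"]) auto

lemma int_span_sum: "(\<And>i. i \<in> I \<Longrightarrow> f i \<in> int_span V) \<Longrightarrow> sum f I \<in> int_span V"
  by (induction I rule: infinite_finite_induct) (auto simp: int_span_0 int_span_add)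

lemma int_span_base: "finite V \<Longrightarrow> v \<in> V \<Longrightarrow> v \<in> int_span V"
  unfolding int_span_def
  by (rule image_eqI[where x="\<lambda>w. if w = v then 1 else 0"]) (auto simp: if_distrib[of of_int] if_distrib[of "\<lambda>x. x * _"] sum.delta cong: if_cong)

lemma int_span_uminus: "x \<in> int_span V \<Longrightarrow> - x \<in> int_span V"
  using int_span_of_int_mult[of x V "-1"] by simp

lemma int_span_mult_mem:
  assumes "finite V" "\<And>v. v \<in> V \<Longrightarrow> x * v \<in> int_span W" "y \<in> int_span V"
  shows "x * y \<in> int_span W"
proof -
  obtain c where y: "y = (\<Sum>v\<in>V. of_int (c v) * v)"
    using assms(3) unfolding int_span_def by blast
  have "x * y = (\<Sum>v\<in>V. of_int (c v) * (x * v))"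
    unfolding y sum_distrib_left by (intro sum.cong) auto
  also have "\<dots> \<in> int_span W"
    by (intro int_span_sum int_span_of_int_mult assms)
  finally show ?thesis .
qed

text \<open>Multiplication by \<open>x\<close> acts on the generators \<open>V\<close> through an integer matrix, and the generators form an
eigenvector with eigenvalue \<open>x\<close>. So \<open>x\<close> is a root of the characteristic polynomial of that matrix.\<close>
lemma stable_int_span_imp_algebraic_int:
  assumes V: "finite V" "v0 \<in> V" "v0 \<noteq> 0" and x: "\<And>v. v \<in> V \<Longrightarrow> x * v \<in> int_span V"
  shows "algebraic_int x"
proof -
  define n where "n = card V"
  obtain f where f: "bij_betw f {..<n} V"
    using ex_bij_betw_nat_finite[OF V(1)] unfolding n_def atLeast0LessThan by blast
  have "\<forall>i. \<exists>c :: complex \<Rightarrow> int. i < n \<longrightarrow> x * f i = (\<Sum>v\<in>V. of_int (c v) * v)"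
    using x f unfolding int_span_def bij_betw_def by blast
  then obtain c :: "nat \<Rightarrow> complex \<Rightarrow> int" where
    c: "\<And>i. i < n \<Longrightarrow> x * f i = (\<Sum>v\<in>V. of_int (c i v) * v)" by metis
  define A :: "int mat" where "A = Matrix.mat n n (\<lambda>(i, j). c i (f j))"
  have A: "A \<in> carrier_mat n n" by (simp add: A_def)
  define u where "u = Matrix.vec n f"
  obtain i0 where i0: "i0 < n" "f i0 = v0" using V f unfolding bij_betw_def by auto
  have "u \<noteq> 0\<^sub>v n"
  proof
    assume "u = 0\<^sub>v n"
    then have "vec_index u i0 = 0" using i0 by simp
    then show False using i0 V by (simp add: u_def)
  qed
  moreover have "map_mat of_int A *\<^sub>v u = x \<cdot>\<^sub>v u"
  proof (rule eq_vecI)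
    show "dim_vec (map_mat of_int A *\<^sub>v u) = dim_vec (x \<cdot>\<^sub>v u)"
      using A by (simp add: u_def)
    fix i assume "i < dim_vec (x \<cdot>\<^sub>v u)"
    then have i: "i < n" by (simp add: u_def)
    have "vec_index (map_mat of_int A *\<^sub>v u) i = (\<Sum>j<n. of_int (c i (f j)) * f j)"
      using i by (simp add: u_def A_def scalar_prod_def atLeast0LessThan)
    also have "\<dots> = x * f i"
      unfolding c[OF i] by (rule sum.reindex_bij_betw[OF f])
    finally show "vec_index (map_mat of_int A *\<^sub>v u) i = vec_index (x \<cdot>\<^sub>v u) i"
      using i by (simp add: u_def)
  qed
  ultimately have "eigenvalue (map_mat of_int A) x"
    unfolding eigenvalue_def eigenvector_def using A
    by (intro exI[of _ u]) (simp add: u_def)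
  then have "poly (char_poly (map_mat of_int A)) x = 0"
    by (subst (asm) eigenvalue_root_char_poly[of _ n]) (use A in auto)
  moreover have "char_poly (map_mat of_int A :: complex mat) = map_poly of_int (char_poly A)"
    by (rule of_int_hom.char_poly_hom[OF A])
  moreover have "lead_coeff (char_poly A) = 1"
    using degree_monic_char_poly[OF A] by simp
  ultimately show ?thesis unfolding algebraic_int_altdef_ipoly by metis
qed

text \<open>If multiplication by the coefficients of a monic equation for \<open>y\<close> preserves the module generated by \<open>V\<close>,
then the products of the elements of \<open>V\<close> with the powers of \<open>y\<close> below the degree generate a module that
multiplication by \<open>y\<close> preserves as well, and so does everything that preserved the old one.\<close>
lemma adjoin_root_module:
  assumes V: "finite V" "1 \<in> V" and n: "n > 0"
    and st: "\<And>i v. i < n \<Longrightarrow> v \<in> V \<Longrightarrow> a i * v \<in> int_span V"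
    and y: "y ^ n + (\<Sum>i<n. a i * y ^ i) = 0"
  defines "W \<equiv> (\<lambda>(v, i). v * y ^ i) ` (V \<times> {..<n})"
  shows "finite W" "1 \<in> W" "\<And>w. w \<in> W \<Longrightarrow> y * w \<in> int_span W"
    and "\<And>b w. (\<And>v. v \<in> V \<Longrightarrow> b * v \<in> int_span V) \<Longrightarrow> w \<in> W \<Longrightarrow> b * w \<in> int_span W"
proof -
  show fW: "finite W" unfolding W_def using V by simp
  show "1 \<in> W" unfolding W_def using V n by (intro image_eqI[of _ _ "(1, 0)"]) auto
  have mem: "z * y ^ i \<in> int_span W" if "z \<in> int_span V" "i < n" for z i
  proof -
    have "y ^ i * z \<in> int_span W"
    proof (rule int_span_mult_mem[OF V(1) _ that(1)])
      fix v assume "v \<in> V"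
      then show "y ^ i * v \<in> int_span W"
        using that(2) by (intro int_span_base fW) (auto simp: W_def mult.commute)
    qed
    then show ?thesis by (simp add: mult.commute)
  qed
  show "b * w \<in> int_span W" if b: "\<And>v. v \<in> V \<Longrightarrow> b * v \<in> int_span V" and w: "w \<in> W" for b w
    using w mem[OF b] unfolding W_def by (auto simp: mult.assoc[symmetric])
  fix w assume "w \<in> W"
  then obtain v i where w: "w = v * y ^ i" "v \<in> V" "i < n" unfolding W_def by auto
  show "y * w \<in> int_span W"
  proof (cases "Suc i < n")
    case True
    then show ?thesis using mem[OF int_span_base[OF V(1) w(2)] True] by (simp add: w mult_ac)
  next
    case False
    then have "n = Suc i" using w by simp
    then have "y * w = v * y ^ n" by (simp add: w mult_ac)
    also have "y ^ n = - (\<Sum>i<n. a i * y ^ i)" using y by (simp add: eq_neg_iff_add_eq_0)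
    also have "v * \<dots> = - (\<Sum>i<n. (a i * v) * y ^ i)"
      by (simp add: sum_distrib_left mult_ac)
    also have "\<dots> \<in> int_span W"
      by (intro int_span_uminus int_span_sum mem st) (use w in auto)
    finally show ?thesis .
  qed
qed

text \<open>One module that serves several algebraic integers at once: sums and products of them preserve it too, and
this is how the closure properties below are obtained.\<close>
lemma common_module:
  assumes "finite A" "\<And>a. a \<in> A \<Longrightarrow> algebraic_int a"
  shows "\<exists>V. finite V \<and> 1 \<in> V \<and> (\<forall>a\<in>A. \<forall>v\<in>V. a * v \<in> int_span V)"
  using assms
proof (induction A)
  case empty
  then show ?case by (intro exI[of _ "{1}"]) auto
next
  case (insert y A)
  then obtain V where V: "finite V" "1 \<in> V" "\<And>a v. a \<in> A \<Longrightarrow> v \<in> V \<Longrightarrow> a * v \<in> int_span V"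
    by auto
  obtain p :: "int poly" where p: "poly (map_poly of_int p) y = 0" "lead_coeff p = 1"
    using insert.prems unfolding algebraic_int_altdef_ipoly by auto
  define n where "n = degree p"
  define a :: "nat \<Rightarrow> complex" where "a i = of_int (coeff p i)" for i
  have "n > 0"
  proof (rule ccontr)
    assume "\<not> n > 0"
    then have "degree p = 0" by (simp add: n_def)
    then obtain c where c: "p = [:c:]" by (rule degree_eq_zeroE)
    with p show False by (simp add: map_poly_pCons)
  qed
  have "y ^ n + (\<Sum>i<n. a i * y ^ i) = poly (map_poly of_int p) y"
  proof -
    have "poly (map_poly of_int p) y = (\<Sum>i\<le>n. a i * y ^ i)"
      unfolding poly_altdef by (simp add: n_def a_def coeff_map_poly degree_map_poly)
    also have "\<dots> = (\<Sum>i<n. a i * y ^ i) + a n * y ^ n"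
      unfolding lessThan_Suc_atMost[symmetric] by simp
    finally show ?thesis using p by (simp add: a_def n_def add.commute)
  qed
  then have eq: "y ^ n + (\<Sum>i<n. a i * y ^ i) = 0" using p by simp
  have st: "a i * v \<in> int_span V" if "v \<in> V" for i v
    unfolding a_def using that by (intro int_span_of_int_mult int_span_base V)
  note W = adjoin_root_module[OF V(1,2) \<open>n > 0\<close> st eq]
  show ?case
    by (rule exI, intro conjI ballI, rule W(1), assumption, rule W(2), assumption)
       (use W(3,4) V(3) in blast)
qed

lemma algebraic_int_add: 
  assumes "algebraic_int x" "algebraic_int (y :: complex)"
  shows "algebraic_int (x + y)"
proof -
  obtain V where V: "finite V" "1 \<in> V" "\<forall>a\<in>{x,y}. \<forall>v\<in>V. a * v \<in> int_span V"
    using common_module[of "{x, y}"] assms by auto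
  show ?thesis
    by (rule stable_int_span_imp_algebraic_int[OF V(1,2)]) (use V(3) in \<open>auto simp: ring_distribs int_span_add\<close>)
qed

lemma algebraic_int_mult: 
  assumes "algebraic_int x" "algebraic_int (y :: complex)"
  shows "algebraic_int (x * y)"
proof -
  obtain V where V: "finite V" "1 \<in> V" "\<forall>a\<in>{x,y}. \<forall>v\<in>V. a * v \<in> int_span V"
    using common_module[of "{x, y}"] assms by auto
  have "x * y * v \<in> int_span V" if "v \<in> V" for v
    using int_span_mult_mem[of V x V "y * v"] V that by (simp add: mult.assoc)
  then show ?thesis
    by (intro stable_int_span_imp_algebraic_int[OF V(1,2)]) auto
qed

lemma algebraic_int_root_of_monic:
  assumes n: "n > 0" and a: "\<And>i. i < n \<Longrightarrow> algebraic_int (a i)"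
    and y: "y ^ n + (\<Sum>i<n. a i * y ^ i) = (0 :: complex)"
  shows "algebraic_int y"
proof -
  obtain V where V: "finite V" "1 \<in> V" "\<forall>b\<in>a ` {..<n}. \<forall>v\<in>V. b * v \<in> int_span V"
    using common_module[of "a ` {..<n}"] a by auto
  have st: "a i * v \<in> int_span V" if "i < n" "v \<in> V" for i v using V(3) that by auto
  note W = adjoin_root_module[OF V(1,2) n st y]
  show ?thesis
    by (rule stable_int_span_imp_algebraic_int, rule W(1), assumption, assumption, rule W(2), assumption, assumption) (simp, rule W(3))
qed

lemma algebraic_int_sum:
  "(\<And>i. i \<in> I \<Longrightarrow> algebraic_int (f i :: complex)) \<Longrightarrow> algebraic_int (sum f I)"
  by (induction I rule: infinite_finite_induct) (auto intro: algebraic_int_add)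

lemma algebraic_int_prod:
  "(\<And>i. i \<in> I \<Longrightarrow> algebraic_int (f i :: complex)) \<Longrightarrow> algebraic_int (prod f I)"
  by (induction I rule: infinite_finite_induct) (auto intro: algebraic_int_mult)

lemma algebraic_int_power: "algebraic_int (x :: complex) \<Longrightarrow> algebraic_int (x ^ n)"
  by (induction n) (auto intro: algebraic_int_mult)

lemma degree_pos_if_root:
  fixes p :: "complex poly"
  assumes "p \<noteq> 0" "poly p a = 0"
  shows "degree p > 0"
proof (rule ccontr)
  assume "\<not> degree p > 0"
  then have "degree p = 0" by simp
  then obtain c where "p = [:c:]" by (rule degree_eq_zeroE)
  with assms show False by simp
qed

lemma algebraic_int_minus_one_power_mult:
  "algebraic_int (x :: complex) \<Longrightarrow> algebraic_int ((-1) ^ n * x)"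
  by (rule algebraic_int_mult[OF algebraic_int_power]) auto

text \<open>Multiplying the equation \<open>f(\<beta>) = 0\<close> of degree \<open>n\<close> with leading coefficient \<open>a\<close> by \<open>a\<^sup>n\<^sup>-\<^sup>1\<close> gives a monic
equation for \<open>a \<beta>\<close>.\<close>
lemma algebraic_int_lead_coeff_mult_root:
  fixes f :: "complex poly"
  assumes f: "\<And>i. algebraic_int (coeff f i)" and root: "poly f \<beta> = 0" and n: "degree f > 0"
  shows "algebraic_int (lead_coeff f * \<beta>)"
proof -
  define n where "n = degree f"
  define a where "a = lead_coeff f"
  have "(a * \<beta>) ^ n + (\<Sum>i<n. (coeff f i * a ^ (n - 1 - i)) * (a * \<beta>) ^ i) = a ^ (n - 1) * poly f \<beta>"
  proof -
    have 1: "(a * \<beta>) ^ n = a ^ (n - 1) * (coeff f n * \<beta> ^ n)"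
      using n by (cases n) (simp_all add: n_def a_def power_mult_distrib)
    have 2: "(coeff f i * a ^ (n - 1 - i)) * (a * \<beta>) ^ i = a ^ (n - 1) * (coeff f i * \<beta> ^ i)" if "i < n" for i
    proof -
      have "a ^ (n - 1) = a ^ (n - 1 - i) * a ^ i" using that by (simp flip: power_add)
      then show ?thesis by (simp add: power_mult_distrib)
    qed
    have "poly f \<beta> = (\<Sum>i<n. coeff f i * \<beta> ^ i) + coeff f n * \<beta> ^ n"
      unfolding poly_altdef n_def lessThan_Suc_atMost[symmetric] by simp
    moreover have "(\<Sum>i<n. (coeff f i * a ^ (n - 1 - i)) * (a * \<beta>) ^ i) = (\<Sum>i<n. a ^ (n - 1) * (coeff f i * \<beta> ^ i))"
      by (intro sum.cong 2) auto
    ultimately show ?thesis unfolding 1 by (simp add: distrib_left sum_distrib_left)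
  qed
  then have eq: "(a * \<beta>) ^ n + (\<Sum>i<n. (coeff f i * a ^ (n - 1 - i)) * (a * \<beta>) ^ i) = 0"
    using root by simp
  have "algebraic_int (a * \<beta>)"
  proof (rule algebraic_int_root_of_monic[OF _ _ eq])
    show "0 < n" using n by (simp add: n_def)
    show "algebraic_int (coeff f i * a ^ (n - 1 - i))" for i
      unfolding a_def by (intro algebraic_int_mult algebraic_int_power f)
  qed
  then show ?thesis by (simp add: a_def)
qed

lemma algebraic_int_diff: "algebraic_int (x :: complex) \<Longrightarrow> algebraic_int y \<Longrightarrow> algebraic_int (x - y)"
  using algebraic_int_add[of x "-y"] by simp

text \<open>One step of the division of \<open>f\<close> by \<open>x - \<beta>\<close> subtracts \<open>a x\<^sup>m (x - \<beta>)\<close>, where \<open>a\<close> is the leading coefficient of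
\<open>f\<close>. This keeps the coefficients integral because \<open>a \<beta>\<close> is an algebraic integer.\<close>
lemma algebraic_int_coeffs_div_root:
  fixes f :: "complex poly"
  assumes "\<And>i. algebraic_int (coeff f i)" "poly f \<beta> = 0"
  shows "\<exists>g. f = [:-\<beta>, 1:] * g \<and> (\<forall>i. algebraic_int (coeff g i))"
  using assms
proof (induction "degree f" arbitrary: f rule: less_induct)
  case less
  show ?case
  proof (cases "degree f = 0")
    case True
    then obtain c where "f = [:c:]" by (rule degree_eq_zeroE)
    with less.prems have "f = 0" by simp
    then show ?thesis by (intro exI[of _ 0]) simp
  next
    case False
    define n where "n = degree f"
    define a where "a = lead_coeff f"
    obtain m where m: "n = Suc m" using False by (cases n) (auto simp: n_def)
    define f' where "f' = f - monom a m * [:-\<beta>, 1:]"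
    have coeff_q: "coeff (monom a m * [:-\<beta>, 1:]) i = (if i = n then a else if i = m then - (a * \<beta>) else 0)" for i
      by (simp add: m mult.commute[of "monom a m"] coeff_pCons coeff_monom split: nat.splits)
    have ab: "algebraic_int (a * \<beta>)"
      unfolding a_def using less.prems False by (intro algebraic_int_lead_coeff_mult_root) auto
    have c': "algebraic_int (coeff f' i)" for i
      unfolding f'_def coeff_diff coeff_q using less.prems(1)[of i] less.prems(1)[of n] ab
      by (auto intro!: algebraic_int_diff algebraic_int_add simp: a_def n_def)
    have r': "poly f' \<beta> = 0" using less.prems by (simp add: f'_def)
    have "degree f' < degree f"
    proof -
      have "degree f' \<le> m"
      proof (rule degree_le, intro allI impI)
        fix i assume "m < i"
        then show "coeff f' i = 0"
          unfolding f'_def coeff_diff coeff_q using m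
          by (auto simp: a_def n_def coeff_eq_0)
      qed
      then show ?thesis using m by (simp add: n_def)
    qed
    from less.hyps[OF this c' r'] obtain g where
      g: "f' = [:-\<beta>, 1:] * g" "\<And>i. algebraic_int (coeff g i)" by blast
    have am: "algebraic_int (coeff (monom a m) i)" for i
      using less.prems(1)[of n] by (auto simp: a_def n_def coeff_monom)
    have "f = f' + monom a m * [:-\<beta>, 1:]" by (simp add: f'_def)
    then have "f = [:-\<beta>, 1:] * (g + monom a m)"
      unfolding g(1) distrib_left by (simp only: mult.commute)
    moreover have "algebraic_int (coeff (g + monom a m) i)" for i
      unfolding coeff_add by (intro algebraic_int_add g am)
    ultimately show ?thesis by blast
  qed
qed

text \<open>The leading coefficient clears the denominators of any subproduct of the roots: dividing out the roots
outside \<open>B\<close> keeps the coefficients integral and leaves a polynomial whose constant coefficient is, up to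
sign, the number in question.\<close>
lemma algebraic_int_lead_coeff_mult_prod_roots:
  fixes y :: "'i \<Rightarrow> complex"
  assumes "finite S" "B \<subseteq> S" "\<And>i. algebraic_int (coeff (Polynomial.smult c (\<Prod>i\<in>S. [:- y i, 1:])) i)"
  shows "algebraic_int (c * (\<Prod>i\<in>B. y i))"
proof -
  have fB: "finite B" using assms finite_subset by blast
  have "algebraic_int (coeff (Polynomial.smult c (\<Prod>i\<in>B. [:- y i, 1:])) i)" for i
  proof -
    have "\<forall>i. algebraic_int (coeff (Polynomial.smult c (\<Prod>i\<in>B. [:- y i, 1:])) i)"
      if "finite R" "R \<inter> B = {}" "\<And>i. algebraic_int (coeff (Polynomial.smult c (\<Prod>i\<in>B \<union> R. [:- y i, 1:])) i)" for R
      using that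
    proof (induction R)
      case (insert r R)
      let ?g = "Polynomial.smult c (\<Prod>i\<in>B \<union> R. [:- y i, 1:])"
      have eq: "Polynomial.smult c (\<Prod>i\<in>B \<union> insert r R. [:- y i, 1:]) = [:- y r, 1:] * ?g"
        using insert.hyps insert.prems fB by (simp del: mult_pCons_left mult_pCons_right)
      have "poly ([:- y r, 1:] * ?g) (y r) = 0" by simp
      then obtain g where g: "[:- y r, 1:] * ?g = [:- y r, 1:] * g" "\<And>i. algebraic_int (coeff g i)"
        using algebraic_int_coeffs_div_root[OF insert.prems(2), of "y r"] unfolding eq by blast
      then have "?g = g" by (simp only: mult_cancel_left) auto
      then show ?case using g(2) insert.IH insert.prems by auto
    qed auto
    from this[of "S - B"] show ?thesis
      using assms by (simp add: Un_absorb1 Int_commute)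
  qed
  from this[of 0] have "algebraic_int (c * (\<Prod>i\<in>B. - y i))"
    by (simp add: poly_0_coeff_0[symmetric] poly_prod)
  then have "algebraic_int ((-1) ^ card B * (c * (\<Prod>i\<in>B. - y i)))"
    by (rule algebraic_int_minus_one_power_mult)
  also have "(-1) ^ card B * (c * (\<Prod>i\<in>B. - y i)) = c * (\<Prod>i\<in>B. y i)"
    by (simp add: prod_uminus)
  finally show ?thesis .
qed

text \<open>A monomial with exponents at most \<open>K\<close> is a product of \<open>K\<close> squarefree monomials; each of them takes one
factor \<open>A\<close>.\<close>
lemma algebraic_int_monomial:
  fixes x :: "'i \<Rightarrow> complex"
  assumes S: "finite S" and A: "\<And>B. B \<subseteq> S \<Longrightarrow> algebraic_int (A * (\<Prod>i\<in>B. x i))"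
  shows "(\<And>i. i \<in> S \<Longrightarrow> k i \<le> K) \<Longrightarrow> algebraic_int (A ^ K * (\<Prod>i\<in>S. x i ^ k i))"
proof (induction K arbitrary: k)
  case 0
  then show ?case by simp
next
  case (Suc K)
  define B where "B = {i\<in>S. k i = Suc K}"
  \<comment> \<open>Split off the top layer: the indices whose exponent is the largest allowed one.\<close>
  have "x i ^ k i = (if i \<in> B then x i else 1) * x i ^ min (k i) K" if "i \<in> S" for i
    using Suc.prems[OF that] that by (auto simp: B_def min_def)
  then have "(\<Prod>i\<in>S. x i ^ k i) = (\<Prod>i\<in>S. if i \<in> B then x i else 1) * (\<Prod>i\<in>S. x i ^ min (k i) K)"
    by (simp add: prod.distrib)
  also have "(\<Prod>i\<in>S. if i \<in> B then x i else 1) = (\<Prod>i\<in>B. x i)"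
    using S by (subst prod.inter_restrict[symmetric]) (auto simp: B_def intro!: prod.cong)
  finally have "A ^ Suc K * (\<Prod>i\<in>S. x i ^ k i) = (A * (\<Prod>i\<in>B. x i)) * (A ^ K * (\<Prod>i\<in>S. x i ^ min (k i) K))"
    by simp
  also have "algebraic_int \<dots>"
    by (rule algebraic_int_mult[OF A Suc.IH]) (auto simp: B_def)
  finally show ?case .
qed

text \<open>Expanding the product gives monomials in which the exponent of \<open>x\<^sub>i\<close> is at most the number of factors
that involve the index \<open>i\<close>.\<close>
lemma algebraic_int_prod_differences:
  fixes x :: "'i \<Rightarrow> complex"
  assumes S: "finite S" and A: "\<And>B. B \<subseteq> S \<Longrightarrow> algebraic_int (A * (\<Prod>i\<in>B. x i))"
    and E: "E \<subseteq> S \<times> S"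
    and K: "\<And>i. i \<in> S \<Longrightarrow> card {p\<in>E. fst p = i} + card {p\<in>E. snd p = i} \<le> K"
  shows "algebraic_int (A ^ K * (\<Prod>p\<in>E. x (fst p) - x (snd p)))"
proof -
  have fE: "finite E" using E S finite_subset by blast
  have grp: "(\<Prod>p\<in>T. x (h p)) = (\<Prod>i\<in>S. x i ^ card {p\<in>T. h p = i})"
    if "finite T" "h ` T \<subseteq> S" for T and h :: "'i \<times> 'i \<Rightarrow> 'i"
    by (subst prod.group[OF that(1) S that(2), symmetric]) simp
  have "(\<Prod>p\<in>E. x (fst p) - x (snd p)) = (\<Prod>p\<in>E. x (fst p) + - x (snd p))" by simp
  also have "\<dots> = (\<Sum>T\<in>Pow E. (\<Prod>p\<in>T. x (fst p)) * (\<Prod>p\<in>E - T. - x (snd p)))"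
    by (rule prod_add[OF fE])
  finally have "A ^ K * (\<Prod>p\<in>E. x (fst p) - x (snd p))
      = (\<Sum>T\<in>Pow E. A ^ K * ((\<Prod>p\<in>T. x (fst p)) * (\<Prod>p\<in>E - T. - x (snd p))))"
    by (simp add: sum_distrib_left)
  also have "algebraic_int \<dots>"
  proof (rule algebraic_int_sum)
    fix T assume "T \<in> Pow E"
    then have T: "T \<subseteq> E" "finite T" using fE finite_subset by auto
    let ?k = "\<lambda>i. card {p\<in>T. fst p = i} + card {p\<in>E - T. snd p = i}"
    have "(\<Prod>p\<in>T. x (fst p)) * (\<Prod>p\<in>E - T. - x (snd p))
        = (-1) ^ card (E - T) * (\<Prod>i\<in>S. x i ^ ?k i)"
      using T E by (subst prod_uminus, subst grp[of T], simp, force, subst grp[of "E - T"], simp add: fE, force)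
        (simp add: power_add prod.distrib)
    then have "A ^ K * ((\<Prod>p\<in>T. x (fst p)) * (\<Prod>p\<in>E - T. - x (snd p)))
        = (-1) ^ card (E - T) * (A ^ K * (\<Prod>i\<in>S. x i ^ ?k i))" by simp
    also have "algebraic_int \<dots>"
    proof (rule algebraic_int_minus_one_power_mult, rule algebraic_int_monomial[OF S A])
      fix i assume i: "i \<in> S"
      have "?k i \<le> card {p\<in>E. fst p = i} + card {p\<in>E. snd p = i}"
        using T fE by (intro add_mono card_mono) auto
      then show "?k i \<le> K" using K[OF i] by simp
    qed auto
    finally show "algebraic_int (A ^ K * ((\<Prod>p\<in>T. x (fst p)) * (\<Prod>p\<in>E - T. - x (snd p))))" .
  qed
  finally show ?thesis .
qed

lemma algebraic_imp_algebraic_int_mult: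
  assumes "algebraic (x :: complex)"
  obtains k :: int where "k \<noteq> 0" "algebraic_int (of_int k * x)"
proof -
  obtain p where p: "\<And>i. coeff p i \<in> \<int>" "p \<noteq> 0" "poly p x = 0"
    using assms by (rule algebraicE) blast
  have "degree p > 0" by (rule degree_pos_if_root[OF p(2,3)])
  then have "algebraic_int (lead_coeff p * x)"
    by (rule algebraic_int_lead_coeff_mult_root[OF int_imp_algebraic_int[OF p(1)] p(3)])
  moreover obtain k where k: "lead_coeff p = of_int k" using p(1)[of "degree p"] by (elim Ints_cases)
  moreover have "k \<noteq> 0" using k p(2) by auto
  ultimately show ?thesis using that[of k] by simp
qed

lemma algebraic_of_int_mult:
  assumes "algebraic (of_int k * x :: complex)" "k \<noteq> 0"
  shows "algebraic x"
proof -
  obtain p where p: "\<And>i. coeff p i \<in> \<int>" "p \<noteq> 0" "poly p (of_int k * x) = 0"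
    using assms(1) by (rule algebraicE) blast
  define q where "q = p \<circ>\<^sub>p [:0, of_int k:]"
  have "coeff q i \<in> \<int>" for i
    unfolding q_def coeff_pcompose_linear by (rule Ints_mult[OF Ints_power[OF Ints_of_int] p(1)])
  moreover have "q \<noteq> 0"
    unfolding q_def using p(2) assms(2) by (subst pcompose_eq_0_iff) simp_all
  moreover have "poly q x = 0"
    using p(3) by (simp add: q_def poly_pcompose mult.commute)
  ultimately show ?thesis by (rule algebraicI)
qed

lemma algebraic_add: "algebraic (x :: complex) \<Longrightarrow> algebraic y \<Longrightarrow> algebraic (x + y)"
proof -
  assume x: "algebraic x" and y: "algebraic y"
  obtain k :: int where k: "k \<noteq> 0" "algebraic_int (of_int k * x)"
    using algebraic_imp_algebraic_int_mult[OF x] by blast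
  obtain l :: int where l: "l \<noteq> 0" "algebraic_int (of_int l * y)"
    using algebraic_imp_algebraic_int_mult[OF y] by blast
  note kl = k(1) l(1) k(2) l(2)
  have "algebraic_int (of_int l * (of_int k * x) + of_int k * (of_int l * y))"
    by (rule algebraic_int_add[OF algebraic_int_mult[OF algebraic_int_of_int kl(3)] algebraic_int_mult[OF algebraic_int_of_int kl(4)]])
  also have "of_int l * (of_int k * x) + of_int k * (of_int l * y) = of_int (k * l) * (x + y)"
    by (simp add: algebra_simps)
  finally have "algebraic_int (of_int (k * l) * (x + y))" .
  then have "algebraic (of_int (k * l) * (x + y))" by (rule algebraic_int_imp_algebraic)
  moreover have "k * l \<noteq> 0" using kl by simp
  ultimately show ?thesis by (rule algebraic_of_int_mult)
qed

lemma algebraic_mult: "algebraic (x :: complex) \<Longrightarrow> algebraic y \<Longrightarrow> algebraic (x * y)"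
proof -
  assume x: "algebraic x" and y: "algebraic y"
  obtain k :: int where k: "k \<noteq> 0" "algebraic_int (of_int k * x)"
    using algebraic_imp_algebraic_int_mult[OF x] by blast
  obtain l :: int where l: "l \<noteq> 0" "algebraic_int (of_int l * y)"
    using algebraic_imp_algebraic_int_mult[OF y] by blast
  note kl = k(1) l(1) k(2) l(2)
  have "algebraic_int ((of_int k * x) * (of_int l * y))"
    by (rule algebraic_int_mult[OF kl(3,4)])
  also have "(of_int k * x) * (of_int l * y) = of_int (k * l) * (x * y)"
    by (simp add: algebra_simps)
  finally have "algebraic_int (of_int (k * l) * (x * y))" .
  then have "algebraic (of_int (k * l) * (x * y))" by (rule algebraic_int_imp_algebraic)
  moreover have "k * l \<noteq> 0" using kl by simp
  ultimately show ?thesis by (rule algebraic_of_int_mult)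
qed

lemma algebraic_power: "algebraic (x :: complex) \<Longrightarrow> algebraic (x ^ n)"
  by (induction n) (auto intro: algebraic_mult)

lemma algebraic_sum: "(\<And>i. i \<in> I \<Longrightarrow> algebraic (f i :: complex)) \<Longrightarrow> algebraic (sum f I)"
  by (induction I rule: infinite_finite_induct) (auto intro: algebraic_add)

lemma algebraic_prod: "(\<And>i. i \<in> I \<Longrightarrow> algebraic (f i :: complex)) \<Longrightarrow> algebraic (prod f I)"
  by (induction I rule: infinite_finite_induct) (auto intro: algebraic_mult)

lemma algebraic_powi: "algebraic (x :: complex) \<Longrightarrow> algebraic (x powi n)"
  by (simp add: power_int_def algebraic_power algebraic_inverse)

section \<open>Automorphisms of the field of algebraic numbers\<close>

lemma algebraic_iff_int_poly:
  "algebraic (x :: complex) \<longleftrightarrow> (\<exists>p::int poly. p \<noteq> 0 \<and> poly (map_poly of_int p) x = 0)"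
proof
  assume "algebraic x" then show "\<exists>p::int poly. p \<noteq> 0 \<and> poly (map_poly of_int p) x = 0"
    by (metis algebraicE')
next
  assume "\<exists>p::int poly. p \<noteq> 0 \<and> poly (map_poly of_int p) x = 0"
  then obtain p :: "int poly" where p: "p \<noteq> 0" "poly (map_poly of_int p) x = 0" by blast
  show "algebraic x"
    by (rule algebraicI[of "map_poly of_int p"]) (use p in \<open>auto simp: coeff_map_poly\<close>)
qed

text \<open>A homomorphism into \<open>\<complex>\<close> from a subring of the algebraic numbers containing \<open>\<rat>\<close>, given by its graph. Graphs
are ordered by inclusion, so Zorn's lemma applies to them directly. As every element of the domain is
algebraic, the domain is automatically a field and the kernel is trivial (\<open>ph_inj\<close>).\<close>
definition partial_hom :: "(complex \<times> complex) set \<Rightarrow> bool" where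
  "partial_hom G \<longleftrightarrow>
     (\<forall>q\<in>\<rat>. (q, q) \<in> G) \<and>
     (\<forall>x y x' y'. (x, y) \<in> G \<longrightarrow> (x', y') \<in> G \<longrightarrow> (x + x', y + y') \<in> G \<and> (x * x', y * y') \<in> G) \<and>
     (\<forall>x y. (x, y) \<in> G \<longrightarrow> algebraic x) \<and>
     (\<forall>y. (0, y) \<in> G \<longrightarrow> y = 0)"

definition coeffs_related :: "(complex \<times> complex) set \<Rightarrow> complex poly \<Rightarrow> complex poly \<Rightarrow> bool" where
  "coeffs_related G p q \<longleftrightarrow> (\<forall>i. (coeff p i, coeff q i) \<in> G)"

context
  fixes G assumes G: "partial_hom G"
begin

lemma ph_rat: "q \<in> \<rat> \<Longrightarrow> (q, q) \<in> G" using G unfolding partial_hom_def by blast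
lemma ph_add: "(x, y) \<in> G \<Longrightarrow> (x', y') \<in> G \<Longrightarrow> (x + x', y + y') \<in> G"
  using G unfolding partial_hom_def by blast
lemma ph_mult: "(x, y) \<in> G \<Longrightarrow> (x', y') \<in> G \<Longrightarrow> (x * x', y * y') \<in> G"
  using G unfolding partial_hom_def by blast
lemma ph_zero: "(0, y) \<in> G \<Longrightarrow> y = 0"
  using G unfolding partial_hom_def by blast
lemma ph_alg: "(x, y) \<in> G \<Longrightarrow> algebraic x"
  using G unfolding partial_hom_def by blast
lemma ph_diff: "(x, y) \<in> G \<Longrightarrow> (x', y') \<in> G \<Longrightarrow> (x - x', y - y') \<in> G"
  using ph_add[of x y "-1 * x'" "-1 * y'"] ph_mult[of "-1" "-1" x' y'] ph_rat[of "-1"] by simp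
lemma ph_unique: "(x, y) \<in> G \<Longrightarrow> (x, y') \<in> G \<Longrightarrow> y = y'"
  using ph_diff[of x y x y'] ph_zero[of "y - y'"] by simp
lemma ph_sum: "(\<And>i. i \<in> I \<Longrightarrow> (f i, g i) \<in> G) \<Longrightarrow> (sum f I, sum g I) \<in> G"
  by (induction I rule: infinite_finite_induct) (auto intro: ph_add ph_rat)
lemma ph_prod: "(\<And>i. i \<in> I \<Longrightarrow> (f i, g i) \<in> G) \<Longrightarrow> (prod f I, prod g I) \<in> G"
  by (induction I rule: infinite_finite_induct) (auto intro: ph_mult ph_rat)
lemma ph_power: "(x, y) \<in> G \<Longrightarrow> (x ^ n, y ^ n) \<in> G"
  by (induction n) (auto intro: ph_mult ph_rat)

lemma ph_int_poly: "(x, y) \<in> G \<Longrightarrow> (poly (map_poly of_int p) x, poly (map_poly of_int p) y) \<in> G"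
  unfolding poly_altdef by (intro ph_sum ph_mult ph_power ph_rat) (auto simp: coeff_map_poly)

lemma ph_int_poly_root: "(x, y) \<in> G \<Longrightarrow> poly (map_poly of_int p) x = 0 \<Longrightarrow> poly (map_poly of_int p) y = 0"
  using ph_int_poly[of x y p] ph_zero by simp

text \<open>A nonzero algebraic number is a root of an integer polynomial with nonzero constant coefficient, and the
image is a root of the same polynomial, so it is not 0.\<close>
lemma ph_inj: assumes "(x, 0) \<in> G" shows "x = 0"
proof (rule ccontr)
  assume "x \<noteq> 0"
  then obtain p where p: "coeff p 0 \<noteq> (0::int)" "poly (map_poly of_int p) x = 0"
    using algebraicE'_nonzero[OF ph_alg[OF assms]] by blast
  have "poly (map_poly of_int p :: complex poly) 0 = 0" by (rule ph_int_poly_root[OF assms p(2)])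
  with p(1) show False by (simp add: poly_0_coeff_0 coeff_map_poly)
qed

lemma coeffs_related_add: "coeffs_related G p p' \<Longrightarrow> coeffs_related G q q' \<Longrightarrow> coeffs_related G (p + q) (p' + q')"
  unfolding coeffs_related_def by (auto intro: ph_add)

lemma coeffs_related_mult: "coeffs_related G p p' \<Longrightarrow> coeffs_related G q q' \<Longrightarrow> coeffs_related G (p * q) (p' * q')"
  unfolding coeffs_related_def coeff_mult by (auto intro!: ph_sum ph_mult)

lemma coeffs_related_const: "(x, y) \<in> G \<Longrightarrow> coeffs_related G [:x:] [:y:]"
  unfolding coeffs_related_def using ph_rat[of 0] by (auto simp: coeff_pCons split: nat.splits)

lemma coeffs_related_degree:
  assumes "coeffs_related G p q" shows "degree q = degree p"
proof -
  have "coeff p i = 0 \<longleftrightarrow> coeff q i = 0" for i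
    using assms ph_zero ph_inj unfolding coeffs_related_def by metis
  then show ?thesis unfolding degree_def by simp
qed

text \<open>This is what makes the extension \<open>q(a) \<mapsto> q'(b)\<close> well defined. Division with remainder of \<open>q\<close> by the
polynomial \<open>p\<close> of minimal degree is done in parallel on both sides, without inverting leading coefficients.\<close>
lemma coeffs_related_root:
  assumes p: "coeffs_related G p p'" "p \<noteq> 0" "poly p a = 0" "poly p' b = 0"
    and min: "\<And>q q'. coeffs_related G q q' \<Longrightarrow> q \<noteq> 0 \<Longrightarrow> poly q a = 0 \<Longrightarrow> degree p \<le> degree q"
    and q: "coeffs_related G q q'" "poly q a = 0"
  shows "poly q' b = 0"
  using q
proof (induction "degree q" arbitrary: q q' rule: less_induct)
  case less
  show ?case
  proof (cases "q = 0")
    case True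
    then have "(0, coeff q' i) \<in> G" for i
      using less.prems(1) unfolding coeffs_related_def by (metis coeff_0)
    then have "q' = 0" using ph_zero by (intro poly_eqI) simp
    then show ?thesis by simp
  next
    case False
    then have d: "degree p \<le> degree q" using min less.prems by blast
    define e where "e = degree q - degree p"
    have pos: "degree p > 0" by (rule degree_pos_if_root[OF p(2,3)])
    define r where "r = [:lead_coeff p:] * q - [:lead_coeff q:] * monom 1 e * p"
    define r' where "r' = [:lead_coeff p':] * q' - [:lead_coeff q':] * monom 1 e * p'"
    have dp: "degree p' = degree p" "degree q' = degree q"
      using coeffs_related_degree p(1) less.prems(1) by auto
    have lp: "(lead_coeff p, lead_coeff p') \<in> G" "(lead_coeff q, lead_coeff q') \<in> G"
      using p(1) less.prems(1) unfolding dp coeffs_related_def by auto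
    have "coeffs_related G (monom 1 e) (monom 1 e)"
      unfolding coeffs_related_def by (auto intro!: ph_rat simp: coeff_monom)
    then have 1: "coeffs_related G ([:lead_coeff q:] * monom 1 e * p) ([:lead_coeff q':] * monom 1 e * p')"
      by (rule coeffs_related_mult[OF coeffs_related_mult[OF coeffs_related_const[OF lp(2)]] p(1)])
    have 2: "coeffs_related G ([:lead_coeff p:] * q) ([:lead_coeff p':] * q')"
      by (rule coeffs_related_mult[OF coeffs_related_const[OF lp(1)] less.prems(1)])
    have rel: "coeffs_related G r r'"
      using 1 2 unfolding r_def r'_def coeffs_related_def coeff_diff by (blast intro: ph_diff)
    have ra: "poly r a = 0" using p less.prems by (simp add: r_def)
    have "degree r < degree q"
    proof -
      have "degree r \<le> degree q - 1"
      proof (rule degree_le, intro allI impI)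
        fix i assume i: "degree q - 1 < i"
        have *: "coeff (monom 1 e * p) i = coeff p (i - e)" if "i \<ge> e"
          using that by (simp add: coeff_monom_mult)
        show "coeff r i = 0"
        proof (cases "i = degree q")
          case True
          then show ?thesis using d pos * by (simp add: r_def e_def mult.assoc)
        next
          case False
          then have "i > degree q" using i by simp
          moreover then have "i - e > degree p" "i \<ge> e" using d by (auto simp: e_def)
          ultimately show ?thesis using * by (simp add: r_def mult.assoc coeff_eq_0)
        qed
      qed
      then show ?thesis using pos d by linarith
    qed
    from less.hyps[OF this rel ra] have "lead_coeff p' * poly q' b = 0"
      using p(4) by (simp add: r'_def)
    moreover have "lead_coeff p' \<noteq> 0" using lp(1) p(2) ph_inj[of "lead_coeff p"] by auto
    ultimately show ?thesis by simp
  qed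
qed

text \<open>Any root \<open>b\<close> of the image \<open>p'\<close> of the minimal polynomial \<open>p\<close> may serve as the image of \<open>a\<close>. The freedom in
\<open>b\<close> is used over \<open>\<rat>\<close>, where it shows that all roots of a minimal polynomial are conjugate.\<close>
lemma partial_hom_adjoin:
  assumes a: "algebraic a" and p: "coeffs_related G p p'" "p \<noteq> 0" "poly p a = 0" "poly p' b = 0"
    and min: "\<And>q q'. coeffs_related G q q' \<Longrightarrow> q \<noteq> 0 \<Longrightarrow> poly q a = 0 \<Longrightarrow> degree p \<le> degree q"
  shows "\<exists>G'. partial_hom G' \<and> G \<subseteq> G' \<and> (a, b) \<in> G'"
proof -
  define G' where "G' = {(poly q a, poly q' b) | q q'. coeffs_related G q q'}"
  have sub: "G \<subseteq> G'"
  proof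
    fix z assume "z \<in> G"
    then obtain x y where z: "z = (x, y)" "(x, y) \<in> G" by (cases z) auto
    show "z \<in> G'" unfolding G'_def using coeffs_related_const[OF z(2)] z(1)
      by (intro CollectI exI[of _ "[:x:]"] exI[of _ "[:y:]"]) simp
  qed
  have "coeffs_related G [:0, 1:] [:0, 1:]"
    unfolding coeffs_related_def by (auto intro!: ph_rat simp: coeff_pCons split: nat.splits)
  then have ab: "(a, b) \<in> G'"
    unfolding G'_def by (intro CollectI exI[of _ "[:0, 1:]"]) simp
  have alg_poly: "algebraic (poly q a)" if "coeffs_related G q q'" for q q'
  proof -
    have c: "algebraic (coeff q i)" for i using that ph_alg unfolding coeffs_related_def by blast
    show ?thesis unfolding poly_altdef by (intro algebraic_sum algebraic_mult algebraic_power a c)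
  qed
  have "partial_hom G'"
    unfolding partial_hom_def
  proof (intro conjI ballI allI impI)
    fix q :: complex assume "q \<in> \<rat>" then show "(q, q) \<in> G'" using ph_rat sub by blast
  next
    fix x y x' y' assume "(x, y) \<in> G'" "(x', y') \<in> G'"
    then obtain q q' r r' where *: "x = poly q a" "y = poly q' b" "x' = poly r a" "y' = poly r' b"
      "coeffs_related G q q'" "coeffs_related G r r'" unfolding G'_def by auto
    show "(x + x', y + y') \<in> G'" unfolding G'_def * poly_add[symmetric]
      using coeffs_related_add[OF *(5,6)] by blast
    show "(x * x', y * y') \<in> G'" unfolding G'_def * poly_mult[symmetric]
      using coeffs_related_mult[OF *(5,6)] by blast
  next
    fix x y assume "(x, y) \<in> G'"
    then show "algebraic x" unfolding G'_def using alg_poly by auto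
  next
    fix y assume "(0, y) \<in> G'"
    then obtain q q' where q: "coeffs_related G q q'" "poly q a = 0" "y = poly q' b" unfolding G'_def by auto
    have "poly q' b = 0"
      by (rule coeffs_related_root[OF p _ q(1,2)]) (rule min)
    then show "y = 0" using q(3) by simp
  qed
  then show ?thesis using sub ab by blast
qed

lemma partial_hom_extend:
  assumes a: "algebraic a"
  shows "\<exists>G' b. partial_hom G' \<and> G \<subseteq> G' \<and> (a, b) \<in> G'"
proof -
  define R where "R p \<longleftrightarrow> p \<noteq> 0 \<and> poly p a = 0 \<and> (\<exists>p'. coeffs_related G p p')" for p
  obtain p0 where p0: "\<And>i. coeff p0 i \<in> \<int>" "p0 \<noteq> 0" "poly p0 a = 0"
    using a by (rule algebraicE) blast
  have "coeffs_related G p0 p0" unfolding coeffs_related_def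
    using p0(1) ph_rat by (metis Ints_subset_Rats subsetD)
  then have "R p0" using p0 by (auto simp: R_def)
  then obtain p where p: "R p" and pmin: "\<And>q. R q \<Longrightarrow> degree p \<le> degree q"
    using ex_has_least_nat[of R p0 degree] by blast
  obtain p' where p': "coeffs_related G p p'" using p by (auto simp: R_def)
  have pos: "degree p > 0" using p by (intro degree_pos_if_root[of p a]) (auto simp: R_def)
  obtain b where b: "poly p' b = 0"
    using fundamental_theorem_of_algebra[of p'] constant_degree[of p'] coeffs_related_degree[OF p'] pos by auto
  show ?thesis
    using partial_hom_adjoin[OF a p' _ _ b] p pmin by (auto simp: R_def)
qed

end

lemma partial_hom_extend_total:
  assumes "partial_hom G"
  obtains M where "partial_hom M" "G \<subseteq> M" "\<And>x. algebraic x \<Longrightarrow> \<exists>y. (x, y) \<in> M"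
proof -
  let ?A = "{M. partial_hom M \<and> G \<subseteq> M}"
  have "\<exists>M\<in>?A. \<forall>X\<in>?A. M \<subseteq> X \<longrightarrow> X = M"
  proof (rule subset_Zorn_nonempty)
    show "?A \<noteq> {}" using assms by blast
    fix C assume C: "C \<noteq> {}" "subset.chain ?A C"
    then have mem: "\<And>X. X \<in> C \<Longrightarrow> partial_hom X \<and> G \<subseteq> X"
      and lin: "\<And>X Y. X \<in> C \<Longrightarrow> Y \<in> C \<Longrightarrow> X \<subseteq> Y \<or> Y \<subseteq> X"
      unfolding subset_chain_def by blast+
    have "partial_hom (\<Union>C)"
      unfolding partial_hom_def
    proof (intro conjI ballI allI impI)
      fix q :: complex assume "q \<in> \<rat>"
      then show "(q, q) \<in> \<Union>C" using C(1) mem ph_rat by blast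
    next
      fix x y x' y' assume "(x, y) \<in> \<Union>C" "(x', y') \<in> \<Union>C"
      then obtain X where X: "X \<in> C" "(x, y) \<in> X" "(x', y') \<in> X" using lin by blast
      show "(x + x', y + y') \<in> \<Union>C" using ph_add[of X x y x' y'] X mem[OF X(1)] by blast
      show "(x * x', y * y') \<in> \<Union>C" using ph_mult[of X x y x' y'] X mem[OF X(1)] by blast
    next
      fix x y assume "(x, y) \<in> \<Union>C" then show "algebraic x" using mem ph_alg by blast
    next
      fix y assume "(0, y) \<in> \<Union>C" then show "y = 0" using mem ph_zero by blast
    qed
    then show "\<Union>C \<in> ?A" using C(1) mem by blast
  qed
  then obtain M where "M \<in> ?A" and max: "\<forall>X\<in>?A. M \<subseteq> X \<longrightarrow> X = M" by (rule bexE)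
  then have M: "partial_hom M" "G \<subseteq> M" by simp_all
  have "\<exists>y. (x, y) \<in> M" if "algebraic x" for x
  proof -
    obtain G' b where G': "partial_hom G'" "M \<subseteq> G'" "(x, b) \<in> G'"
      using partial_hom_extend[OF M(1) \<open>algebraic x\<close>] by blast
    moreover have "G \<subseteq> G'" using M(2) G'(2) by (rule subset_trans)
    ultimately have "G' = M" using max by simp
    then show ?thesis using G'(3) by blast
  qed
  then show ?thesis by (rule that[OF M])
qed

text \<open>A total homomorphism maps the finite root set of each integer polynomial injectively into itself, hence
onto itself; this gives surjectivity.\<close>
lemma partial_hom_extend_galois:
  assumes G: "partial_hom G"
  shows "\<exists>\<sigma>\<in>galois_Qbar. \<forall>x y. (x, y) \<in> G \<longrightarrow> \<sigma> x = y"
proof -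
  obtain M where M: "partial_hom M" "G \<subseteq> M" "\<And>x. algebraic x \<Longrightarrow> \<exists>y. (x, y) \<in> M"
    using partial_hom_extend_total[OF G] by blast
  define \<sigma> where "\<sigma> x = (SOME y. (x, y) \<in> M)" for x
  have s: "(x, \<sigma> x) \<in> M" if "algebraic x" for x
    unfolding \<sigma>_def using M(3)[OF that] by (rule someI_ex)
  have eq: "\<sigma> x = y" if "(x, y) \<in> M" for x y
    using ph_unique[OF M(1) s[OF ph_alg[OF M(1) that]] that] .
  have inj: "inj_on \<sigma> Qbar"
  proof (rule inj_onI)
    fix x y assume "x \<in> Qbar" "y \<in> Qbar" "\<sigma> x = \<sigma> y"
    then have "(x - y, 0) \<in> M" using ph_diff[OF M(1) s[of x] s[of y]] by (simp add: Qbar_def)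
    then show "x = y" using ph_inj[OF M(1), of "x - y"] by simp
  qed
  have root: "poly (map_poly of_int p) (\<sigma> x) = 0" if "algebraic x" "poly (map_poly of_int p) x = 0" for x p
    using ph_int_poly_root[OF M(1) s[OF that(1)] that(2)] .
  have alg: "algebraic (\<sigma> x)" if "algebraic x" for x
    using that root[OF that] unfolding algebraic_iff_int_poly by blast
  have surj: "y \<in> \<sigma> ` Qbar" if "y \<in> Qbar" for y
  proof -
    obtain p :: "int poly" where p: "p \<noteq> 0" "poly (map_poly of_int p) y = 0"
      using \<open>y \<in> Qbar\<close> unfolding Qbar_def algebraic_iff_int_poly by blast
    define R where "R = {z :: complex. poly (map_poly of_int p) z = 0}"
    have R: "finite R" "R \<subseteq> Qbar"
      using p unfolding R_def Qbar_def algebraic_iff_int_poly by (auto intro!: poly_roots_finite)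
    have "\<sigma> ` R \<subseteq> R" using root R(2) unfolding R_def Qbar_def by auto
    then have "\<sigma> ` R = R"
      using R inj by (metis card_image card_subset_eq inj_on_subset)
    then show ?thesis using p R unfolding R_def by blast
  qed
  have "\<sigma> \<in> galois_Qbar"
    unfolding galois_Qbar_def
  proof (intro CollectI conjI ballI)
    show "bij_betw \<sigma> Qbar Qbar"
      unfolding bij_betw_def using inj surj alg by (auto simp: Qbar_def)
    show "\<sigma> q = q" if "q \<in> \<rat>" for q using ph_rat[OF M(1) that] eq by blast
    fix x y assume "x \<in> Qbar" "y \<in> Qbar"
    then have "(x, \<sigma> x) \<in> M" "(y, \<sigma> y) \<in> M" using s by (auto simp: Qbar_def)
    then show "\<sigma> (x + y) = \<sigma> x + \<sigma> y" "\<sigma> (x * y) = \<sigma> x * \<sigma> y"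
      using ph_add[OF M(1)] ph_mult[OF M(1)] eq by blast+
  qed
  then show ?thesis using eq M(2) by blast
qed

lemma algebraic_int_poly: "algebraic (x :: complex) \<Longrightarrow> algebraic (poly (map_poly of_int p) x)"
  unfolding poly_altdef
  by (intro algebraic_sum algebraic_mult algebraic_power) (simp_all add: coeff_map_poly)

lemma min_int_poly_props:
  assumes "algebraic x"
  shows "is_min_int_poly x (min_int_poly x)"
  unfolding min_int_poly_def using theI'[OF ex1_min_int_poly[OF assms]] .

lemma degree_min_int_poly_pos:
  assumes "algebraic x"
  shows "degree (min_int_poly x) > 0"
  using min_int_poly_props[OF assms] degree_pos_if_root[of "map_poly of_int (min_int_poly x)" x]
  unfolding is_min_int_poly_def by (simp add: degree_map_poly)

lemma rat_poly_clear_denominators: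
  fixes p :: "complex poly"
  assumes "\<And>i. coeff p i \<in> \<rat>"
  shows "\<exists>(k::int) q. k \<noteq> 0 \<and> [:of_int k:] * p = map_poly of_int q"
  using assms
proof (induction p)
  case 0
  then show ?case by (intro exI[of _ 1] exI[of _ 0]) auto
next
  case (pCons a p)
  have "\<And>i. coeff p i \<in> \<rat>" using pCons.prems[of "Suc i" for i] by simp
  then obtain k q where kq: "k \<noteq> 0" "[:of_int k:] * p = map_poly of_int q" using pCons.IH by blast
  have "a \<in> \<rat>" using pCons.prems[of 0] by simp
  then obtain m n where mn: "n > 0" "a = of_int m / of_int n" by (rule Rats_cases') 
  have "[:of_int (k * n):] * pCons a p = map_poly of_int (pCons (m * k) ([:n:] * q))"
  proof (rule poly_eqI)
    fix i
    have "of_int k * coeff p j = (of_int (coeff q j) :: complex)" for j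
      using arg_cong[OF kq(2), of "\<lambda>r. coeff r j"] by (simp add: coeff_map_poly)
    then show "coeff ([:of_int (k * n):] * pCons a p) i = coeff (map_poly of_int (pCons (m * k) ([:n:] * q))) i"
      using mn by (cases i) (simp_all add: coeff_map_poly mult_ac)
  qed
  moreover have "k * n \<noteq> 0" using kq mn by simp
  ultimately show ?case by blast
qed

lemma partial_hom_Rats: "partial_hom {(q, q) | q. q \<in> \<rat>}"
  unfolding partial_hom_def by (auto intro: rat_imp_algebraic)

text \<open>The identity of \<open>\<rat>\<close> extends to the field generated by \<open>x\<close> with any other root \<open>y\<close> of the minimal
polynomial as the image of \<open>x\<close>, and from there to all algebraic numbers.\<close>
lemma galois_exists_conjugate:
  assumes x: "algebraic x" and y: "poly (map_poly of_int (min_int_poly x)) y = 0"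
  obtains \<sigma> where "\<sigma> \<in> galois_Qbar" "\<sigma> x = y"
proof -
  define P where "P = (map_poly of_int (min_int_poly x) :: complex poly)"
  let ?G = "{(q, q) | q :: complex. q \<in> \<rat>}"
  note m = min_int_poly_props[OF x, unfolded is_min_int_poly_def]
  have rel: "coeffs_related ?G q q' \<longleftrightarrow> q = q' \<and> (\<forall>i. coeff q i \<in> \<rat>)" for q q'
    unfolding coeffs_related_def by (auto simp: poly_eq_iff)
  have P: "coeffs_related ?G P P" "P \<noteq> 0" "poly P x = 0" "poly P y = 0"
    using m y unfolding rel P_def by (auto simp: coeff_map_poly)
  have min: "degree P \<le> degree q" if q: "coeffs_related ?G q q'" "q \<noteq> 0" "poly q x = 0" for q q'
  proof -
    obtain k and r :: "int poly" where kr: "k \<noteq> 0" "[:of_int k:] * q = map_poly of_int r"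
      using rat_poly_clear_denominators[of q] q(1) unfolding rel by blast
    have "poly (map_poly of_int r) x = 0" unfolding kr(2)[symmetric] using q by simp
    moreover have "r \<noteq> 0" using kr q by auto
    ultimately have "degree (min_int_poly x) \<le> degree r" using m by blast
    moreover have "degree r = degree q"
      using arg_cong[OF kr(2), of degree] kr(1) by (simp add: degree_map_poly)
    ultimately show ?thesis by (simp add: P_def degree_map_poly)
  qed
  have "\<exists>G'. partial_hom G' \<and> ?G \<subseteq> G' \<and> (x, y) \<in> G'"
    by (rule partial_hom_adjoin[OF partial_hom_Rats x P]) (rule min)
  then obtain G' where G': "partial_hom G'" "(x, y) \<in> G'" by blast
  obtain \<sigma> where s: "\<sigma> \<in> galois_Qbar" and "\<forall>x y. (x, y) \<in> G' \<longrightarrow> \<sigma> x = y"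
    using partial_hom_extend_galois[OF G'(1)] by (rule bexE)
  then have "\<sigma> x = y" using G'(2) by simp
  then show ?thesis by (rule that[OF s])
qed

lemma partial_hom_galois:
  assumes "\<sigma> \<in> galois_Qbar"
  shows "partial_hom {(x, \<sigma> x) | x. x \<in> Qbar}"
proof -
  have s: "bij_betw \<sigma> Qbar Qbar" "\<And>q. q \<in> \<rat> \<Longrightarrow> \<sigma> q = q"
    "\<And>x y. x \<in> Qbar \<Longrightarrow> y \<in> Qbar \<Longrightarrow> \<sigma> (x + y) = \<sigma> x + \<sigma> y"
    "\<And>x y. x \<in> Qbar \<Longrightarrow> y \<in> Qbar \<Longrightarrow> \<sigma> (x * y) = \<sigma> x * \<sigma> y"
    using assms unfolding galois_Qbar_def by auto
  show ?thesis
    unfolding partial_hom_def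
  proof (intro conjI ballI allI impI)
    fix q :: complex assume "q \<in> \<rat>"
    then show "(q, q) \<in> {(x, \<sigma> x) | x. x \<in> Qbar}" using s(2)[of q] rat_imp_algebraic[of q] 
      by (auto simp: Qbar_def)
  next
    fix x y x' y' assume "(x, y) \<in> {(x, \<sigma> x) | x. x \<in> Qbar}" "(x', y') \<in> {(x, \<sigma> x) | x. x \<in> Qbar}"
    then have *: "y = \<sigma> x" "y' = \<sigma> x'" "x \<in> Qbar" "x' \<in> Qbar" by auto
    then have "x + x' \<in> Qbar" "x * x' \<in> Qbar" by (auto simp: Qbar_def algebraic_add algebraic_mult)
    then show "(x + x', y + y') \<in> {(x, \<sigma> x) | x. x \<in> Qbar}" "(x * x', y * y') \<in> {(x, \<sigma> x) | x. x \<in> Qbar}"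
      using * s(3,4) by auto
  next
    fix x y assume "(x, y) \<in> {(x, \<sigma> x) | x. x \<in> Qbar}" then show "algebraic x" by (auto simp: Qbar_def)
  next
    fix y assume "(0, y) \<in> {(x, \<sigma> x) | x. x \<in> Qbar}" then show "y = 0" using s(2)[of 0] by auto
  qed
qed

context
  fixes \<sigma> assumes sig: "\<sigma> \<in> galois_Qbar"
begin

lemma galois_add: "algebraic x \<Longrightarrow> algebraic y \<Longrightarrow> \<sigma> (x + y) = \<sigma> x + \<sigma> y"
  using sig by (simp add: galois_Qbar_def Qbar_def)

lemma galois_mult: "algebraic x \<Longrightarrow> algebraic y \<Longrightarrow> \<sigma> (x * y) = \<sigma> x * \<sigma> y"
  using sig by (simp add: galois_Qbar_def Qbar_def)

lemma galois_rat: "q \<in> \<rat> \<Longrightarrow> \<sigma> q = q"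
  using sig by (simp add: galois_Qbar_def)

lemma galois_algebraic: "algebraic x \<Longrightarrow> algebraic (\<sigma> x)"
  using sig unfolding galois_Qbar_def bij_betw_def Qbar_def by auto

lemma galois_inj: "algebraic x \<Longrightarrow> algebraic y \<Longrightarrow> \<sigma> x = \<sigma> y \<longleftrightarrow> x = y"
  using sig unfolding galois_Qbar_def bij_betw_def Qbar_def by (auto dest: inj_onD)

lemma galois_eq_0: "algebraic x \<Longrightarrow> \<sigma> x = 0 \<longleftrightarrow> x = 0"
  using galois_inj[of x 0] galois_rat[of 0] by simp

lemma galois_graphI: "algebraic x \<Longrightarrow> (x, \<sigma> x) \<in> {(x, \<sigma> x) | x. x \<in> Qbar}"
  by (simp add: Qbar_def)

lemma galois_graphD: "(x, y) \<in> {(x, \<sigma> x) | x. x \<in> Qbar} \<Longrightarrow> \<sigma> x = y"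
  by simp

lemma galois_int_poly: "algebraic x \<Longrightarrow> \<sigma> (poly (map_poly of_int p) x) = poly (map_poly of_int p) (\<sigma> x)"
  by (rule galois_graphD[OF ph_int_poly[OF partial_hom_galois[OF sig] galois_graphI]])

lemma galois_diff: "algebraic x \<Longrightarrow> algebraic y \<Longrightarrow> \<sigma> (x - y) = \<sigma> x - \<sigma> y"
  by (rule galois_graphD[OF ph_diff[OF partial_hom_galois[OF sig] galois_graphI galois_graphI]])

lemma galois_prod: "(\<And>i. i \<in> I \<Longrightarrow> algebraic (f i)) \<Longrightarrow> \<sigma> (\<Prod>i\<in>I. f i) = (\<Prod>i\<in>I. \<sigma> (f i))"
  by (rule galois_graphD[OF ph_prod[OF partial_hom_galois[OF sig] galois_graphI]])

lemma galois_power: "algebraic x \<Longrightarrow> \<sigma> (x ^ n) = \<sigma> x ^ n"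
  by (rule galois_graphD[OF ph_power[OF partial_hom_galois[OF sig] galois_graphI]])

lemma galois_inverse: assumes "algebraic x" shows "\<sigma> (inverse x) = inverse (\<sigma> x)"
proof (cases "x = 0")
  case False
  have "\<sigma> x * \<sigma> (inverse x) = 1"
    using galois_mult[of x "inverse x"] galois_rat[of 1] assms False by auto
  then show ?thesis by (metis inverse_unique)
qed (simp add: galois_rat)

lemma galois_powi: "algebraic x \<Longrightarrow> \<sigma> (x powi n) = \<sigma> x powi n"
  by (simp add: power_int_def galois_power galois_inverse algebraic_inverse)

end

lemma galois_comp: "\<sigma> \<in> galois_Qbar \<Longrightarrow> \<tau> \<in> galois_Qbar \<Longrightarrow> (\<lambda>x. \<sigma> (\<tau> x)) \<in> galois_Qbar"
proof -
  assume s: "\<sigma> \<in> galois_Qbar" and t: "\<tau> \<in> galois_Qbar"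
  have "bij_betw (\<sigma> \<circ> \<tau>) Qbar Qbar"
    using s t unfolding galois_Qbar_def by (intro bij_betw_trans[of \<tau> Qbar Qbar]) simp_all
  then show ?thesis
    unfolding galois_Qbar_def
    by (auto simp: o_def Qbar_def galois_rat[OF s] galois_rat[OF t] galois_add[OF t] galois_mult[OF t]
        galois_add[OF s] galois_mult[OF s] galois_algebraic[OF t])
qed

lemma galois_id: "(\<lambda>x. x) \<in> galois_Qbar"
  unfolding galois_Qbar_def by (auto simp: bij_betw_def)

text \<open>A multiple root could be moved to \<open>x\<close> by an automorphism, and then the derivative would be an integer
polynomial of smaller degree that vanishes at \<open>x\<close>.\<close>
lemma rsquarefree_min_int_poly:
  assumes x: "algebraic x"
  shows "rsquarefree (map_poly of_int (min_int_poly x) :: complex poly)"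
  unfolding rsquarefree_roots
proof (intro allI notI, elim conjE)
  fix y :: complex
  let ?P = "min_int_poly x"
  assume y: "poly (map_poly of_int ?P) y = 0" "poly (pderiv (map_poly of_int ?P)) y = 0"
  note m = min_int_poly_props[OF x, unfolded is_min_int_poly_def]
  obtain \<sigma> where s: "\<sigma> \<in> galois_Qbar" "\<sigma> x = y" using galois_exists_conjugate[OF x y(1)] by blast
  have "pderiv (map_poly of_int ?P :: complex poly) = map_poly of_int (pderiv ?P)"
    by (intro poly_eqI) (simp add: coeff_map_poly coeff_pderiv)
  then have "\<sigma> (poly (map_poly of_int (pderiv ?P)) x) = 0"
    using y(2) s(2) galois_int_poly[OF s(1) x] by simp
  moreover have "algebraic (poly (map_poly of_int (pderiv ?P)) x)"
    by (rule algebraic_int_poly[OF x])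
  ultimately have "poly (map_poly of_int (pderiv ?P)) x = 0" using galois_eq_0[OF s(1)] by blast
  moreover note d = degree_min_int_poly_pos[OF x]
  then have "pderiv ?P \<noteq> 0" by (simp add: pderiv_eq_0_iff)
  ultimately have "degree ?P \<le> degree (pderiv ?P)" using m by blast
  then show False using d by (simp add: degree_pderiv)
qed

lemma min_int_poly_root_finite:
  assumes "algebraic x"
  shows "finite {y :: complex. poly (map_poly of_int (min_int_poly x)) y = 0}"
  using min_int_poly_props[OF assms] unfolding is_min_int_poly_def by (intro poly_roots_finite) simp

lemma proots_min_int_poly:
  assumes x: "algebraic x"
  shows "proots (map_poly of_int (min_int_poly x) :: complex poly)
    = mset_set {y. poly (map_poly of_int (min_int_poly x)) y = 0}"
proof (rule multiset_eqI)
  fix y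
  have "map_poly of_int (min_int_poly x) \<noteq> (0 :: complex poly)"
    using min_int_poly_props[OF x] unfolding is_min_int_poly_def by simp
  then show "count (proots (map_poly of_int (min_int_poly x) :: complex poly)) y
      = count (mset_set {y. poly (map_poly of_int (min_int_poly x)) y = 0}) y"
    using rsquarefree_root_order[OF rsquarefree_min_int_poly[OF x], of y] min_int_poly_root_finite[OF x]
    by (auto simp: order_root count_mset_set')
qed

lemma card_roots_min_int_poly:
  assumes "algebraic x"
  shows "card {y :: complex. poly (map_poly of_int (min_int_poly x)) y = 0} = alg_degree x"
  using arg_cong[OF proots_min_int_poly[OF assms], of size]
  by (simp add: size_proots_complex alg_degree_def degree_map_poly)

text \<open>All roots of the minimal polynomial are conjugate to \<open>x\<close>, so \<open>x\<close> is the only root, and it is simple.\<close>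
lemma galois_fixed_imp_rat:
  assumes x: "algebraic x" and fixed: "\<And>\<sigma>. \<sigma> \<in> galois_Qbar \<Longrightarrow> \<sigma> x = x"
  shows "x \<in> \<rat>"
proof -
  let ?P = "min_int_poly x"
  let ?Q = "map_poly of_int ?P :: complex poly"
  note m = min_int_poly_props[OF x, unfolded is_min_int_poly_def]
  have "y = x" if "poly ?Q y = 0" for y
  proof -
    obtain \<sigma> where s: "\<sigma> \<in> galois_Qbar" "\<sigma> x = y" using galois_exists_conjugate[OF x \<open>poly ?Q y = 0\<close>] .
    show ?thesis using s(2) fixed[OF s(1)] by simp
  qed
  then have "{y. poly ?Q y = 0} = {x}" using m by blast
  then have "degree ?P = 1" using card_roots_min_int_poly[OF x] by (simp add: alg_degree_def)
  then obtain a b where ab: "?P = [:b, a:]" "a \<noteq> 0" by (rule degree1_coeffs)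
  have "map_poly of_int [:b, a:] = ([:of_int b, of_int a:] :: complex poly)"
    by (intro poly_eqI) (simp add: coeff_map_poly coeff_pCons split: nat.splits)
  moreover have "poly ?Q x = 0" using m by blast
  ultimately have "of_int b + x * of_int a = 0" unfolding ab by simp
  then have "x * of_int a = - of_int b" by (simp add: eq_neg_iff_add_eq_0 add.commute)
  then have "x = of_int (- b) / of_int a" using ab(2) by (simp only: eq_divide_eq) simp
  then show ?thesis by (simp only: Rats_divide Rats_of_int)
qed

section \<open>Galois orbits of points of the torus\<close>

definition gal_act :: "(complex \<Rightarrow> complex) \<Rightarrow> complex ^ 'n \<Rightarrow> complex ^ 'n" where
  "gal_act \<sigma> \<alpha> = (\<chi> j. \<sigma> (\<alpha> $ j))"

lemma alg_degree_pos: "algebraic x \<Longrightarrow> alg_degree x > 0"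
  unfolding alg_degree_def by (rule degree_min_int_poly_pos)

lemma weil_height_mult_degree:
  assumes "algebraic x"
  shows "real (alg_degree x) * weil_height x = ln (of_int (lead_coeff (min_int_poly x)))
    + (\<Sum>y\<in>{y :: complex. poly (map_poly of_int (min_int_poly x)) y = 0}. log_plus (cmod y))"
proof -
  have "lead_coeff (min_int_poly x) > 0"
    using min_int_poly_props[OF assms] unfolding is_min_int_poly_def by simp
  then show ?thesis
    unfolding weil_height_def proots_min_int_poly[OF assms] using alg_degree_pos[OF assms]
    by (simp add: sum_unfold_sum_mset)
qed

context
  fixes \<xi> :: "complex ^ 'n"
  assumes xi: "\<And>j. algebraic (\<xi> $ j)"
begin

lemma orbit_algebraic: "\<alpha> \<in> galois_orbit \<xi> \<Longrightarrow> algebraic (\<alpha> $ j)"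
  unfolding galois_orbit_def using galois_algebraic xi by auto

lemma orbit_act: "\<sigma> \<in> galois_Qbar \<Longrightarrow> \<alpha> \<in> galois_orbit \<xi> \<Longrightarrow> gal_act \<sigma> \<alpha> \<in> galois_orbit \<xi>"
proof -
  assume s: "\<sigma> \<in> galois_Qbar" and "\<alpha> \<in> galois_orbit \<xi>"
  then obtain \<tau> where t: "\<tau> \<in> galois_Qbar" "\<alpha> = (\<chi> j. \<tau> (\<xi> $ j))" unfolding galois_orbit_def by blast
  show ?thesis
    unfolding galois_orbit_def gal_act_def
    by (rule image_eqI[OF _ galois_comp[OF s t(1)]]) (simp add: t(2) Finite_Cartesian_Product.vec_eq_iff)
qed

lemma orbit_self: "\<xi> \<in> galois_orbit \<xi>"
  unfolding galois_orbit_def by (rule image_eqI[OF _ galois_id]) (simp add: Finite_Cartesian_Product.vec_eq_iff)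

lemma orbit_root:
  "\<alpha> \<in> galois_orbit \<xi> \<Longrightarrow> poly (map_poly of_int (min_int_poly (\<xi> $ j))) (\<alpha> $ j) = 0"
proof -
  assume "\<alpha> \<in> galois_orbit \<xi>"
  then obtain \<sigma> where s: "\<sigma> \<in> galois_Qbar" "\<alpha> $ j = \<sigma> (\<xi> $ j)" unfolding galois_orbit_def by auto
  show ?thesis
    unfolding s(2) galois_int_poly[OF s(1) xi, symmetric]
    using min_int_poly_props[OF xi] galois_rat[OF s(1), of 0] unfolding is_min_int_poly_def by simp
qed

lemma finite_orbit: "finite (galois_orbit \<xi>)"
proof (rule finite_subset)
  let ?R = "\<Union>j. {y :: complex. poly (map_poly of_int (min_int_poly (\<xi> $ j))) y = 0}"
  show "galois_orbit \<xi> \<subseteq> vec_lambda ` (UNIV \<rightarrow>\<^sub>E ?R)"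
  proof
    fix \<alpha> assume "\<alpha> \<in> galois_orbit \<xi>"
    then have "(\<lambda>j. \<alpha> $ j) \<in> UNIV \<rightarrow>\<^sub>E ?R" using orbit_root by auto
    then show "\<alpha> \<in> vec_lambda ` (UNIV \<rightarrow>\<^sub>E ?R)" by (rule rev_image_eqI) simp
  qed
  show "finite (vec_lambda ` (UNIV \<rightarrow>\<^sub>E ?R) :: (complex ^ 'n) set)"
    by (intro finite_imageI finite_PiE) (simp_all add: min_int_poly_root_finite[OF xi])
qed

lemma inj_on_gal_act: "\<sigma> \<in> galois_Qbar \<Longrightarrow> inj_on (gal_act \<sigma>) (galois_orbit \<xi>)"
proof (rule inj_onI)
  fix x y assume s: "\<sigma> \<in> galois_Qbar" and xy: "x \<in> galois_orbit \<xi>" "y \<in> galois_orbit \<xi>" "gal_act \<sigma> x = gal_act \<sigma> y"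
  have "\<sigma> (x $ j) = \<sigma> (y $ j)" for j
    using arg_cong[OF xy(3), of "\<lambda>v. v $ j"] by (simp add: gal_act_def)
  then have "x $ j = y $ j" for j
    using galois_inj[OF s orbit_algebraic[OF xy(1)] orbit_algebraic[OF xy(2)]] by simp
  then show "x = y" by (simp add: Finite_Cartesian_Product.vec_eq_iff)
qed

lemma bij_betw_gal_act:
  "\<sigma> \<in> galois_Qbar \<Longrightarrow> bij_betw (gal_act \<sigma>) (galois_orbit \<xi>) (galois_orbit \<xi>)"
  unfolding bij_betw_def
  by (meson endo_inj_surj finite_orbit image_subsetI inj_on_gal_act orbit_act)

text \<open>The values on the orbit are the conjugates of \<open>x(\<xi>)\<close>. Two such values are conjugate to each other, and
an automorphism that moves one to the other maps the fibre over the first injectively into the fibre over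
the second; so all fibres have the same size.\<close>
lemma equivariant_fibres:
  assumes alg: "\<And>\<alpha>. \<alpha> \<in> galois_orbit \<xi> \<Longrightarrow> algebraic (x \<alpha>)"
    and eqv: "\<And>\<sigma> \<alpha>. \<sigma> \<in> galois_Qbar \<Longrightarrow> \<alpha> \<in> galois_orbit \<xi> \<Longrightarrow> x (gal_act \<sigma> \<alpha>) = \<sigma> (x \<alpha>)"
  defines "R \<equiv> {y. poly (map_poly of_int (min_int_poly (x \<xi>))) y = 0}"
  shows "x ` galois_orbit \<xi> = R"
    and "\<exists>e>0. (\<forall>y\<in>R. card {\<alpha>\<in>galois_orbit \<xi>. x \<alpha> = y} = e) \<and> card (galois_orbit \<xi>) = e * alg_degree (x \<xi>)"
proof -
  let ?S = "galois_orbit \<xi>"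
  let ?F = "\<lambda>y. {\<alpha>\<in>?S. x \<alpha> = y}"
  have ax: "algebraic (x \<xi>)" using alg orbit_self by blast
  have orb: "\<alpha> \<in> ?S \<longleftrightarrow> (\<exists>\<sigma>\<in>galois_Qbar. \<alpha> = gal_act \<sigma> \<xi>)" for \<alpha>
    unfolding galois_orbit_def gal_act_def by auto
  show img: "x ` ?S = R"
  proof
    show "x ` ?S \<subseteq> R"
    proof
      fix y assume "y \<in> x ` ?S"
      then obtain \<alpha> where a: "\<alpha> \<in> ?S" "y = x \<alpha>" by (elim imageE)
      then obtain \<sigma> where s: "\<sigma> \<in> galois_Qbar" "\<alpha> = gal_act \<sigma> \<xi>" unfolding orb by (elim bexE)
      then have y: "y = \<sigma> (x \<xi>)" using a(2) eqv[OF s(1) orbit_self] by simp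
      have "poly (map_poly of_int (min_int_poly (x \<xi>))) y = 0"
        unfolding y galois_int_poly[OF s(1) ax, symmetric]
        using min_int_poly_props[OF ax] galois_rat[OF s(1), of 0] unfolding is_min_int_poly_def by simp
      then show "y \<in> R" unfolding R_def by simp
    qed
    show "R \<subseteq> x ` ?S"
    proof
      fix y assume "y \<in> R"
      then have "poly (map_poly of_int (min_int_poly (x \<xi>))) y = 0" unfolding R_def by simp
      then obtain \<sigma> where s: "\<sigma> \<in> galois_Qbar" "\<sigma> (x \<xi>) = y"
        by (rule galois_exists_conjugate[OF ax])
      then have "y = x (gal_act \<sigma> \<xi>)" using eqv[OF s(1) orbit_self] by simp
      then show "y \<in> x ` ?S" using orbit_act[OF s(1) orbit_self] by blast
    qed
  qed
  have le: "card (?F y) \<le> card (?F z)" if yR: "y \<in> R" and zR: "z \<in> R" for y z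
  proof -
    obtain \<beta> where b: "\<beta> \<in> ?S" "y = x \<beta>" using yR unfolding img[symmetric] by blast
    have r: "min_int_poly y = min_int_poly (x \<xi>)" if y: "y \<in> R" for y
    proof -
      have "poly (map_poly of_int (min_int_poly (x \<xi>))) y = 0" using y unfolding R_def by simp
      then obtain \<sigma> where s: "\<sigma> \<in> galois_Qbar" "\<sigma> (x \<xi>) = y"
        by (rule galois_exists_conjugate[OF ax])
      have eq: "poly (map_poly of_int q) y = 0 \<longleftrightarrow> poly (map_poly of_int q) (x \<xi>) = 0" for q :: "int poly"
        unfolding s(2)[symmetric] galois_int_poly[OF s(1) ax, symmetric]
        by (rule galois_eq_0[OF s(1) algebraic_int_poly[OF ax]])
      show ?thesis unfolding min_int_poly_def is_min_int_poly_def eq ..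
    qed
    have ay: "algebraic y" using alg[OF b(1)] b(2) by simp
    have "poly (map_poly of_int (min_int_poly y)) z = 0"
      unfolding r[OF yR] using zR unfolding R_def by simp
    then obtain \<sigma> where s: "\<sigma> \<in> galois_Qbar" "\<sigma> y = z" by (rule galois_exists_conjugate[OF ay])
    show ?thesis
    proof (rule card_inj_on_le)
      show "inj_on (gal_act \<sigma>) (?F y)" by (rule inj_on_subset[OF inj_on_gal_act[OF s(1)]]) auto
      show "gal_act \<sigma> ` ?F y \<subseteq> ?F z" using s eqv orbit_act by auto
      show "finite (?F z)" using finite_orbit by simp
    qed
  qed
  define e where "e = card (?F (x \<xi>))"
  have xR: "x \<xi> \<in> R" using img orbit_self by blast
  have e: "card (?F y) = e" if "y \<in> R" for y
    unfolding e_def using le[OF that xR] le[OF xR that] by simp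
  have "e > 0" unfolding e_def card_gt_0_iff using orbit_self finite_orbit by auto
  moreover have "card ?S = e * alg_degree (x \<xi>)"
  proof -
    have fR: "finite R" unfolding R_def by (rule min_int_poly_root_finite[OF ax])
    have "card ?S = (\<Sum>y\<in>R. card (?F y))"
      using sum.group[OF finite_orbit fR, of x "\<lambda>_. 1::nat"] img by simp
    also have "\<dots> = e * card R" using e by simp
    finally show ?thesis unfolding R_def card_roots_min_int_poly[OF ax] .
  qed
  ultimately show "\<exists>e>0. (\<forall>y\<in>R. card (?F y) = e) \<and> card ?S = e * alg_degree (x \<xi>)"
    using e by blast
qed

end

section \<open>The logarithmic energy of finitely many complex numbers\<close>

text \<open>The kernel \<open>min(p\<^sub>i, p\<^sub>j)\<close> is positive semidefinite: subtracting the smallest \<open>p\<^sub>k\<close> from all \<open>p\<^sub>i\<close> splits off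
\<open>p\<^sub>k\<close> times a square and removes the index \<open>k\<close>.\<close>
lemma min_kernel_psd:
  fixes w :: "'i \<Rightarrow> complex" and p :: "'i \<Rightarrow> real"
  assumes "finite S" "\<And>i. i \<in> S \<Longrightarrow> p i \<ge> 0"
  shows "0 \<le> Re (\<Sum>i\<in>S. \<Sum>j\<in>S. w i * cnj (w j) * of_real (min (p i) (p j)))"
  using assms
proof (induction "card S" arbitrary: S p)
  case 0
  then show ?case by simp
next
  case (Suc n)
  then have "S \<noteq> {}" by auto
  then obtain k where k: "k \<in> S" "\<And>i. i \<in> S \<Longrightarrow> p k \<le> p i"
    using Suc.prems(1) by (metis arg_min_least arg_min_if_finite(1))
  define q where "q i = p i - p k" for i
  have q: "q i \<ge> 0" if "i \<in> S" for i using k(2)[OF that] by (simp add: q_def)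
  have zero: "min (q k) (q j) = 0" "min (q j) (q k) = 0" if "j \<in> S" for j
    using q[OF that] by (auto simp: q_def)
  let ?T = "S - {k}"
  have "(\<Sum>i\<in>S. \<Sum>j\<in>S. w i * cnj (w j) * of_real (min (p i) (p j)))
      = (\<Sum>i\<in>S. \<Sum>j\<in>S. of_real (p k) * (w i * cnj (w j)) + w i * cnj (w j) * of_real (min (q i) (q j)))"
  proof (intro sum.cong refl)
    fix i j
    have "min (p i) (p j) = p k + min (q i) (q j)" by (simp add: q_def min_def)
    then show "w i * cnj (w j) * of_real (min (p i) (p j)) = of_real (p k) * (w i * cnj (w j)) + w i * cnj (w j) * of_real (min (q i) (q j))"
      by (simp add: algebra_simps)
  qed
  also have "\<dots> = of_real (p k) * ((\<Sum>i\<in>S. w i) * cnj (\<Sum>i\<in>S. w i))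
      + (\<Sum>i\<in>S. \<Sum>j\<in>S. w i * cnj (w j) * of_real (min (q i) (q j)))"
    by (simp only: sum.distrib sum_distrib_left[symmetric] cnj_sum sum_product)
  also have "(\<Sum>i\<in>S. \<Sum>j\<in>S. w i * cnj (w j) * of_real (min (q i) (q j)))
      = (\<Sum>i\<in>?T. \<Sum>j\<in>?T. w i * cnj (w j) * of_real (min (q i) (q j)))"
  proof -
    have "(\<Sum>j\<in>S. w i * cnj (w j) * of_real (min (q i) (q j)))
        = (if i = k then 0 else (\<Sum>j\<in>?T. w i * cnj (w j) * of_real (min (q i) (q j))))" if "i \<in> S" for i
      using Suc.prems(1) k(1) zero[OF that] zero(1) by (auto simp: sum.remove[of S k] intro: sum.neutral)
    then have "(\<Sum>i\<in>S. \<Sum>j\<in>S. w i * cnj (w j) * of_real (min (q i) (q j)))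
        = (\<Sum>i\<in>S. if i = k then 0 else (\<Sum>j\<in>?T. w i * cnj (w j) * of_real (min (q i) (q j))))"
      by (rule sum.cong[OF refl])
    also have "\<dots> = (\<Sum>i\<in>?T. \<Sum>j\<in>?T. w i * cnj (w j) * of_real (min (q i) (q j)))"
      using Suc.prems(1) k(1) by (subst sum.remove[of S k]) auto
    finally show ?thesis .
  qed
  finally have eq: "(\<Sum>i\<in>S. \<Sum>j\<in>S. w i * cnj (w j) * of_real (min (p i) (p j)))
      = of_real (p k * (cmod (\<Sum>i\<in>S. w i))\<^sup>2) + (\<Sum>i\<in>?T. \<Sum>j\<in>?T. w i * cnj (w j) * of_real (min (q i) (q j)))"
    by (simp only: of_real_mult complex_norm_square)
  have "0 \<le> Re (\<Sum>i\<in>?T. \<Sum>j\<in>?T. w i * cnj (w j) * of_real (min (q i) (q j)))"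
    by (rule Suc.hyps(1)) (use Suc.hyps(2) Suc.prems(1) k(1) q in auto)
  moreover have "0 \<le> p k * (cmod (\<Sum>i\<in>S. w i))\<^sup>2" using Suc.prems(2)[OF k(1)] by simp
  ultimately show ?case unfolding eq by simp
qed

text \<open>The fractional linear map \<open>z \<mapsto> (1 - z) / (1 - r z)\<close> sends the unit disc to the disc with diameter from 0 to
\<open>2 / (1 + r)\<close>.\<close>
lemma norm_one_minus_le:
  assumes "cmod z \<le> 1" "0 < r" "r < 1"
  shows "cmod (1 - z) \<le> 2 / (1 + r) * cmod (1 - of_real r * z)"
proof -
  obtain a b where z: "z = Complex a b" by (cases z)
  have s: "a\<^sup>2 + b\<^sup>2 \<le> 1"
    using assms(1) unfolding z by (simp add: cmod_def real_sqrt_le_1_iff)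
  have a: "- 1 \<le> a"
    using assms(1) abs_Re_le_cmod[of z] unfolding z by simp
  have "4 * ((1 - r * a)\<^sup>2 + (r * b)\<^sup>2) - (1 + r)\<^sup>2 * ((1 - a)\<^sup>2 + b\<^sup>2)
      = (1 - r) * ((1 + 3 * r) * (1 - (a\<^sup>2 + b\<^sup>2)) + 2 * (1 - r) * (1 + a))"
    by (simp add: power2_eq_square algebra_simps)
  also have "\<dots> \<ge> 0"
  proof -
    have "0 \<le> (1 + 3 * r) * (1 - (a\<^sup>2 + b\<^sup>2))" "0 \<le> 2 * (1 - r) * (1 + a)"
      using assms s a by (auto intro!: mult_nonneg_nonneg)
    then show ?thesis using assms by (intro mult_nonneg_nonneg) auto
  qed
  finally have "(1 + r)\<^sup>2 * ((1 - a)\<^sup>2 + b\<^sup>2) \<le> 4 * ((1 - r * a)\<^sup>2 + (r * b)\<^sup>2)" by simp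
  then have "((1 + r) * cmod (1 - z))\<^sup>2 \<le> (2 * cmod (1 - of_real r * z))\<^sup>2"
    unfolding z by (simp add: cmod_power2 power_mult_distrib)
  then have "(1 + r) * cmod (1 - z) \<le> 2 * cmod (1 - of_real r * z)"
    by (rule power2_le_imp_le) simp
  then show ?thesis using assms by (simp add: field_simps)
qed

text \<open>The term \<open>n = 0\<close> is a division by 0 and vanishes.\<close>
lemma minus_ln_norm_sums:
  assumes "cmod w < 1"
  shows "(\<lambda>n. Re (w ^ n) / real n) sums (- ln (cmod (1 - w)))"
proof -
  have "w \<noteq> 1" using assms by auto
  have "(\<lambda>n. (-1) ^ Suc n / of_nat n * (- w) ^ n) sums Ln (1 + - w)"
    using assms by (intro Ln_series) simp
  then have "(\<lambda>n. - Re ((-1) ^ Suc n / of_nat n * (- w) ^ n)) sums (- Re (Ln (1 + - w)))"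
    by (intro sums_minus sums_Re)
  also have "(\<lambda>n. - Re ((-1) ^ Suc n / of_nat n * (- w) ^ n)) = (\<lambda>n. Re (w ^ n) / real n)"
  proof
    fix n
    have "(-1) ^ Suc n * (- w) ^ n = - (w ^ n)"
      by (simp add: power_mult_distrib[symmetric])
    then have "(-1) ^ Suc n / of_nat n * (- w) ^ n = - (w ^ n / of_real (real n))"
      by (simp add: divide_inverse mult_ac)
    then show "- Re ((-1) ^ Suc n / of_nat n * (- w) ^ n) = Re (w ^ n) / real n"
      by (simp only: uminus_complex.sel Re_divide_of_real minus_minus)
  qed
  finally show ?thesis using \<open>w \<noteq> 1\<close> by simp
qed

locale complex_family =
  fixes S :: "'i set" and x :: "'i \<Rightarrow> complex"
  assumes fin: "finite S" and nz: "\<And>i. i \<in> S \<Longrightarrow> x i \<noteq> 0"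
begin

text \<open>For a pair of values \<open>u\<close>, \<open>v\<close> the number \<open>pair_ratio\<close> is \<open>u / v\<close> if \<open>|u| \<le> |v|\<close>, and the complex conjugate
of \<open>v / u\<close> otherwise, so that \<open>|u - v| = max(|u|, |v|) |1 - pair_ratio|\<close>. Writing it as
\<open>u \<sqdot> cnj v / max(|u|, |v|)\<^sup>2\<close> shows that all its powers are positive semidefinite kernels.\<close>
definition pair_max :: "'i \<times> 'i \<Rightarrow> real" where
  "pair_max p = max (cmod (x (fst p))) (cmod (x (snd p)))"

definition pair_ratio :: "'i \<times> 'i \<Rightarrow> complex" where
  "pair_ratio p = x (fst p) * cnj (x (snd p)) / of_real ((pair_max p)\<^sup>2)"

lemma pair_max_pos: "p \<in> S \<times> S \<Longrightarrow> pair_max p > 0"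
  using nz by (auto simp: pair_max_def less_max_iff_disj)

lemma norm_pair_ratio_le_1: assumes "p \<in> S \<times> S" shows "cmod (pair_ratio p) \<le> 1"
proof -
  have "cmod (x (fst p)) * cmod (x (snd p)) \<le> pair_max p * pair_max p"
    unfolding pair_max_def by (intro mult_mono) (auto simp: le_max_iff_disj)
  then show ?thesis
    using pair_max_pos[OF assms] by (simp add: pair_ratio_def norm_mult norm_divide power2_eq_square divide_le_eq_1)
qed

lemma sum_Re_pair_ratio_power_nonneg: "0 \<le> (\<Sum>p\<in>S \<times> S. Re (pair_ratio p ^ n))"
proof -
  have "0 \<le> Re (\<Sum>i\<in>S. \<Sum>j\<in>S. x i ^ n * cnj (x j ^ n) * of_real (min (1 / cmod (x i) ^ (2 * n)) (1 / cmod (x j) ^ (2 * n))))"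
    using fin by (intro min_kernel_psd) auto
  also have "(\<Sum>i\<in>S. \<Sum>j\<in>S. x i ^ n * cnj (x j ^ n) * of_real (min (1 / cmod (x i) ^ (2 * n)) (1 / cmod (x j) ^ (2 * n))))
     = (\<Sum>i\<in>S. \<Sum>j\<in>S. pair_ratio (i, j) ^ n)"
  proof (intro sum.cong refl)
    fix i j assume ij: "i \<in> S" "j \<in> S"
    have "min (1 / cmod (x i) ^ (2 * n)) (1 / cmod (x j) ^ (2 * n)) = 1 / (pair_max (i, j)) ^ (2 * n)"
    proof (cases "cmod (x i) \<le> cmod (x j)")
      case True
      then have "1 / cmod (x j) ^ (2 * n) \<le> 1 / cmod (x i) ^ (2 * n)"
        using nz[OF ij(1)] by (intro divide_left_mono power_mono mult_pos_pos) (auto intro!: zero_less_power)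
      then show ?thesis using True by (simp add: pair_max_def)
    next
      case False
      then have "1 / cmod (x i) ^ (2 * n) \<le> 1 / cmod (x j) ^ (2 * n)"
        using nz[OF ij(2)] by (intro divide_left_mono power_mono mult_pos_pos) (auto intro!: zero_less_power)
      then show ?thesis using False by (simp add: pair_max_def)
    qed
    then show "x i ^ n * cnj (x j ^ n) * of_real (min (1 / cmod (x i) ^ (2 * n)) (1 / cmod (x j) ^ (2 * n))) = pair_ratio (i, j) ^ n"
      by (simp add: pair_ratio_def power_divide power_mult_distrib power_mult)
  qed
  finally show ?thesis by (simp add: sum.cartesian_product)
qed

lemma sum_Re_pair_ratio_le:
  assumes r: "0 < r" "r < 1"
  shows "r * (\<Sum>p\<in>S \<times> S. Re (pair_ratio p)) \<le> (\<Sum>p\<in>S \<times> S. - ln (cmod (1 - of_real r * pair_ratio p)))"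
proof -
  define f where "f n = (\<Sum>p\<in>S \<times> S. Re ((of_real r * pair_ratio p) ^ n) / real n)" for n
  have f: "f sums (\<Sum>p\<in>S \<times> S. - ln (cmod (1 - of_real r * pair_ratio p)))"
    unfolding f_def
  proof (intro sums_sum minus_ln_norm_sums)
    fix p assume p: "p \<in> S \<times> S"
    have "cmod (of_real r * pair_ratio p) \<le> r * 1"
      unfolding norm_mult using norm_pair_ratio_le_1[OF p] r by (intro mult_mono) auto
    then show "cmod (of_real r * pair_ratio p) < 1" using r by simp
  qed
  have f_eq: "f n = r ^ n / real n * (\<Sum>p\<in>S \<times> S. Re (pair_ratio p ^ n))" for n
    unfolding f_def sum_distrib_left by (intro sum.cong) (simp_all add: power_mult_distrib flip: of_real_power)
  have "sum f {1} \<le> suminf f"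
    using f r sum_Re_pair_ratio_power_nonneg by (intro sum_le_suminf) (auto simp: sums_iff f_eq)
  then show ?thesis using f by (simp add: sums_iff f_eq)
qed

lemma norm_diff_eq:
  assumes "p \<in> S \<times> S"
  shows "cmod (x (fst p) - x (snd p)) = pair_max p * cmod (1 - pair_ratio p)"
proof -
  obtain i j where p: "p = (i, j)" "i \<in> S" "j \<in> S" using assms by auto
  have sq: "complex_of_real ((cmod z)\<^sup>2) = z * cnj z" for z by (rule complex_norm_square)
  show ?thesis
  proof (cases "cmod (x i) \<le> cmod (x j)")
    case True
    then have m: "pair_max p = cmod (x j)" by (simp add: pair_max_def p)
    have "pair_ratio p = x i / x j" unfolding pair_ratio_def m sq using nz[OF p(3)] by (simp add: p)
    then have "1 - pair_ratio p = (x j - x i) / x j" using nz[OF p(3)] by (simp add: diff_divide_distrib)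
    then have "pair_max p * cmod (1 - pair_ratio p) = cmod (x j - x i)" using nz[OF p(3)] by (simp add: m norm_divide)
    then show ?thesis by (simp add: p norm_minus_commute)
  next
    case False
    then have m: "pair_max p = cmod (x i)" by (simp add: pair_max_def p)
    have "pair_ratio p = cnj (x j / x i)" unfolding pair_ratio_def m sq using nz[OF p(2)] by (simp add: p)
    then have "1 - pair_ratio p = cnj ((x i - x j) / x i)" using nz[OF p(2)] by (simp add: diff_divide_distrib)
    then have "cmod (1 - pair_ratio p) = cmod ((x i - x j) / x i)" by (simp only: complex_mod_cnj)
    then have "pair_max p * cmod (1 - pair_ratio p) = cmod (x i - x j)" using nz[OF p(2)] by (simp add: m norm_divide)
    then show ?thesis by (simp add: p)
  qed
qed

definition offdiag :: "('i \<times> 'i) set" where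
  "offdiag = {p \<in> S \<times> S. x (fst p) \<noteq> x (snd p)}"

text \<open>Off the diagonal, \<open>- log |1 - z|\<close> is at least \<open>- log |1 - r z|\<close> up to \<open>log (2 / (1 + r))\<close>; on the diagonal,
where \<open>z = 1\<close>, the latter is \<open>log (1 / (1 - r))\<close>. In the power series of \<open>- log |1 - r z|\<close>, summed over all
pairs, every term is nonnegative, and the left hand side is the first one.\<close>
lemma energy_inequality:
  assumes r: "0 < r" "r < 1"
  shows "r * (\<Sum>p\<in>S \<times> S. Re (pair_ratio p)) \<le>
    (\<Sum>p\<in>offdiag. ln (pair_max p) - ln (cmod (x (fst p) - x (snd p))))
    + real (card offdiag) * ln (2 / (1 + r))
    + (real (card S * card S) - real (card offdiag)) * ln (1 / (1 - r))"
proof -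
  let ?D = "S \<times> S - offdiag"
  have sub: "offdiag \<subseteq> S \<times> S" "finite (S \<times> S)" "finite offdiag"
    using fin finite_subset[of offdiag "S \<times> S"] by (auto simp: offdiag_def)
  have "(\<Sum>p\<in>S \<times> S. - ln (cmod (1 - of_real r * pair_ratio p)))
      = (\<Sum>p\<in>?D. - ln (cmod (1 - of_real r * pair_ratio p))) + (\<Sum>p\<in>offdiag. - ln (cmod (1 - of_real r * pair_ratio p)))"
    using sub by (intro sum.subset_diff)
  also have "(\<Sum>p\<in>?D. - ln (cmod (1 - of_real r * pair_ratio p))) = (\<Sum>p\<in>?D. ln (1 / (1 - r)))"
  proof (intro sum.cong refl)
    fix p assume "p \<in> ?D"
    then have p: "p \<in> S \<times> S" "x (fst p) = x (snd p)" by (auto simp: offdiag_def)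
    then have "pair_max p * cmod (1 - pair_ratio p) = 0" using norm_diff_eq[OF p(1)] by simp
    then have "pair_ratio p = 1" using pair_max_pos[OF p(1)] by simp
    moreover have "cmod (1 - of_real r) = 1 - r" using r by (metis abs_of_pos diff_gt_0_iff_gt norm_of_real of_real_1 of_real_diff)
    ultimately show "- ln (cmod (1 - of_real r * pair_ratio p)) = ln (1 / (1 - r))"
      using r by (simp add: ln_div)
  qed
  also have "\<dots> = (real (card S * card S) - real (card offdiag)) * ln (1 / (1 - r))"
    using sub card_mono[OF sub(2,1)] by (simp add: card_Diff_subset of_nat_diff card_cartesian_product)
  also have "(\<Sum>p\<in>offdiag. - ln (cmod (1 - of_real r * pair_ratio p)))
      \<le> (\<Sum>p\<in>offdiag. (ln (pair_max p) - ln (cmod (x (fst p) - x (snd p)))) + ln (2 / (1 + r)))"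
  proof (rule sum_mono)
    fix p assume "p \<in> offdiag"
    then have p: "p \<in> S \<times> S" "x (fst p) \<noteq> x (snd p)" by (auto simp: offdiag_def)
    have "pair_max p * cmod (1 - pair_ratio p) \<noteq> 0" unfolding norm_diff_eq[OF p(1), symmetric] using p(2) by simp
    then have pos: "cmod (1 - pair_ratio p) > 0" "pair_max p > 0" using pair_max_pos[OF p(1)] by simp_all
    have le: "cmod (1 - pair_ratio p) \<le> 2 / (1 + r) * cmod (1 - of_real r * pair_ratio p)"
      by (rule norm_one_minus_le[OF norm_pair_ratio_le_1[OF p(1)] r])
    with pos(1) have "cmod (1 - of_real r * pair_ratio p) \<noteq> 0" by auto
    then have pos': "cmod (1 - of_real r * pair_ratio p) > 0" by simp
    have "ln (cmod (1 - pair_ratio p)) \<le> ln (2 / (1 + r) * cmod (1 - of_real r * pair_ratio p))"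
      using pos pos' r by (intro ln_mono[OF le]) simp_all
    also have "\<dots> = ln (2 / (1 + r)) + ln (cmod (1 - of_real r * pair_ratio p))"
      using pos' r by (intro ln_mult_pos) auto
    finally show "- ln (cmod (1 - of_real r * pair_ratio p)) \<le> (ln (pair_max p) - ln (cmod (x (fst p) - x (snd p)))) + ln (2 / (1 + r))"
      unfolding norm_diff_eq[OF p(1)] ln_mult_pos[OF pos(2,1)] by simp
  qed
  finally show ?thesis
    using sum_Re_pair_ratio_le[OF r] by (simp add: sum.distrib)
qed

text \<open>The kernel \<open>pair_ratio\<close> differs from the product of the directions \<open>u\<^sub>i cnj u\<^sub>j\<close> by the factor
\<open>exp (- |t\<^sub>i - t\<^sub>j|)\<close>, where \<open>t\<^sub>i = log |x\<^sub>i|\<close>, and \<open>1 - exp (- t) \<le> t\<close>.\<close>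
lemma norm_sum_directions_le:
  "(cmod (\<Sum>i\<in>S. x i / of_real (cmod (x i))))\<^sup>2 \<le>
    (\<Sum>p\<in>S \<times> S. Re (pair_ratio p)) + 2 * real (card S) * (\<Sum>i\<in>S. \<bar>ln (cmod (x i))\<bar>)"
proof -
  define u where "u i = x i / of_real (cmod (x i))" for i
  define t where "t i = ln (cmod (x i))" for i
  have "of_real ((cmod (\<Sum>i\<in>S. u i))\<^sup>2) = (\<Sum>i\<in>S. u i) * cnj (\<Sum>i\<in>S. u i)"
    by (rule complex_norm_square)
  also have "\<dots> = (\<Sum>p\<in>S \<times> S. u (fst p) * cnj (u (snd p)))"
    by (simp add: sum_product sum.cartesian_product case_prod_beta)
  finally have "Re (of_real ((cmod (\<Sum>i\<in>S. u i))\<^sup>2)) = Re (\<Sum>p\<in>S \<times> S. u (fst p) * cnj (u (snd p)))"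
    by (rule arg_cong)
  then have "(cmod (\<Sum>i\<in>S. u i))\<^sup>2 = (\<Sum>p\<in>S \<times> S. Re (u (fst p) * cnj (u (snd p))))"
    by simp
  also have "\<dots> \<le> (\<Sum>p\<in>S \<times> S. Re (pair_ratio p) + (\<bar>t (fst p)\<bar> + \<bar>t (snd p)\<bar>))"
  proof (rule sum_mono)
    fix p assume p: "p \<in> S \<times> S"
    define i j where "i = fst p" and "j = snd p"
    have ij: "i \<in> S" "j \<in> S" using p by (auto simp: i_def j_def)
    have n: "cmod (x i) > 0" "cmod (x j) > 0" using nz ij by auto
    define \<rho> where "\<rho> = exp (- \<bar>t i - t j\<bar>)"
    have mn: "\<rho> * (pair_max p)\<^sup>2 = cmod (x i) * cmod (x j)"
    proof (cases "cmod (x i) \<le> cmod (x j)")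
      case True
      then have "t i \<le> t j" using n by (simp add: t_def)
      then have "\<rho> = exp (t i) / exp (t j)" by (simp add: \<rho>_def exp_diff)
      then show ?thesis using n True by (simp add: t_def pair_max_def power2_eq_square flip: i_def j_def)
    next
      case False
      then have "t j \<le> t i" using n by (simp add: t_def)
      then have "\<rho> = exp (t j) / exp (t i)" by (simp add: \<rho>_def exp_diff)
      then show ?thesis using n False by (simp add: t_def pair_max_def power2_eq_square flip: i_def j_def)
    qed
    have pm: "pair_max p > 0" by (rule pair_max_pos[OF p])
    have "pair_ratio p = of_real \<rho> * (u i * cnj (u j))"
    proof -
      have "of_real \<rho> = complex_of_real (cmod (x i) * cmod (x j)) / of_real ((pair_max p)\<^sup>2)"
        unfolding mn[symmetric] using pm by simp
      then show ?thesis using n by (simp add: pair_ratio_def u_def field_simps flip: i_def j_def)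
    qed
    then have re: "Re (pair_ratio p) = \<rho> * Re (u i * cnj (u j))" by simp
    have "cmod (u i * cnj (u j)) = 1" using n by (simp add: u_def norm_mult norm_divide)
    then have le1: "Re (u i * cnj (u j)) \<le> 1" using complex_Re_le_cmod by metis
    have "1 - \<rho> \<le> \<bar>t i - t j\<bar>" unfolding \<rho>_def using exp_ge_add_one_self[of "- \<bar>t i - t j\<bar>"] by linarith
    moreover have "\<rho> \<le> 1" by (simp add: \<rho>_def)
    moreover have "(1 - \<rho>) * Re (u i * cnj (u j)) \<le> (1 - \<rho>) * 1"
      using le1 \<open>\<rho> \<le> 1\<close> by (intro mult_left_mono) auto
    ultimately have "Re (u i * cnj (u j)) - \<rho> * Re (u i * cnj (u j)) \<le> \<bar>t i\<bar> + \<bar>t j\<bar>"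
      using abs_triangle_ineq4[of "t i" "t j"] by (simp only: left_diff_distrib mult_1 mult_1_right)
    then show "Re (u (fst p) * cnj (u (snd p))) \<le> Re (pair_ratio p) + (\<bar>t (fst p)\<bar> + \<bar>t (snd p)\<bar>)"
      unfolding re i_def j_def by linarith
  qed
  also have "\<dots> = (\<Sum>p\<in>S \<times> S. Re (pair_ratio p)) + 2 * real (card S) * (\<Sum>i\<in>S. \<bar>t i\<bar>)"
  proof -
    have "(\<Sum>p\<in>S \<times> S. \<bar>t (fst p)\<bar> + \<bar>t (snd p)\<bar>) = (\<Sum>i\<in>S. \<Sum>j\<in>S. \<bar>t i\<bar> + \<bar>t j\<bar>)"
      by (simp add: sum.cartesian_product case_prod_beta)
    also have "\<dots> = 2 * real (card S) * (\<Sum>i\<in>S. \<bar>t i\<bar>)"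
      by (simp add: sum.distrib sum_distrib_left mult.assoc)
    finally show ?thesis by (simp add: sum.distrib)
  qed
  finally show ?thesis by (simp add: u_def t_def)
qed

end

section \<open>Averages of characters over a Galois orbit\<close>

lemma algebraic_int_rat_norm_ge_1:
  assumes "algebraic_int (x :: complex)" "x \<in> \<rat>" "x \<noteq> 0"
  shows "cmod x \<ge> 1"
proof -
  have "x \<in> \<int>" by (rule rational_algebraic_int_is_int[OF assms(1,2)])
  then obtain k where "x = of_int k" by (elim Ints_cases)
  moreover then have "k \<noteq> 0" using assms(3) by simp
  ultimately show ?thesis by simp
qed

lemma galois_int: "\<sigma> \<in> galois_Qbar \<Longrightarrow> \<sigma> (of_int k) = of_int k"
  by (rule galois_rat) simp_all

lemma map_poly_of_int_mult:
  "map_poly of_int (p * q) = (map_poly of_int p * map_poly of_int q :: complex poly)"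
  by (intro poly_eqI) (simp add: coeff_map_poly coeff_mult)

lemma map_poly_of_int_power:
  "map_poly of_int (p ^ n) = (map_poly of_int p ^ n :: complex poly)"
  by (induction n) (simp_all add: map_poly_of_int_mult)

context
  fixes \<xi> :: "complex ^ 'n"
  assumes xi: "\<And>j. algebraic (\<xi> $ j)" and xi0: "\<And>j. \<xi> $ j \<noteq> 0"
begin

lemma orbit_nonzero: "\<alpha> \<in> galois_orbit \<xi> \<Longrightarrow> \<alpha> $ j \<noteq> 0"
  unfolding galois_orbit_def using galois_eq_0[OF _ xi] xi0 by auto

lemma card_orbit_pos: "card (galois_orbit \<xi>) > 0"
  using finite_orbit[OF xi] orbit_self[of \<xi>, OF xi] by (auto simp: card_gt_0_iff)

text \<open>The polynomial with the roots \<open>\<alpha>\<^sub>j\<close>, \<open>\<alpha>\<close> in the orbit, is the power of the minimal polynomial of \<open>\<xi>\<^sub>j\<close> whose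
exponent is the size \<open>e\<close> of the fibres. The denominator \<open>c\<close> is its leading coefficient, and the height
of \<open>\<xi>\<^sub>j\<close> is its logarithmic Mahler measure divided by its degree.\<close>
lemma coordinate_denominator:
  obtains c :: int where "c \<ge> 1"
    "\<And>B. B \<subseteq> galois_orbit \<xi> \<Longrightarrow> algebraic_int (of_int c * (\<Prod>\<alpha>\<in>B. \<alpha> $ j))"
    "real (card (galois_orbit \<xi>)) * weil_height (\<xi> $ j) = ln (of_int c) + (\<Sum>\<alpha>\<in>galois_orbit \<xi>. log_plus (cmod (\<alpha> $ j)))"
proof -
  let ?S = "galois_orbit \<xi>" and ?p = "min_int_poly (\<xi> $ j)"
  let ?P = "map_poly of_int ?p :: complex poly"
  define R where "R = {y. poly ?P y = 0}"
  have eqv: "(gal_act \<sigma> \<alpha>) $ j = \<sigma> (\<alpha> $ j)" for \<sigma> \<alpha> by (simp add: gal_act_def)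
  note fib = equivariant_fibres[OF xi, where x = "\<lambda>\<alpha>. \<alpha> $ j", OF orbit_algebraic[OF xi] eqv, folded R_def]
  obtain e where e: "e > 0" "\<And>y. y \<in> R \<Longrightarrow> card {\<alpha>\<in>?S. \<alpha> $ j = y} = e" "card ?S = e * alg_degree (\<xi> $ j)"
    using fib(2) by blast
  have fS: "finite ?S" by (rule finite_orbit[OF xi])
  have fR: "finite R" unfolding R_def by (rule min_int_poly_root_finite[OF xi])
  have img: "(\<lambda>\<alpha>. \<alpha> $ j) ` ?S = R" by (rule fib(1))
  define c where "c = lead_coeff ?p ^ e"
  have l1: "lead_coeff ?p \<ge> 1" using min_int_poly_props[OF xi, of j] unfolding is_min_int_poly_def by simp
  have c1: "c \<ge> 1" unfolding c_def using l1 by (rule one_le_power)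
  have dec: "Polynomial.smult (of_int c) (\<Prod>\<alpha>\<in>?S. [:- (\<alpha> $ j), 1:]) = map_poly of_int (?p ^ e)"
  proof -
    have "(\<Prod>\<alpha>\<in>?S. [:- (\<alpha> $ j), 1:]) = (\<Prod>y\<in>R. \<Prod>\<alpha>\<in>{\<alpha>\<in>?S. \<alpha> $ j = y}. [:- (\<alpha> $ j), 1:])"
      by (rule prod.group[OF fS fR, symmetric]) (simp add: img)
    also have "\<dots> = (\<Prod>y\<in>R. [:- y, 1:] ^ e)"
      using e(2) by (intro prod.cong refl) simp
    also have "\<dots> = (\<Prod>y\<in>R. [:- y, 1:]) ^ e" by (rule prod_power_distrib[symmetric])
    finally have eq: "(\<Prod>\<alpha>\<in>?S. [:- (\<alpha> $ j), 1:]) = (\<Prod>y\<in>R. [:- y, 1:]) ^ e" .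
    have "Polynomial.smult (of_int (lead_coeff ?p)) (\<Prod>y\<in>R. [:- y, 1:]) = ?P"
      using complex_poly_decompose_rsquarefree[OF rsquarefree_min_int_poly[OF xi, of j]]
      by (simp add: R_def coeff_map_poly degree_map_poly)
    then have "?P ^ e = Polynomial.smult (of_int (lead_coeff ?p) ^ e) ((\<Prod>y\<in>R. [:- y, 1:]) ^ e)"
      by (metis smult_power)
    then show ?thesis unfolding map_poly_of_int_power eq c_def by simp
  qed
  have ai: "algebraic_int (of_int c * (\<Prod>\<alpha>\<in>B. \<alpha> $ j))" if "B \<subseteq> ?S" for B
    by (rule algebraic_int_lead_coeff_mult_prod_roots[OF fS that]) (simp add: dec coeff_map_poly)
  have "real (card ?S) * weil_height (\<xi> $ j) = real e * (real (alg_degree (\<xi> $ j)) * weil_height (\<xi> $ j))"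
    by (simp add: e(3))
  also have "\<dots> = real e * ln (of_int (lead_coeff ?p)) + real e * (\<Sum>y\<in>R. log_plus (cmod y))"
    unfolding weil_height_mult_degree[OF xi] R_def by (simp add: distrib_left)
  also have "real e * ln (of_int (lead_coeff ?p)) = ln (of_int c)"
    using l1 by (simp add: c_def ln_realpow)
  also have "real e * (\<Sum>y\<in>R. log_plus (cmod y)) = (\<Sum>\<alpha>\<in>?S. log_plus (cmod (\<alpha> $ j)))"
  proof -
    have "(\<Sum>\<alpha>\<in>?S. log_plus (cmod (\<alpha> $ j))) = (\<Sum>y\<in>R. \<Sum>\<alpha>\<in>{\<alpha>\<in>?S. \<alpha> $ j = y}. log_plus (cmod (\<alpha> $ j)))"
      by (rule sum.group[OF fS fR, symmetric]) (simp add: img)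
    also have "\<dots> = (\<Sum>y\<in>R. real e * log_plus (cmod y))"
      using e(2) by (intro sum.cong refl) simp
    finally show ?thesis by (simp add: sum_distrib_left)
  qed
  finally show ?thesis using that[OF c1 ai] by blast
qed

lemma log_plus_mult_le: "a > 0 \<Longrightarrow> b > 0 \<Longrightarrow> log_plus (a * b) \<le> log_plus a + log_plus b"
  by (simp add: log_plus_def ln_mult_pos)

lemma log_plus_prod_power_le:
  assumes "finite J" "\<And>j. j \<in> J \<Longrightarrow> a j > 0"
  shows "log_plus (\<Prod>j\<in>J. a j ^ k j) \<le> (\<Sum>j\<in>J. real (k j) * log_plus (a j))"
  using assms
proof (induction J rule: finite_induct)
  case empty
  then show ?case by (simp add: log_plus_def)
next
  case (insert x F)
  have "log_plus (a x ^ k x) = real (k x) * log_plus (a x)"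
    using insert.prems[of x] by (auto simp: log_plus_def ln_realpow max_def zero_le_mult_iff mult_le_0_iff)
  moreover have "log_plus (a x ^ k x * (\<Prod>j\<in>F. a j ^ k j)) \<le> log_plus (a x ^ k x) + log_plus (\<Prod>j\<in>F. a j ^ k j)"
    using insert.prems by (intro log_plus_mult_le) (auto intro!: prod_pos)
  ultimately show ?case using insert by simp
qed

text \<open>The same for \<open>1 / \<xi>\<^sub>j\<close> when the exponent \<open>n\<close> is negative. There the denominator is the leading coefficient
times the product of all roots, that is, the constant coefficient up to sign, and
\<open>log\<^sup>+ (1 / t) = log\<^sup>+ t - log t\<close> shows that the height does not change. As this denominator is a nonzero
integer, the sum of the \<open>log |\<alpha>\<^sub>j|\<close> is bounded below, and this gives the last estimate.\<close>
lemma signed_coordinate_denominator: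
  fixes n :: int and j :: 'n
  defines "y \<equiv> \<lambda>\<alpha> :: complex ^ 'n. if n \<ge> 0 then \<alpha> $ j else inverse (\<alpha> $ j)"
  shows "\<exists>c. (\<forall>\<sigma>\<in>galois_Qbar. \<sigma> c = c) \<and> algebraic c \<and> cmod c \<ge> 1 \<and>
    (\<forall>B. B \<subseteq> galois_orbit \<xi> \<longrightarrow> algebraic_int (c * (\<Prod>\<alpha>\<in>B. y \<alpha>))) \<and>
    ln (cmod c) + (\<Sum>\<alpha>\<in>galois_orbit \<xi>. log_plus (cmod (y \<alpha>))) = real (card (galois_orbit \<xi>)) * weil_height (\<xi> $ j)"
    and "(\<Sum>\<alpha>\<in>galois_orbit \<xi>. \<bar>ln (cmod (\<alpha> $ j))\<bar>) \<le> 2 * (real (card (galois_orbit \<xi>)) * weil_height (\<xi> $ j))"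
proof -
  let ?S = "galois_orbit \<xi>"
  have fS: "finite ?S" by (rule finite_orbit[OF xi])
  obtain c :: int where c: "c \<ge> 1"
    "\<And>B. B \<subseteq> ?S \<Longrightarrow> algebraic_int (of_int c * (\<Prod>\<alpha>\<in>B. \<alpha> $ j))"
    "real (card ?S) * weil_height (\<xi> $ j) = ln (of_int c) + (\<Sum>\<alpha>\<in>?S. log_plus (cmod (\<alpha> $ j)))"
    using coordinate_denominator[of j] by blast
  define c' where "c' = of_int c * (\<Prod>\<alpha>\<in>?S. \<alpha> $ j)"
  have c'0: "c' \<noteq> 0" using c(1) orbit_nonzero fS by (auto simp: c'_def)
  have ai': "algebraic_int c'" unfolding c'_def by (rule c(2)) simp
  have fix': "\<sigma> c' = c'" if s: "\<sigma> \<in> galois_Qbar" for \<sigma>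
  proof -
    have ap: "algebraic (\<Prod>\<alpha>\<in>?S. \<alpha> $ j)"
      by (intro algebraic_prod orbit_algebraic[OF xi])
    have "\<sigma> c' = of_int c * \<sigma> (\<Prod>\<alpha>\<in>?S. \<alpha> $ j)"
      unfolding c'_def using galois_mult[OF s algebraic_of_int ap, of c] galois_int[OF s, of c] by simp
    also have "\<sigma> (\<Prod>\<alpha>\<in>?S. \<alpha> $ j) = (\<Prod>\<alpha>\<in>?S. \<sigma> (\<alpha> $ j))"
      by (rule galois_prod[OF s]) (rule orbit_algebraic[OF xi])
    also have "\<dots> = (\<Prod>\<alpha>\<in>?S. (gal_act \<sigma> \<alpha>) $ j)" by (simp add: gal_act_def)
    also have "\<dots> = (\<Prod>\<alpha>\<in>?S. \<alpha> $ j)"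
      by (rule prod.reindex_bij_betw[OF bij_betw_gal_act[OF xi s]])
    finally show ?thesis by (simp add: c'_def)
  qed
  have "c' \<in> \<rat>" by (rule galois_fixed_imp_rat[OF algebraic_int_imp_algebraic[OF ai']]) (rule fix')
  then have n': "cmod c' \<ge> 1" by (rule algebraic_int_rat_norm_ge_1[OF ai' _ c'0])
  have lnc': "ln (cmod c') = ln (of_int c) + (\<Sum>\<alpha>\<in>?S. ln (cmod (\<alpha> $ j)))"
  proof -
    have "ln (cmod c') = ln (of_int c * (\<Prod>\<alpha>\<in>?S. cmod (\<alpha> $ j)))"
      unfolding c'_def norm_mult using c(1) by (simp add: prod_norm)
    also have "\<dots> = ln (of_int c) + ln (\<Prod>\<alpha>\<in>?S. cmod (\<alpha> $ j))"
      using c(1) orbit_nonzero by (intro ln_mult_pos prod_pos) auto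
    also have "ln (\<Prod>\<alpha>\<in>?S. cmod (\<alpha> $ j)) = (\<Sum>\<alpha>\<in>?S. ln (cmod (\<alpha> $ j)))"
      using orbit_nonzero fS by (intro ln_prod) auto
    finally show ?thesis .
  qed
  have lp: "log_plus (cmod (inverse (\<alpha> $ j))) = log_plus (cmod (\<alpha> $ j)) - ln (cmod (\<alpha> $ j))" if "\<alpha> \<in> ?S" for \<alpha>
    using orbit_nonzero[OF that, of j] by (simp add: log_plus_def norm_inverse ln_inverse max_def)
  show "\<exists>c. (\<forall>\<sigma>\<in>galois_Qbar. \<sigma> c = c) \<and> algebraic c \<and> cmod c \<ge> 1 \<and>
    (\<forall>B. B \<subseteq> ?S \<longrightarrow> algebraic_int (c * (\<Prod>\<alpha>\<in>B. y \<alpha>))) \<and>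
    ln (cmod c) + (\<Sum>\<alpha>\<in>?S. log_plus (cmod (y \<alpha>))) = real (card ?S) * weil_height (\<xi> $ j)"
  proof (cases "n \<ge> 0")
    case True
    then have y: "y \<alpha> = \<alpha> $ j" for \<alpha> by (simp add: y_def)
    show ?thesis unfolding y using c
      by (intro exI[of _ "of_int c"]) (simp add: galois_int)
  next
    case False
    then have y: "y \<alpha> = inverse (\<alpha> $ j)" for \<alpha> by (simp add: y_def)
    have "algebraic_int (c' * (\<Prod>\<alpha>\<in>B. inverse (\<alpha> $ j)))" if B: "B \<subseteq> ?S" for B
    proof -
      have "(\<Prod>\<alpha>\<in>?S. \<alpha> $ j) = (\<Prod>\<alpha>\<in>?S - B. \<alpha> $ j) * (\<Prod>\<alpha>\<in>B. \<alpha> $ j)"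
        by (rule prod.subset_diff[OF B fS])
      moreover have "(\<Prod>\<alpha>\<in>B. \<alpha> $ j) * (\<Prod>\<alpha>\<in>B. inverse (\<alpha> $ j)) = 1"
        using B orbit_nonzero unfolding prod.distrib[symmetric] by (intro prod.neutral) auto
      ultimately have "c' * (\<Prod>\<alpha>\<in>B. inverse (\<alpha> $ j)) = of_int c * (\<Prod>\<alpha>\<in>?S - B. \<alpha> $ j)"
        by (simp add: c'_def mult.assoc)
      then show ?thesis using c(2)[of "?S - B"] by simp
    qed
    moreover have "ln (cmod c') + (\<Sum>\<alpha>\<in>?S. log_plus (cmod (inverse (\<alpha> $ j)))) = real (card ?S) * weil_height (\<xi> $ j)"
      unfolding c(3) lnc' using lp by (simp add: sum_subtractf)
    ultimately show ?thesis unfolding y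
      using fix' n' algebraic_int_imp_algebraic[OF ai'] by (intro exI[of _ c']) simp
  qed
  have "(\<Sum>\<alpha>\<in>?S. \<bar>ln (cmod (\<alpha> $ j))\<bar>) = (\<Sum>\<alpha>\<in>?S. 2 * log_plus (cmod (\<alpha> $ j)) - ln (cmod (\<alpha> $ j)))"
    by (intro sum.cong refl) (simp add: log_plus_def max_def)
  also have "\<dots> = 2 * (\<Sum>\<alpha>\<in>?S. log_plus (cmod (\<alpha> $ j))) - (\<Sum>\<alpha>\<in>?S. ln (cmod (\<alpha> $ j)))"
    by (simp add: sum_subtractf sum_distrib_left)
  also have "\<dots> \<le> 2 * (\<Sum>\<alpha>\<in>?S. log_plus (cmod (\<alpha> $ j))) + 2 * ln (of_int c)"
  proof -
    have "0 \<le> ln (cmod c')" "0 \<le> ln (real_of_int c)" using n' c(1) by simp_all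
    then show ?thesis using lnc' by linarith
  qed
  finally show "(\<Sum>\<alpha>\<in>?S. \<bar>ln (cmod (\<alpha> $ j))\<bar>) \<le> 2 * (real (card ?S) * weil_height (\<xi> $ j))"
    unfolding c(3) by simp
qed

lemma weil_height_nonneg: "weil_height (\<xi> $ j) \<ge> 0"
proof -
  have "0 \<le> (\<Sum>\<alpha>\<in>galois_orbit \<xi>. \<bar>ln (cmod (\<alpha> $ j))\<bar>)" by (intro sum_nonneg) simp
  then have "0 \<le> real (card (galois_orbit \<xi>)) * weil_height (\<xi> $ j)"
    using signed_coordinate_denominator(2)[of j] by linarith
  then show ?thesis using card_orbit_pos by (simp add: zero_le_mult_iff)
qed

lemma torus_char_algebraic: "\<alpha> \<in> galois_orbit \<xi> \<Longrightarrow> algebraic (torus_char n \<alpha>)"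
  unfolding torus_char_def by (intro algebraic_prod algebraic_powi orbit_algebraic[OF xi])

lemma torus_char_equivariant:
  assumes s: "\<sigma> \<in> galois_Qbar" and a: "\<alpha> \<in> galois_orbit \<xi>"
  shows "torus_char n (gal_act \<sigma> \<alpha>) = \<sigma> (torus_char n \<alpha>)"
  unfolding torus_char_def galois_prod[OF s algebraic_powi[OF orbit_algebraic[OF xi a]]]
    galois_powi[OF s orbit_algebraic[OF xi a]]
  by (simp add: gal_act_def)

text \<open>The energy inequality with \<open>r = 1 - 1/d\<close>, where \<open>d\<close> is the number of distinct values. The upper bound for
the energy comes from the integrality of \<open>X\<close> below: \<open>A\<close> clears the denominators of every product of
distinct values \<open>x(\<alpha>)\<close>, and each \<open>\<alpha>\<close> occurs in \<open>2 q\<close> of the factors of \<open>Y\<close>.\<close>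
lemma mean_character_bound:
  fixes n :: "int ^ 'n"
  defines "x \<equiv> torus_char n" and "d \<equiv> alg_degree (torus_char n \<xi>)"
  defines "m \<equiv> real (card (galois_orbit \<xi>))" and "H \<equiv> (\<Sum>j\<in>UNIV. real (nat \<bar>n $ j\<bar>) * weil_height (\<xi> $ j))"
  shows "(cmod (\<Sum>\<alpha>\<in>galois_orbit \<xi>. x \<alpha> / of_real (cmod (x \<alpha>))))\<^sup>2 \<le> m\<^sup>2 * (6 * H + 2 * ln (2 * real d) / real d)"
proof -
  let ?S = "galois_orbit \<xi>"
  have fS: "finite ?S" by (rule finite_orbit[OF xi])
  have m0: "m > 0" unfolding m_def using card_orbit_pos by simp
  have x0: "x \<alpha> \<noteq> 0" if "\<alpha> \<in> ?S" for \<alpha>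
    unfolding x_def torus_char_def using orbit_nonzero[OF that] by simp
  interpret complex_family ?S x by standard (use fS x0 in auto)
  have H0: "H \<ge> 0" unfolding H_def using weil_height_nonneg by (intro sum_nonneg mult_nonneg_nonneg) auto
  \<comment> \<open>Replacing coordinates by their inverses where the exponent is negative makes all exponents nonnegative.\<close>
  define N where "N j = nat \<bar>n $ j\<bar>" for j
  define y where "y j \<alpha> = (if n $ j \<ge> 0 then \<alpha> $ j else inverse (\<alpha> $ j))" for j and \<alpha> :: "complex ^ 'n"
  have xy: "x \<alpha> = (\<Prod>j\<in>UNIV. y j \<alpha> ^ N j)" for \<alpha>
    unfolding x_def torus_char_def by (intro prod.cong refl) (simp add: power_int_def y_def N_def)
  have y0: "y j \<alpha> \<noteq> 0" if "\<alpha> \<in> ?S" for j \<alpha> using orbit_nonzero[OF that] by (simp add: y_def)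
  have "\<forall>j. \<exists>c. (\<forall>\<sigma>\<in>galois_Qbar. \<sigma> c = c) \<and> algebraic c \<and> cmod c \<ge> 1 \<and>
    (\<forall>B. B \<subseteq> ?S \<longrightarrow> algebraic_int (c * (\<Prod>\<alpha>\<in>B. y j \<alpha>))) \<and>
    ln (cmod c) + (\<Sum>\<alpha>\<in>?S. log_plus (cmod (y j \<alpha>))) = m * weil_height (\<xi> $ j)"
    unfolding y_def m_def using signed_coordinate_denominator(1) by blast
  then obtain c where c: "\<And>\<sigma> j. \<sigma> \<in> galois_Qbar \<Longrightarrow> \<sigma> (c j) = c j" "\<And>j. algebraic (c j)" "\<And>j. cmod (c j) \<ge> 1"
    "\<And>j B. B \<subseteq> ?S \<Longrightarrow> algebraic_int (c j * (\<Prod>\<alpha>\<in>B. y j \<alpha>))"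
    "\<And>j. ln (cmod (c j)) + (\<Sum>\<alpha>\<in>?S. log_plus (cmod (y j \<alpha>))) = m * weil_height (\<xi> $ j)"
    by metis
  define A where "A = (\<Prod>j\<in>UNIV. c j ^ N j)"
  have c0: "c j \<noteq> 0" for j using c(3)[of j] by auto
  have A0: "A \<noteq> 0" unfolding A_def using c0 by simp
  have Aint: "algebraic_int (A * (\<Prod>\<alpha>\<in>B. x \<alpha>))" if B: "B \<subseteq> ?S" for B
  proof -
    have "A * (\<Prod>\<alpha>\<in>B. x \<alpha>) = (\<Prod>j\<in>UNIV. (c j * (\<Prod>\<alpha>\<in>B. y j \<alpha>)) ^ N j)"
      unfolding xy A_def by (subst prod.swap) (simp add: prod.distrib power_mult_distrib prod_power_distrib)
    then show ?thesis using c(4)[OF B] by (auto intro!: algebraic_int_prod algebraic_int_power)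
  qed
  have xalg: "\<And>\<alpha>. \<alpha> \<in> ?S \<Longrightarrow> algebraic (x \<alpha>)" unfolding x_def by (rule torus_char_algebraic)
  have xeqv: "\<And>\<sigma> \<alpha>. \<sigma> \<in> galois_Qbar \<Longrightarrow> \<alpha> \<in> ?S \<Longrightarrow> x (gal_act \<sigma> \<alpha>) = \<sigma> (x \<alpha>)"
    unfolding x_def by (rule torus_char_equivariant)
  define R where "R = {v :: complex. poly (map_poly of_int (min_int_poly (x \<xi>))) v = 0}"
  have dx: "d = alg_degree (x \<xi>)" by (simp add: d_def x_def)
  note fib = equivariant_fibres[OF xi, where x = x, OF xalg xeqv, folded R_def dx]
  obtain e where e: "e > 0" "\<And>v. v \<in> R \<Longrightarrow> card {\<alpha>\<in>?S. x \<alpha> = v} = e" "card ?S = e * d"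
    using fib(2) by blast
  have fibre: "card {\<alpha>\<in>?S. x \<alpha> = x \<beta>} = e" if "\<beta> \<in> ?S" for \<beta>
    using e(2) fib(1) that by blast
  have d1: "d \<ge> 1" unfolding dx using alg_degree_pos[OF xalg[OF orbit_self[OF xi]]] by simp
  define q where "q = card ?S - e"
  have e_le: "e \<le> card ?S" using e(3) d1 by simp
  have offfib: "card {\<beta>\<in>?S. x \<alpha> \<noteq> x \<beta>} = q" if "\<alpha> \<in> ?S" for \<alpha>
  proof -
    have "{\<beta>\<in>?S. x \<alpha> \<noteq> x \<beta>} = ?S - {\<beta>\<in>?S. x \<beta> = x \<alpha>}" by auto
    then show ?thesis using fibre[OF that] fS by (simp add: card_Diff_subset q_def)
  qed
  have E_sub: "offdiag \<subseteq> ?S \<times> ?S" "finite offdiag"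
    using fS finite_subset[of offdiag "?S \<times> ?S"] by (auto simp: offdiag_def)
  have Efst: "card {p\<in>offdiag. fst p = \<alpha>} = q" and Esnd: "card {p\<in>offdiag. snd p = \<alpha>} = q" if a: "\<alpha> \<in> ?S" for \<alpha>
  proof -
    have "{p\<in>offdiag. fst p = \<alpha>} = Pair \<alpha> ` {\<beta>\<in>?S. x \<alpha> \<noteq> x \<beta>}" using a by (auto simp: offdiag_def)
    then show "card {p\<in>offdiag. fst p = \<alpha>} = q" using offfib[OF a] by (simp add: card_image inj_on_def)
    have "{p\<in>offdiag. snd p = \<alpha>} = (\<lambda>\<beta>. (\<beta>, \<alpha>)) ` {\<beta>\<in>?S. x \<alpha> \<noteq> x \<beta>}" using a by (auto simp: offdiag_def)
    then show "card {p\<in>offdiag. snd p = \<alpha>} = q" using offfib[OF a] by (simp add: card_image inj_on_def)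
  qed
  have sum_fst: "(\<Sum>p\<in>offdiag. f (fst p)) = real q * (\<Sum>\<alpha>\<in>?S. f \<alpha>)" for f :: "complex ^ 'n \<Rightarrow> real"
  proof -
    have "(\<Sum>p\<in>offdiag. f (fst p)) = (\<Sum>\<alpha>\<in>?S. \<Sum>p\<in>{p\<in>offdiag. fst p = \<alpha>}. f (fst p))"
      by (rule sum.group[OF E_sub(2) fS, symmetric]) (use E_sub in auto)
    also have "\<dots> = (\<Sum>\<alpha>\<in>?S. real q * f \<alpha>)" using Efst by (intro sum.cong refl) simp
    finally show ?thesis by (simp add: sum_distrib_left)
  qed
  have sum_snd: "(\<Sum>p\<in>offdiag. f (snd p)) = real q * (\<Sum>\<alpha>\<in>?S. f \<alpha>)" for f :: "complex ^ 'n \<Rightarrow> real"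
  proof -
    have "(\<Sum>p\<in>offdiag. f (snd p)) = (\<Sum>\<alpha>\<in>?S. \<Sum>p\<in>{p\<in>offdiag. snd p = \<alpha>}. f (snd p))"
      by (rule sum.group[OF E_sub(2) fS, symmetric]) (use E_sub in auto)
    also have "\<dots> = (\<Sum>\<alpha>\<in>?S. real q * f \<alpha>)" using Esnd by (intro sum.cong refl) simp
    finally show ?thesis by (simp add: sum_distrib_left)
  qed
  have cardE: "real (card offdiag) = real q * m"
    using sum_fst[of "\<lambda>_. 1"] by (simp add: m_def)
  define Y where "Y = (\<Prod>p\<in>offdiag. x (fst p) - x (snd p))"
  \<comment> \<open>A power of a discriminant with its denominators cleared.\<close>
  define X where "X = A ^ (2 * q) * Y"
  have X0: "X \<noteq> 0" unfolding X_def Y_def using A0 E_sub(2) by (auto simp: offdiag_def)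
  have Xint: "algebraic_int X"
    unfolding X_def Y_def
  proof (rule algebraic_int_prod_differences[OF fS Aint E_sub(1)])
    fix \<alpha> assume "\<alpha> \<in> ?S"
    then show "card {p\<in>offdiag. fst p = \<alpha>} + card {p\<in>offdiag. snd p = \<alpha>} \<le> 2 * q"
      using Efst[of \<alpha>] Esnd[of \<alpha>] by linarith
  qed
  \<comment> \<open>An automorphism permutes the factors of \<open>Y\<close>.\<close>
  have Xfix: "\<sigma> X = X" if s: "\<sigma> \<in> galois_Qbar" for \<sigma>
  proof -
    have Aalg: "algebraic A" unfolding A_def by (intro algebraic_prod algebraic_power c(2))
    have sA: "\<sigma> A = A"
      unfolding A_def galois_prod[OF s algebraic_power[OF c(2)]] galois_power[OF s c(2)] c(1)[OF s] ..
    have df: "algebraic (x (fst p) - x (snd p))" if "p \<in> offdiag" for p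
      using that E_sub(1) algebraic_add[OF xalg[of "fst p"], of "- x (snd p)"] xalg[of "snd p"] by auto
    have Yalg: "algebraic Y"
      unfolding Y_def by (rule algebraic_prod[OF df])
    have "\<sigma> Y = (\<Prod>p\<in>offdiag. \<sigma> (x (fst p) - x (snd p)))"
      unfolding Y_def by (rule galois_prod[OF s df])
    also have "\<dots> = (\<Prod>p\<in>offdiag. x (fst (map_prod (gal_act \<sigma>) (gal_act \<sigma>) p)) - x (snd (map_prod (gal_act \<sigma>) (gal_act \<sigma>) p)))"
    proof (rule prod.cong[OF refl])
      fix p assume "p \<in> offdiag"
      then have p: "fst p \<in> ?S" "snd p \<in> ?S" using E_sub(1) by auto
      show "\<sigma> (x (fst p) - x (snd p)) = x (fst (map_prod (gal_act \<sigma>) (gal_act \<sigma>) p)) - x (snd (map_prod (gal_act \<sigma>) (gal_act \<sigma>) p))"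
        using p by (simp add: galois_diff[OF s] xalg xeqv[OF s])
    qed
    also have "\<dots> = Y"
      unfolding Y_def
    proof (rule prod.reindex_bij_betw)
      show "bij_betw (map_prod (gal_act \<sigma>) (gal_act \<sigma>)) offdiag offdiag"
        unfolding bij_betw_def
      proof
        show inj: "inj_on (map_prod (gal_act \<sigma>) (gal_act \<sigma>)) offdiag"
          by (rule inj_on_subset[OF map_prod_inj_on[OF inj_on_gal_act[OF xi s] inj_on_gal_act[OF xi s]] E_sub(1)])
        show "map_prod (gal_act \<sigma>) (gal_act \<sigma>) ` offdiag = offdiag"
        proof (rule endo_inj_surj[OF E_sub(2) _ inj])
          show "map_prod (gal_act \<sigma>) (gal_act \<sigma>) ` offdiag \<subseteq> offdiag"
            by (auto simp: offdiag_def xeqv[OF s] galois_inj[OF s] xalg orbit_act[OF xi s])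
        qed
      qed
    qed
    finally have sY: "\<sigma> Y = Y" .
    show ?thesis unfolding X_def galois_mult[OF s algebraic_power[OF Aalg] Yalg] galois_power[OF s Aalg] sA sY ..
  qed
  have "X \<in> \<rat>" by (rule galois_fixed_imp_rat[OF algebraic_int_imp_algebraic[OF Xint]]) (rule Xfix)
  then have X1: "cmod X \<ge> 1" by (rule algebraic_int_rat_norm_ge_1[OF Xint _ X0])
  have lnA: "ln (cmod A) = (\<Sum>j\<in>UNIV. real (N j) * ln (cmod (c j)))"
  proof -
    have "ln (cmod A) = ln (\<Prod>j\<in>UNIV. cmod (c j) ^ N j)" by (simp add: A_def prod_norm[symmetric] norm_power)
    also have "\<dots> = (\<Sum>j\<in>UNIV. ln (cmod (c j) ^ N j))" using c0 by (intro ln_prod) auto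
    finally show ?thesis using c0 by (simp add: ln_realpow)
  qed
  have lnX: "0 \<le> 2 * real q * ln (cmod A) + (\<Sum>p\<in>offdiag. ln (cmod (x (fst p) - x (snd p))))"
  proof -
    have pos: "cmod (x (fst p) - x (snd p)) > 0" if "p \<in> offdiag" for p using that by (auto simp: offdiag_def)
    have "ln (cmod X) = ln (cmod A ^ (2 * q) * (\<Prod>p\<in>offdiag. cmod (x (fst p) - x (snd p))))"
      by (simp add: X_def Y_def norm_mult norm_power prod_norm)
    also have "\<dots> = ln (cmod A ^ (2 * q)) + ln (\<Prod>p\<in>offdiag. cmod (x (fst p) - x (snd p)))"
      using A0 pos by (intro ln_mult_pos prod_pos) auto
    also have "ln (\<Prod>p\<in>offdiag. cmod (x (fst p) - x (snd p))) = (\<Sum>p\<in>offdiag. ln (cmod (x (fst p) - x (snd p))))"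
      using E_sub(2) pos by (intro ln_prod) auto
    also have "ln (cmod A ^ (2 * q)) = 2 * real q * ln (cmod A)" using A0 by (simp add: ln_realpow)
    finally show ?thesis using ln_ge_zero[OF X1] by linarith
  qed
  have lpx: "log_plus (cmod (x \<alpha>)) \<le> (\<Sum>j\<in>UNIV. real (N j) * log_plus (cmod (y j \<alpha>)))" if a: "\<alpha> \<in> ?S" for \<alpha>
  proof -
    have "cmod (x \<alpha>) = (\<Prod>j\<in>UNIV. cmod (y j \<alpha>) ^ N j)" by (simp add: xy prod_norm[symmetric] norm_power)
    then show ?thesis using y0[OF a] by (auto intro!: log_plus_prod_power_le)
  qed
  have mH: "ln (cmod A) + (\<Sum>\<alpha>\<in>?S. log_plus (cmod (x \<alpha>))) \<le> m * H"
  proof -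
    have "(\<Sum>\<alpha>\<in>?S. log_plus (cmod (x \<alpha>))) \<le> (\<Sum>\<alpha>\<in>?S. \<Sum>j\<in>UNIV. real (N j) * log_plus (cmod (y j \<alpha>)))"
      by (rule sum_mono[OF lpx])
    also have "\<dots> = (\<Sum>j\<in>UNIV. real (N j) * (\<Sum>\<alpha>\<in>?S. log_plus (cmod (y j \<alpha>))))"
      by (subst sum.swap) (simp add: sum_distrib_left)
    finally have "ln (cmod A) + (\<Sum>\<alpha>\<in>?S. log_plus (cmod (x \<alpha>)))
        \<le> (\<Sum>j\<in>UNIV. real (N j) * (ln (cmod (c j)) + (\<Sum>\<alpha>\<in>?S. log_plus (cmod (y j \<alpha>)))))"
      unfolding lnA by (simp add: sum.distrib distrib_left)
    also have "\<dots> = m * H" unfolding c(5) H_def N_def by (simp add: sum_distrib_left mult_ac)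
    finally show ?thesis .
  qed
  have energy: "(\<Sum>p\<in>offdiag. ln (pair_max p) - ln (cmod (x (fst p) - x (snd p)))) \<le> 2 * real q * (m * H)"
  proof -
    have "ln (pair_max p) \<le> log_plus (cmod (x (fst p))) + log_plus (cmod (x (snd p)))" for p
      by (auto simp: pair_max_def log_plus_def max_def)
    then have "(\<Sum>p\<in>offdiag. ln (pair_max p)) \<le> (\<Sum>p\<in>offdiag. log_plus (cmod (x (fst p))) + log_plus (cmod (x (snd p))))"
      by (intro sum_mono)
    also have "\<dots> = 2 * real q * (\<Sum>\<alpha>\<in>?S. log_plus (cmod (x \<alpha>)))"
      using sum_fst[of "\<lambda>\<alpha>. log_plus (cmod (x \<alpha>))"] sum_snd[of "\<lambda>\<alpha>. log_plus (cmod (x \<alpha>))"] by (simp add: sum.distrib)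
    finally have "(\<Sum>p\<in>offdiag. ln (pair_max p) - ln (cmod (x (fst p) - x (snd p)))) \<le> 2 * real q * (ln (cmod A) + (\<Sum>\<alpha>\<in>?S. log_plus (cmod (x \<alpha>))))"
      using lnX unfolding sum_subtractf distrib_left by linarith
    also have "\<dots> \<le> 2 * real q * (m * H)" using mH by (intro mult_left_mono) auto
    finally show ?thesis .
  qed
  have radial: "(\<Sum>\<alpha>\<in>?S. \<bar>ln (cmod (x \<alpha>))\<bar>) \<le> 2 * (m * H)"
  proof -
    have "\<bar>ln (cmod (x \<alpha>))\<bar> \<le> (\<Sum>j\<in>UNIV. real (N j) * \<bar>ln (cmod (\<alpha> $ j))\<bar>)" if a: "\<alpha> \<in> ?S" for \<alpha>
    proof -
      have "ln (cmod (x \<alpha>)) = ln (\<Prod>j\<in>UNIV. cmod (y j \<alpha>) ^ N j)" by (simp add: xy prod_norm[symmetric] norm_power)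
      also have "\<dots> = (\<Sum>j\<in>UNIV. ln (cmod (y j \<alpha>) ^ N j))" using y0[OF a] by (intro ln_prod) auto
      finally have "\<bar>ln (cmod (x \<alpha>))\<bar> \<le> (\<Sum>j\<in>UNIV. \<bar>ln (cmod (y j \<alpha>) ^ N j)\<bar>)" by simp
      also have "\<dots> = (\<Sum>j\<in>UNIV. real (N j) * \<bar>ln (cmod (\<alpha> $ j))\<bar>)"
        using y0[OF a] orbit_nonzero[OF a]
        by (intro sum.cong refl) (simp add: ln_realpow abs_mult y_def norm_inverse ln_inverse)
      finally show ?thesis .
    qed
    then have "(\<Sum>\<alpha>\<in>?S. \<bar>ln (cmod (x \<alpha>))\<bar>) \<le> (\<Sum>\<alpha>\<in>?S. \<Sum>j\<in>UNIV. real (N j) * \<bar>ln (cmod (\<alpha> $ j))\<bar>)"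
      by (rule sum_mono)
    also have "\<dots> = (\<Sum>j\<in>UNIV. real (N j) * (\<Sum>\<alpha>\<in>?S. \<bar>ln (cmod (\<alpha> $ j))\<bar>))"
      by (subst sum.swap) (simp add: sum_distrib_left)
    also have "\<dots> \<le> (\<Sum>j\<in>UNIV. real (N j) * (2 * (m * weil_height (\<xi> $ j))))"
      unfolding m_def by (intro sum_mono mult_left_mono signed_coordinate_denominator(2)) auto
    also have "\<dots> = 2 * (m * H)" unfolding H_def N_def by (simp add: sum_distrib_left mult_ac)
    finally show ?thesis .
  qed
  show ?thesis
  proof (cases "d = 1")
    case True
    have "cmod (\<Sum>\<alpha>\<in>?S. x \<alpha> / of_real (cmod (x \<alpha>))) \<le> (\<Sum>\<alpha>\<in>?S. cmod (x \<alpha> / of_real (cmod (x \<alpha>))))"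
      by (rule norm_sum)
    also have "\<dots> = m" unfolding m_def using x0 by (simp add: norm_divide)
    finally have "(cmod (\<Sum>\<alpha>\<in>?S. x \<alpha> / of_real (cmod (x \<alpha>))))\<^sup>2 \<le> m\<^sup>2 * 1"
      by (simp add: power_mono)
    also have "\<dots> \<le> m\<^sup>2 * (6 * H + 2 * ln (2 * real d) / real d)"
      using H0 True ln2_ge_two_thirds by (intro mult_left_mono) auto
    finally show ?thesis .
  next
    case False
    then have d2: "real d \<ge> 2" using d1 by simp
    define r where "r = 1 - 1 / real d"
    have r: "0 < r" "r < 1" using d2 by (auto simp: r_def field_simps)
    have qr: "real q = r * m" using e_le d2 e(3) by (simp add: q_def r_def m_def of_nat_diff field_simps)
    have "r * (\<Sum>p\<in>?S \<times> ?S. Re (pair_ratio p)) \<le> 2 * (r * m) * (m * H) + r * m * m * ln (2 / (1 + r)) + (m * m - r * m * m) * ln (1 / (1 - r))"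
      using energy_inequality[OF r] energy unfolding cardE qr by (simp add: m_def)
    also have "\<dots> = r * (m\<^sup>2 * (2 * H + ln (2 / (1 + r)) + (1 - r) / r * ln (1 / (1 - r))))"
      using r by (simp add: power2_eq_square field_simps)
    finally have pzle: "(\<Sum>p\<in>?S \<times> ?S. Re (pair_ratio p)) \<le> m\<^sup>2 * (2 * H + ln (2 / (1 + r)) + (1 - r) / r * ln (1 / (1 - r)))"
      using r by simp
    have "ln (2 / (1 + r)) + (1 - r) / r * ln (1 / (1 - r)) \<le> 2 * ln (2 * real d) / real d"
    proof -
      have "ln (2 / (1 + r)) \<le> 2 / (1 + r) - 1" using r by (intro ln_le_minus_one) auto
      also have "\<dots> = 1 / (2 * real d - 1)" using d2 by (simp add: r_def field_simps)
      also have "\<dots> \<le> 1 / real d" using d2 by (intro divide_left_mono) auto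
      also have "\<dots> \<le> 2 * ln 2 / real d" using ln2_ge_two_thirds d2 by (intro divide_right_mono) auto
      finally have a: "ln (2 / (1 + r)) \<le> 2 * ln 2 / real d" .
      have "(1 - r) / r = 1 / (real d - 1)" using d2 by (simp add: r_def field_simps)
      also have "\<dots> \<le> 2 / real d" using d2 by (simp add: field_simps)
      finally have "(1 - r) / r * ln (real d) \<le> 2 / real d * ln (real d)" using d2 by (intro mult_right_mono) auto
      moreover have "1 / (1 - r) = real d" by (simp add: r_def)
      moreover have "ln (2 * real d) = ln 2 + ln (real d)" using d2 by (intro ln_mult_pos) auto
      ultimately show ?thesis using a by (simp add: add_divide_distrib)
    qed
    then have "m\<^sup>2 * (2 * H + ln (2 / (1 + r)) + (1 - r) / r * ln (1 / (1 - r))) \<le> m\<^sup>2 * (2 * H + 2 * ln (2 * real d) / real d)"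
      by (intro mult_left_mono) auto
    moreover have "2 * real (card ?S) * (\<Sum>\<alpha>\<in>?S. \<bar>ln (cmod (x \<alpha>))\<bar>) \<le> m\<^sup>2 * (4 * H)"
    proof -
      have "2 * m * (\<Sum>\<alpha>\<in>?S. \<bar>ln (cmod (x \<alpha>))\<bar>) \<le> 2 * m * (2 * (m * H))"
        using radial m0 by (intro mult_left_mono) auto
      then show ?thesis by (simp add: m_def power2_eq_square mult_ac)
    qed
    ultimately have "(cmod (\<Sum>\<alpha>\<in>?S. x \<alpha> / of_real (cmod (x \<alpha>))))\<^sup>2 \<le> m\<^sup>2 * (2 * H + 2 * ln (2 * real d) / real d) + m\<^sup>2 * (4 * H)"
      using norm_sum_directions_le pzle by linarith
    then show ?thesis by (simp add: algebra_simps)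
  qed
qed

end

section \<open>Trapezoidal majorants of arcs and their Fourier coefficients\<close>

text \<open>The second Bernoulli polynomial, made periodic.\<close>
definition bern2 :: "real \<Rightarrow> real" where
  "bern2 x = (frac x)\<^sup>2 - frac x + 1 / 6"

text \<open>The Abel means of the Fourier series of \<open>\<pi>\<^sup>2 bern2\<close> at \<open>t / (2 \<pi>)\<close>. Division by 0 gives 0, so the term
\<open>n = 0\<close> vanishes.\<close>
definition abel_cos_sum :: "real \<Rightarrow> real \<Rightarrow> real" where
  "abel_cos_sum r t = (\<Sum>n. r ^ n * cos (real n * t) / (real n)\<^sup>2)"

lemma summable_inverse_squares: "summable (\<lambda>n. 1 / (real n)\<^sup>2)"
  using inverse_power_summable[of 2, where 'a=real] by (simp add: divide_inverse power_inverse)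

lemma abel_cos_sum_term_le: "0 \<le> r \<Longrightarrow> r \<le> 1 \<Longrightarrow> norm (r ^ n * cos (real n * t) / (real n)\<^sup>2) \<le> 1 / (real n)\<^sup>2"
proof -
  assume "0 \<le> r" "r \<le> 1"
  then have "r ^ n * \<bar>cos (real n * t)\<bar> \<le> 1 * 1" by (intro mult_mono power_le_one) auto
  then show ?thesis using \<open>0 \<le> r\<close> by (simp add: abs_mult divide_right_mono)
qed

lemma abel_cos_sum_summable: "0 \<le> r \<Longrightarrow> r \<le> 1 \<Longrightarrow> summable (\<lambda>n. r ^ n * cos (real n * t) / (real n)\<^sup>2)"
  by (rule summable_comparison_test[OF _ summable_inverse_squares]) (use abel_cos_sum_term_le in blast)

lemma continuous_on_abel_cos_sum_angle: "continuous_on UNIV (abel_cos_sum 1)"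
proof -
  have "uniform_limit UNIV (\<lambda>n t. \<Sum>i<n. 1 ^ i * cos (real i * t) / (real i)\<^sup>2) (abel_cos_sum 1) sequentially"
    unfolding abel_cos_sum_def using abel_cos_sum_term_le[of 1]
    by (intro Weierstrass_m_test[OF _ summable_inverse_squares]) auto
  then show ?thesis
    by (rule uniform_limit_theorem[rotated]) (auto intro!: always_eventually continuous_intros simp: divide_inverse)
qed

lemma continuous_on_abel_cos_sum_radius: "continuous_on {0..1} (\<lambda>r. abel_cos_sum r t)"
proof -
  have "uniform_limit {0..1} (\<lambda>n r. \<Sum>i<n. r ^ i * cos (real i * t) / (real i)\<^sup>2) (\<lambda>r. abel_cos_sum r t) sequentially"
    unfolding abel_cos_sum_def using abel_cos_sum_term_le
    by (intro Weierstrass_m_test[OF _ summable_inverse_squares]) auto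
  then show ?thesis
    by (rule uniform_limit_theorem[rotated]) (auto intro!: always_eventually continuous_intros simp: divide_inverse)
qed

text \<open>For \<open>r < 1\<close> the sum is the real part of the dilogarithm at \<open>r exp(\<i> t)\<close>, and \<open>z Li\<^sub>2'(z) = - log (1 - z)\<close>.\<close>
lemma abel_cos_sum_has_derivative:
  assumes r: "0 < r" "r < 1"
  shows "(abel_cos_sum r has_real_derivative Im (Ln (1 - of_real r * exp (\<i> * of_real t)))) (at t)"
proof -
  define c :: "nat \<Rightarrow> complex" where "c n = 1 / (of_nat n)\<^sup>2" for n
  define L where "L z = (\<Sum>n. c n * z ^ n)" for z
  define g where "g t = of_real r * exp (\<i> * of_real t)" for t :: real
  have ng: "cmod (g t) = r" for t using r by (simp add: g_def norm_mult norm_exp_i_times)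
  have nc: "norm (c n * z ^ n) \<le> 1 / (real n)\<^sup>2" if "cmod z \<le> 1" for n z
    using that by (simp add: c_def norm_mult norm_divide norm_power power_le_one divide_right_mono)
  have sm: "summable (\<lambda>n. c n * z ^ n)" if "cmod z \<le> 1" for z
    by (rule summable_comparison_test[OF _ summable_inverse_squares]) (use nc[OF that] in blast)
  have Re_L: "Re (L (g s)) = abel_cos_sum r s" for s
  proof -
    have "Re (L (g s)) = (\<Sum>n. Re (c n * g s ^ n))"
      unfolding L_def using sm[of "g s"] ng[of s] r by (subst Re_suminf) auto
    also have "(\<lambda>n. Re (c n * g s ^ n)) = (\<lambda>n. r ^ n * cos (real n * s) / (real n)\<^sup>2)"
    proof
      fix n
      have "g s ^ n = of_real (r ^ n) * cis (real n * s)"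
        by (simp add: g_def power_mult_distrib flip: exp_of_nat_mult cis_conv_exp) (simp add: Complex.DeMoivre flip: cis_conv_exp)
      then have "c n * g s ^ n = of_real (r ^ n / (real n)\<^sup>2) * cis (real n * s)"
        by (simp add: c_def)
      then show "Re (c n * g s ^ n) = r ^ n * cos (real n * s) / (real n)\<^sup>2" by simp
    qed
    finally show ?thesis by (simp add: abel_cos_sum_def)
  qed
  have dL: "(L has_field_derivative (\<Sum>n. diffs c n * g t ^ n)) (at (g t))"
    unfolding L_def using sm ng[of t] r by (intro termdiffs_strong'[of 1]) auto
  have "g t * (\<Sum>n. diffs c n * g t ^ n) = - Ln (1 - g t)"
  proof -
    have d: "diffs c n = 1 / of_nat (Suc n)" for n
      by (simp add: diffs_def c_def power2_eq_square del: of_nat_Suc)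
    have s: "(\<lambda>n. (-1) ^ Suc n / of_nat n * (- g t) ^ n) sums Ln (1 + - g t)"
      using ng[of t] r by (intro Ln_series) simp
    have "(\<lambda>n. - (g t ^ n / of_nat n)) sums Ln (1 - g t)"
    proof -
      have "(-1) ^ Suc n / of_nat n * (- g t) ^ n = - (g t ^ n / of_nat n)" for n
      proof -
        have "(-1) ^ Suc n * (- g t) ^ n = - (g t ^ n)" by (simp add: power_mult_distrib[symmetric])
        then show ?thesis by (simp add: divide_inverse mult_ac)
      qed
      then show ?thesis using s by (simp only: add_uminus_conv_diff)
    qed
    then have "(\<lambda>n. g t ^ n / of_nat n) sums (- Ln (1 - g t))"
      using sums_minus by fastforce
    then have "(\<lambda>n. g t ^ Suc n / of_nat (Suc n)) sums (- Ln (1 - g t))"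
      by (subst sums_Suc_iff) simp
    then have "(\<lambda>n. g t * (diffs c n * g t ^ n)) sums (- Ln (1 - g t))"
      by (simp add: d field_simps del: of_nat_Suc)
    then have "(\<Sum>n. g t * (diffs c n * g t ^ n)) = - Ln (1 - g t)" by (simp add: sums_iff)
    moreover have "summable (\<lambda>n. diffs c n * g t ^ n)"
      by (rule termdiff_converges[of _ 1]) (use ng[of t] r sm in auto)
    ultimately show ?thesis by (simp add: suminf_mult)
  qed
  moreover have dg: "(g has_vector_derivative (\<i> * g t)) (at t)"
  proof -
    have "((\<lambda>z. of_real r * exp (\<i> * z)) has_field_derivative (of_real r * (exp (\<i> * of_real t) * \<i>))) (at (of_real t))"
      by (auto intro!: derivative_eq_intros)
    then have "((\<lambda>x. of_real r * exp (\<i> * of_real x)) has_vector_derivative (of_real r * (exp (\<i> * of_real t) * \<i>))) (at t)"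
      by (rule has_vector_derivative_real_field)
    then show ?thesis by (simp add: g_def[abs_def] mult_ac)
  qed
  ultimately have "((L \<circ> g) has_vector_derivative (\<i> * (- Ln (1 - g t)))) (at t)"
    using field_vector_diff_chain_at[OF dg dL] by (simp add: mult.assoc)
  then have "((\<lambda>s. Re ((L \<circ> g) s)) has_vector_derivative Re (\<i> * (- Ln (1 - g t)))) (at t)"
    by (rule bounded_linear.has_vector_derivative[OF bounded_linear_Re])
  moreover have "(\<lambda>s. Re ((L \<circ> g) s)) = abel_cos_sum r" by (simp add: fun_eq_iff Re_L)
  ultimately show ?thesis
    by (simp add: g_def has_real_derivative_iff_has_vector_derivative)
qed

lemma Im_Ln_one_minus_exp:
  assumes "0 < t" "t < 2 * pi"
  shows "Im (Ln (1 - exp (\<i> * of_real t))) = (t - pi) / 2"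
proof -
  have s: "sin (t / 2) > 0" using assms by (intro sin_gt_zero) auto
  have "of_real (2 * sin (t / 2)) * exp (\<i> * of_real ((t - pi) / 2)) = 1 - exp (\<i> * of_real t)"
  proof -
    have c: "cos t = 1 - 2 * (sin (t / 2))\<^sup>2" "sin t = 2 * sin (t / 2) * cos (t / 2)"
      using cos_double_sin[of "t / 2"] sin_double[of "t / 2"] by simp_all
    have "cos ((t - pi) / 2) = sin (t / 2)" "sin ((t - pi) / 2) = - cos (t / 2)"
      unfolding diff_divide_distrib by (simp_all add: cos_diff sin_diff)
    then show ?thesis
      unfolding cis_conv_exp[symmetric] by (simp add: complex_eq_iff c power2_eq_square)
  qed
  then have "Arg (1 - exp (\<i> * of_real t)) = (t - pi) / 2"
    by (rule Arg_unique) (use s assms pi_gt_zero in auto)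
  moreover have "1 - exp (\<i> * of_real t) \<noteq> 0"
  proof
    assume "1 - exp (\<i> * of_real t) = 0"
    then have "cis t = 1" by (simp add: cis_conv_exp)
    then have "cos t = 1" by (simp add: complex_eq_iff)
    then have "sin (t / 2) = 0" using cos_double_sin[of "t / 2"] by simp
    then show False using s by simp
  qed
  ultimately show ?thesis by (simp add: Arg_def)
qed

text \<open>For \<open>r < 1\<close> the derivative of the difference between the sum and the quadratic polynomial is
\<open>Im (Ln (1 - r exp(\<i> t))) - (t - \<pi>) / 2\<close>. This tends to 0 as \<open>r \<rightarrow> 1\<close>, uniformly on intervals that avoid the
multiples of \<open>2 \<pi>\<close>, so by the mean value theorem the difference is constant in the limit.\<close>
lemma abel_cos_sum_diff_const:
  assumes "0 < s" "s < t" "t < 2 * pi"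
  shows "abel_cos_sum 1 t - (t\<^sup>2 / 4 - pi * t / 2) = abel_cos_sum 1 s - (s\<^sup>2 / 4 - pi * s / 2)"
proof -
  define D where "D r u = abel_cos_sum r u - (u\<^sup>2 / 4 - pi * u / 2)" for r u
  define G where "G p = Im (Ln (1 - of_real (fst p) * exp (\<i> * of_real (snd p))))" for p :: "real \<times> real"
  let ?K = "{1/2..1} \<times> {s..t}"
  have np: "1 - of_real (fst p) * exp (\<i> * of_real (snd p)) \<notin> \<real>\<^sub>\<le>\<^sub>0" if p: "p \<in> ?K" for p
  proof
    assume "1 - of_real (fst p) * exp (\<i> * of_real (snd p)) \<in> \<real>\<^sub>\<le>\<^sub>0"
    then have "1 - fst p * cos (snd p) \<le> 0"
      by (simp add: complex_nonpos_Reals_iff flip: cis_conv_exp)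
    moreover have "cos (snd p) < 1"
    proof -
      have "sin (snd p / 2) > 0" using p assms by (intro sin_gt_zero) auto
      then show ?thesis using cos_double_sin[of "snd p / 2"] by simp
    qed
    moreover have "fst p * cos (snd p) < 1"
    proof (cases "cos (snd p) \<le> 0")
      case True
      then have "fst p * cos (snd p) \<le> 0" using p by (auto simp: mult_le_0_iff)
      then show ?thesis by simp
    next
      case False
      then have "fst p * cos (snd p) \<le> 1 * cos (snd p)" using p by (intro mult_right_mono) auto
      then show ?thesis using \<open>cos (snd p) < 1\<close> by simp
    qed
    ultimately show False by simp
  qed
  have "continuous_on ?K G"
    unfolding G_def using np by (intro continuous_intros) auto
  then have uc: "uniformly_continuous_on ?K G"
    by (intro compact_uniformly_continuous compact_Times) auto
  have bound: "\<bar>D 1 t - D 1 s\<bar> \<le> e * (t - s)" if e: "e > 0" for e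
  proof -
    obtain d where d: "d > 0" "\<And>p q. p \<in> ?K \<Longrightarrow> q \<in> ?K \<Longrightarrow> dist q p < d \<Longrightarrow> dist (G q) (G p) < e"
      using uc e unfolding uniformly_continuous_on_def by metis
    have le: "\<bar>D r t - D r s\<bar> \<le> e * (t - s)" if r: "max (1/2) (1 - d) < r" "r < 1" for r
    proof -
      have der: "(D r has_real_derivative (G (r, u) - (u - pi) / 2)) (at u)" for u
        unfolding D_def G_def using r
        by (auto intro!: derivative_eq_intros abel_cos_sum_has_derivative simp: field_simps)
      obtain u where u: "s < u" "u < t" "D r t - D r s = (t - s) * (G (r, u) - (u - pi) / 2)"
        using MVT2[OF assms(2) der] by blast
      have "G (1, u) = (u - pi) / 2"
        unfolding G_def using Im_Ln_one_minus_exp[of u] u assms by simp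
      moreover have "dist (G (r, u)) (G (1, u)) < e"
        using u r by (intro d(2)) (auto simp: dist_Pair_Pair dist_real_def)
      ultimately have "\<bar>G (r, u) - (u - pi) / 2\<bar> \<le> e" unfolding dist_real_def by linarith
      then have "\<bar>(t - s) * (G (r, u) - (u - pi) / 2)\<bar> \<le> (t - s) * e"
        unfolding abs_mult using assms by (intro mult_mono) auto
      then show ?thesis unfolding u(3) by (simp add: mult.commute)
    qed
    have lim: "((\<lambda>r. D r v) \<longlongrightarrow> D 1 v) (at_left 1)" for v
    proof -
      have "((\<lambda>r. abel_cos_sum r v) \<longlongrightarrow> abel_cos_sum 1 v) (at 1 within {0..1})"
        using continuous_on_abel_cos_sum_radius[of v] unfolding continuous_on_def by auto
      then have "((\<lambda>r. abel_cos_sum r v) \<longlongrightarrow> abel_cos_sum 1 v) (at_left 1)"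
        by (simp add: at_within_Icc_at_left)
      then show ?thesis unfolding D_def by (intro tendsto_intros)
    qed
    have "((\<lambda>r. \<bar>D r t - D r s\<bar>) \<longlongrightarrow> \<bar>D 1 t - D 1 s\<bar>) (at_left 1)"
      by (intro tendsto_intros lim)
    moreover have "eventually (\<lambda>r. \<bar>D r t - D r s\<bar> \<le> e * (t - s)) (at_left 1)"
      using d(1) le by (intro eventually_at_leftI[of "max (1/2) (1 - d)"]) auto
    ultimately show ?thesis by (intro tendsto_upperbound[OF _ _ trivial_limit_at_left_real]) auto
  qed
  have "D 1 t = D 1 s"
  proof (rule ccontr)
    assume "D 1 t \<noteq> D 1 s"
    then have "\<bar>D 1 t - D 1 s\<bar> / (2 * (t - s)) > 0" using assms by simp
    from bound[OF this] show False using assms \<open>D 1 t \<noteq> D 1 s\<close> by (simp add: field_simps)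
  qed
  then show ?thesis by (simp add: D_def)
qed

text \<open>The constant is found at \<open>t = 0\<close>, where the sum is \<open>\<pi>\<^sup>2 / 6\<close>.\<close>
lemma abel_cos_sum_eq:
  assumes "0 \<le> t" "t < 2 * pi"
  shows "abel_cos_sum 1 t = t\<^sup>2 / 4 - pi * t / 2 + pi\<^sup>2 / 6"
proof -
  have c0: "abel_cos_sum 1 0 = pi\<^sup>2 / 6"
  proof -
    have "(\<lambda>n. 1 / (real (Suc n))\<^sup>2) sums (pi\<^sup>2 / 6)" using inverse_squares_sums by (simp add: add.commute)
    then have "(\<lambda>n. 1 / (real n)\<^sup>2) sums (pi\<^sup>2 / 6)" by (subst (asm) sums_Suc_iff) simp
    then show ?thesis by (simp add: abel_cos_sum_def sums_iff)
  qed
  show ?thesis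
  proof (cases "t = 0")
    case True
    then show ?thesis using c0 by simp
  next
    case False
    then have t: "0 < t" using assms by simp
    define D where "D u = abel_cos_sum 1 u - (u\<^sup>2 / 4 - pi * u / 2)" for u
    have "isCont (abel_cos_sum 1) 0" using continuous_on_abel_cos_sum_angle by (simp add: continuous_on_eq_continuous_at)
    then have "isCont D 0" unfolding D_def by (intro continuous_intros) simp_all
    then have "(D \<longlongrightarrow> D 0) (at_right 0)"
      unfolding isCont_def by (rule filterlim_mono[OF _ order_refl at_le]) auto
    moreover have "eventually (\<lambda>s. D s = D t) (at_right 0)"
      using t assms abel_cos_sum_diff_const[of _ t] by (intro eventually_at_rightI[of 0 t]) (auto simp: D_def)
    ultimately have "((\<lambda>_. D t) \<longlongrightarrow> D 0) (at_right (0::real))"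
      by (rule Lim_transform_eventually)
    then have "D t = D 0" using tendsto_unique[OF trivial_limit_at_right_real tendsto_const] by blast
    then show ?thesis using c0 by (simp add: D_def)
  qed
qed

lemma bern2_sums: "(\<lambda>n. cos (2 * pi * real n * x) / (pi\<^sup>2 * (real n)\<^sup>2)) sums bern2 x"
proof -
  define t where "t = 2 * pi * frac x"
  have t: "0 \<le> t" "t < 2 * pi" using frac_lt_1[of x] by (auto simp: t_def)
  have "(\<lambda>n. 1 ^ n * cos (real n * t) / (real n)\<^sup>2) sums abel_cos_sum 1 t"
    unfolding abel_cos_sum_def by (intro summable_sums abel_cos_sum_summable) auto
  then have "(\<lambda>n. inverse (pi\<^sup>2) * (1 ^ n * cos (real n * t) / (real n)\<^sup>2)) sums (inverse (pi\<^sup>2) * abel_cos_sum 1 t)"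
    by (rule sums_mult)
  also have "inverse (pi\<^sup>2) * abel_cos_sum 1 t = bern2 x"
    unfolding abel_cos_sum_eq[OF t] by (simp add: t_def bern2_def field_simps power2_eq_square)
  also have "(\<lambda>n. inverse (pi\<^sup>2) * (1 ^ n * cos (real n * t) / (real n)\<^sup>2)) = (\<lambda>n. cos (2 * pi * real n * x) / (pi\<^sup>2 * (real n)\<^sup>2))"
  proof
    fix n
    have "cos (2 * pi * real n * x) = cos (real n * t + 2 * pi * of_int (int n * \<lfloor>x\<rfloor>))"
      by (simp add: t_def frac_def algebra_simps)
    also have "\<dots> = cos (real n * t)"
      using cos_int_2pin[of "int n * \<lfloor>x\<rfloor>"] sin_int_2pin[of "int n * \<lfloor>x\<rfloor>"] by (simp only: cos_add mult_1_right mult_zero_right diff_zero)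
    finally show "inverse (pi\<^sup>2) * (1 ^ n * cos (real n * t) / (real n)\<^sup>2) = cos (2 * pi * real n * x) / (pi\<^sup>2 * (real n)\<^sup>2)"
      by (simp add: field_simps)
  qed
  finally show ?thesis .
qed

text \<open>The primitive of the floor function that vanishes at 0. It is convex, and \<open>\<lfloor>x\<rfloor>\<close> and \<open>\<lceil>x\<rceil> - 1\<close> are subgradients
at \<open>x\<close>.\<close>
definition floor_primitive :: "real \<Rightarrow> real" where
  "floor_primitive x = of_int \<lfloor>x\<rfloor> * x - of_int \<lfloor>x\<rfloor> * (of_int \<lfloor>x\<rfloor> + 1) / 2"

lemma floor_primitive_ge: "floor_primitive x \<ge> of_int m * x - of_int m * (of_int m + 1) / 2"
proof -
  define n where "n = \<lfloor>x\<rfloor>"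
  have n: "of_int n \<le> x" "x < of_int n + 1" by (auto simp: n_def)
  have "(of_int n - of_int m) * (2 * x - (of_int n + of_int m + 1)) \<ge> 0"
  proof (cases "m \<le> n")
    case True
    show ?thesis
    proof (cases "m = n")
      case False
      then have "m + 1 \<le> n" using True by simp
      then have "of_int m + 1 \<le> (of_int n :: real)" by (metis of_int_1 of_int_add of_int_le_iff)
      then show ?thesis using n by (intro mult_nonneg_nonneg) auto
    qed simp
  next
    case False
    then have "n + 1 \<le> m" by simp
    then have "of_int n + 1 \<le> (of_int m :: real)" by (metis of_int_1 of_int_add of_int_le_iff)
    then show ?thesis using n by (intro mult_nonpos_nonpos) auto
  qed
  then show ?thesis by (simp add: floor_primitive_def n_def[symmetric] field_simps)
qed

lemma floor_primitive_ceiling: "floor_primitive x = of_int (\<lceil>x\<rceil> - 1) * x - of_int (\<lceil>x\<rceil> - 1) * (of_int (\<lceil>x\<rceil> - 1) + 1) / 2"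
proof (cases "x \<in> \<int>")
  case True
  then obtain n where "x = of_int n" by (elim Ints_cases)
  then show ?thesis by (simp add: floor_primitive_def field_simps)
next
  case False
  then have "\<lceil>x\<rceil> - 1 = \<lfloor>x\<rfloor>" by (metis add_diff_cancel_right' ceiling_altdef Ints_of_int)
  then show ?thesis by (simp add: floor_primitive_def)
qed

lemma floor_primitive_bern2: "floor_primitive x = (x\<^sup>2 - x + 1 / 6 - bern2 x) / 2"
  by (simp add: floor_primitive_def bern2_def frac_def field_simps power2_eq_square)

text \<open>The indicator of the points with a translate by an integer in \<open>[a, a + l]\<close>, replaced by a periodic
function with sides of slope \<open>K\<close> that vanishes outside the arc enlarged by \<open>1 / K\<close> at both ends. The two
differences of \<open>floor_primitive\<close> divided by \<open>1 / K\<close> are averages of the floor function, so the definition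
also covers arcs that overlap themselves after the enlargement; the values may then exceed 1.\<close>
definition trapezoid :: "real \<Rightarrow> real \<Rightarrow> real \<Rightarrow> real \<Rightarrow> real" where
  "trapezoid a l K x = K * (floor_primitive (x - a + 1 / K) - floor_primitive (x - a) - (floor_primitive (x - a - l) - floor_primitive (x - a - l - 1 / K)))"

text \<open>The subgradient inequality at \<open>x - a\<close> and at \<open>x - a - l\<close>. At the second point \<open>\<lceil>x - a - l\<rceil> - 1\<close> is used
and not the floor, because the arc contains its right end point.\<close>
lemma trapezoid_ge_int:
  assumes "K > 0"
  shows "trapezoid a l K x \<ge> of_int \<lfloor>x - a\<rfloor> - of_int (\<lceil>x - a - l\<rceil> - 1)"
proof -
  let ?y = "x - a" and ?z = "x - a - l"
  have "floor_primitive (?y + 1 / K) - floor_primitive ?y \<ge> of_int \<lfloor>?y\<rfloor> / K"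
    using floor_primitive_ge[of "\<lfloor>?y\<rfloor>" "?y + 1 / K"] unfolding floor_primitive_def[of ?y] by (simp add: field_simps)
  moreover have "floor_primitive ?z - floor_primitive (?z - 1 / K) \<le> of_int (\<lceil>?z\<rceil> - 1) / K"
  proof -
    define m where "m = (of_int (\<lceil>?z\<rceil> - 1) :: real)"
    have "m * (?z - 1 / K) = m * ?z - m / K" by (simp add: right_diff_distrib)
    then show ?thesis
      using floor_primitive_ge[of "\<lceil>?z\<rceil> - 1" "?z - 1 / K"] floor_primitive_ceiling[of ?z] unfolding m_def[symmetric] by linarith
  qed
  ultimately have "(of_int \<lfloor>?y\<rfloor> - of_int (\<lceil>?z\<rceil> - 1)) / K \<le> floor_primitive (?y + 1 / K) - floor_primitive ?y - (floor_primitive ?z - floor_primitive (?z - 1 / K))"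
    unfolding diff_divide_distrib by linarith
  then show ?thesis using assms unfolding trapezoid_def by (simp only: pos_divide_le_eq mult.commute)
qed

lemma trapezoid_nonneg:
  assumes "K > 0" "l \<ge> 0"
  shows "trapezoid a l K x \<ge> 0"
proof -
  have "\<lceil>x - a - l\<rceil> - 1 \<le> \<lfloor>x - a\<rfloor>" using assms(2) by linarith
  then have "of_int \<lfloor>x - a\<rfloor> - of_int (\<lceil>x - a - l\<rceil> - 1) \<ge> (0 :: real)" by simp
  then show ?thesis using trapezoid_ge_int[OF assms(1), of x a l] by linarith
qed

lemma trapezoid_ge_1:
  assumes "K > 0" "a \<le> x + of_int k" "x + of_int k \<le> a + l"
  shows "trapezoid a l K x \<ge> 1"
proof -
  have "\<lfloor>x - a\<rfloor> \<ge> - k" "\<lceil>x - a - l\<rceil> \<le> - k" using assms by linarith+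
  then have "\<lceil>x - a - l\<rceil> - 1 + 1 \<le> \<lfloor>x - a\<rfloor>" by linarith
  then have "of_int (\<lceil>x - a - l\<rceil> - 1) + 1 \<le> (of_int \<lfloor>x - a\<rfloor> :: real)" by (metis of_int_1 of_int_add of_int_le_iff)
  then show ?thesis using trapezoid_ge_int[OF assms(1), of x a l] by linarith
qed

definition cis2pi :: "real \<Rightarrow> complex" where "cis2pi x = cis (2 * pi * x)"

lemma cis2pi_add: "cis2pi (x + y) = cis2pi x * cis2pi y"
  by (simp add: cis2pi_def cis_mult ring_distribs)
lemma cis2pi_0 [simp]: "cis2pi 0 = 1" by (simp add: cis2pi_def)
lemma norm_cis2pi [simp]: "cmod (cis2pi x) = 1" by (simp add: cis2pi_def)

lemma norm_cis2pi_minus_1_le: "cmod (cis2pi x - 1) \<le> 2 * pi * \<bar>x\<bar>"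
proof -
  have "(cmod (cis y - 1))\<^sup>2 = (2 * sin (y / 2))\<^sup>2" for y
  proof -
    have "(cmod (cis y - 1))\<^sup>2 = (cos y - 1)\<^sup>2 + (sin y)\<^sup>2" by (simp add: cmod_power2)
    also have "\<dots> = 2 - 2 * cos y" using sin_cos_squared_add[of y] by (simp add: power2_eq_square algebra_simps)
    also have "\<dots> = (2 * sin (y / 2))\<^sup>2" using cos_double_sin[of "y / 2"] by (simp add: power2_eq_square)
    finally show ?thesis .
  qed
  from this[of "2 * pi * x"] have "(cmod (cis2pi x - 1))\<^sup>2 = (2 * \<bar>sin (pi * x)\<bar>)\<^sup>2"
    unfolding cis2pi_def by (simp add: power_mult_distrib mult.commute)
  then have "cmod (cis2pi x - 1) = 2 * \<bar>sin (pi * x)\<bar>"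
    by (rule power2_eq_imp_eq) simp_all
  also have "\<dots> \<le> 2 * \<bar>pi * x\<bar>" using abs_sin_x_le_abs_x[of "pi * x"] by simp
  finally show ?thesis by (simp add: abs_mult)
qed

definition bern2_coeff :: "int \<Rightarrow> real" where "bern2_coeff k = 1 / (2 * pi\<^sup>2 * (of_int k)\<^sup>2)"

lemma int_interval_Suc: "{- int (Suc R)..int (Suc R)} = insert (int (Suc R)) (insert (- int (Suc R)) {- int R..int R})"
  by auto

lemma bern2_partial_sum:
  "(\<Sum>k\<in>{- int R..int R}. of_real (bern2_coeff k) * cis2pi (of_int k * x)) = of_real (\<Sum>n\<le>R. cos (2 * pi * real n * x) / (pi\<^sup>2 * (real n)\<^sup>2))"
proof (induction R)
  case 0
  then show ?case by (simp add: bern2_coeff_def)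
next
  case (Suc R)
  have "of_real (bern2_coeff (int (Suc R))) * cis2pi (of_int (int (Suc R)) * x) + of_real (bern2_coeff (- int (Suc R))) * cis2pi (of_int (- int (Suc R)) * x)
     = of_real (cos (2 * pi * real (Suc R) * x) / (pi\<^sup>2 * (real (Suc R))\<^sup>2))"
    by (simp add: bern2_coeff_def cis2pi_def complex_eq_iff mult_ac del: of_nat_Suc)
  then show ?case
    unfolding int_interval_Suc using Suc.IH by (simp add: add_ac del: of_nat_Suc)
qed

lemma bern2_lim:
  "(\<lambda>R. \<Sum>k\<in>{- int R..int R}. of_real (bern2_coeff k) * cis2pi (of_int k * x)) \<longlonglongrightarrow> of_real (bern2 x)"
  unfolding bern2_partial_sum using bern2_sums[of x] by (intro tendsto_of_real) (simp add: sums_def_le)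

text \<open>Up to quadratic polynomials, whose contribution to the second difference is the constant \<open>l + 1 / K\<close>, the
function \<open>floor_primitive\<close> is \<open>- bern2 / 2\<close>. So the coefficients of the trapezoid are second differences
of those of \<open>bern2\<close>. The value \<open>bern2_coeff 0 = 0\<close> takes care of \<open>k = 0\<close>.\<close>
definition trap_coeff :: "real \<Rightarrow> real \<Rightarrow> real \<Rightarrow> int \<Rightarrow> complex" where
  "trap_coeff a l K k = (if k = 0 then of_real (l + 1 / K) else 0)
    - of_real (K / 2 * bern2_coeff k) * (cis2pi (of_int k * (1 / K - a)) - cis2pi (of_int k * (- a))
        - (cis2pi (of_int k * (- a - l)) - cis2pi (of_int k * (- a - l - 1 / K))))"

lemma trap_coeff_0: "trap_coeff a l K 0 = of_real (l + 1 / K)"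
  by (simp add: trap_coeff_def bern2_coeff_def)

lemma trapezoid_lim:
  assumes "K > 0"
  shows "(\<lambda>R. \<Sum>k\<in>{- int R..int R}. trap_coeff a l K k * cis2pi (of_int k * x)) \<longlonglongrightarrow> of_real (trapezoid a l K x)"
proof -
  let ?B = "\<lambda>y R. \<Sum>k\<in>{- int R..int R}. of_real (bern2_coeff k) * cis2pi (of_int k * y)"
  have eq: "(\<Sum>k\<in>{- int R..int R}. trap_coeff a l K k * cis2pi (of_int k * x))
     = of_real (l + 1 / K) - of_real (K / 2) * (?B (x - a + 1 / K) R - ?B (x - a) R - (?B (x - a - l) R - ?B (x - a - l - 1 / K) R))" for R
  proof -
    have e: "cis2pi (of_int k * c) * cis2pi (of_int k * x) = cis2pi (of_int k * (x + c))" for k c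
      by (simp add: cis2pi_add[symmetric] ring_distribs add.commute)
    have key: "trap_coeff a l K k * cis2pi (of_int k * x) = (if k = 0 then of_real (l + 1 / K) else 0)
      - of_real (K / 2) * (of_real (bern2_coeff k) * cis2pi (of_int k * (x - a + 1 / K)) - of_real (bern2_coeff k) * cis2pi (of_int k * (x - a))
         - (of_real (bern2_coeff k) * cis2pi (of_int k * (x - a - l)) - of_real (bern2_coeff k) * cis2pi (of_int k * (x - a - l - 1 / K))))" for k
    proof -
      have F: "cis2pi (of_int k * (x - a + 1 / K)) = cis2pi (of_int k * (1 / K - a)) * cis2pi (of_int k * x)"
        "cis2pi (of_int k * (x - a)) = cis2pi (of_int k * (- a)) * cis2pi (of_int k * x)"
        "cis2pi (of_int k * (x - a - l)) = cis2pi (of_int k * (- a - l)) * cis2pi (of_int k * x)"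
        "cis2pi (of_int k * (x - a - l - 1 / K)) = cis2pi (of_int k * (- a - l - 1 / K)) * cis2pi (of_int k * x)"
        unfolding e by (simp_all add: algebra_simps)
      show ?thesis
      proof (cases "k = 0")
        case True
        then show ?thesis by (simp add: trap_coeff_def bern2_coeff_def)
      next
        case False
        then show ?thesis unfolding F trap_coeff_def of_real_mult by (simp only: if_False) (simp only: algebra_simps mult_zero_left add_0)
      qed
    qed
    have delta: "(\<Sum>k\<in>{- int R..int R}. if k = 0 then of_real (l + 1 / K) else 0) = complex_of_real (l + 1 / K)"
      by (simp add: sum.delta)
    show ?thesis
      unfolding key sum_subtractf sum_distrib_left[symmetric] delta ..
  qed
  have "of_real (trapezoid a l K x) = of_real (l + 1 / K) - of_real (K / 2) * (of_real (bern2 (x - a + 1 / K)) - of_real (bern2 (x - a)) - (of_real (bern2 (x - a - l)) - complex_of_real (bern2 (x - a - l - 1 / K))))"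
  proof -
    have "trapezoid a l K x = (l + 1 / K) - (K / 2) * (bern2 (x - a + 1 / K) - bern2 (x - a) - (bern2 (x - a - l) - bern2 (x - a - l - 1 / K)))"
      unfolding trapezoid_def floor_primitive_bern2 using assms by (simp add: field_simps power2_eq_square)
    then show ?thesis by simp
  qed
  then show ?thesis
    unfolding eq by (simp only:) (intro tendsto_intros bern2_lim)
qed

text \<open>Two of the four exponentials at a time differ by a translation by \<open>1 / K\<close>. Estimating their difference
by \<open>2 \<pi> |k| / K\<close> gives the first bound, estimating it by 2 the second.\<close>
lemma norm_trap_coeff_le:
  assumes K: "K > 0" and k: "k \<noteq> 0"
  shows "cmod (trap_coeff a l K k) \<le> 1 / (pi * \<bar>of_int k\<bar>)" "cmod (trap_coeff a l K k) \<le> K / (pi\<^sup>2 * (of_int k)\<^sup>2)"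
proof -
  define e1 where "e1 = cis2pi (of_int k * (1 / K - a)) - cis2pi (of_int k * (- a))"
  define e2 where "e2 = cis2pi (of_int k * (- a - l)) - cis2pi (of_int k * (- a - l - 1 / K))"
  have "cmod (trap_coeff a l K k) = K / 2 * bern2_coeff k * cmod (e1 - e2)"
    using k K by (simp add: trap_coeff_def norm_mult e1_def e2_def bern2_coeff_def del: of_real_mult of_real_divide)
  also have "\<dots> \<le> K / 2 * bern2_coeff k * (cmod e1 + cmod e2)"
    using K by (intro mult_left_mono norm_triangle_ineq4) (simp add: bern2_coeff_def)
  finally have le: "cmod (trap_coeff a l K k) \<le> K / 2 * bern2_coeff k * (cmod e1 + cmod e2)" .
  have b: "bern2_coeff k \<ge> 0" by (simp add: bern2_coeff_def)
  have d: "cmod (cis2pi (u + of_int k / K) - cis2pi u) \<le> 2 * pi * (\<bar>of_int k\<bar> / K)" for u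
  proof -
    have "cis2pi (u + of_int k / K) - cis2pi u = cis2pi u * (cis2pi (of_int k / K) - 1)" by (simp add: cis2pi_add algebra_simps)
    then show ?thesis using norm_cis2pi_minus_1_le[of "of_int k / K"] K by (simp add: norm_mult)
  qed
  have "cmod e1 \<le> 2 * pi * (\<bar>of_int k\<bar> / K)" "cmod e2 \<le> 2 * pi * (\<bar>of_int k\<bar> / K)"
    using d[of "of_int k * (- a)"] d[of "of_int k * (- a - l - 1 / K)"] by (simp_all add: e1_def e2_def algebra_simps)
  then have "K / 2 * bern2_coeff k * (cmod e1 + cmod e2) \<le> K / 2 * bern2_coeff k * (4 * pi * (\<bar>of_int k\<bar> / K))"
    using K b by (intro mult_left_mono) auto
  also have "\<dots> = 1 / (pi * \<bar>of_int k\<bar>)"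
  proof -
    have "(of_int k)\<^sup>2 = \<bar>of_int k\<bar> * \<bar>of_int k :: real\<bar>" by (simp add: power2_eq_square)
    then show ?thesis using K k by (simp add: bern2_coeff_def field_simps power2_eq_square)
  qed
  finally show "cmod (trap_coeff a l K k) \<le> 1 / (pi * \<bar>of_int k\<bar>)" using le by simp
  have "cmod e1 \<le> 2" "cmod e2 \<le> 2"
    unfolding e1_def e2_def by (rule order_trans[OF norm_triangle_ineq4], simp)+
  then have "K / 2 * bern2_coeff k * (cmod e1 + cmod e2) \<le> K / 2 * bern2_coeff k * 4"
    using K b by (intro mult_left_mono) auto
  also have "\<dots> = K / (pi\<^sup>2 * (of_int k)\<^sup>2)" by (simp add: bern2_coeff_def)
  finally show "cmod (trap_coeff a l K k) \<le> K / (pi\<^sup>2 * (of_int k)\<^sup>2)" using le by linarith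
qed

lemma sum_int_interval:
  fixes f :: "int \<Rightarrow> 'a :: comm_monoid_add"
  shows "(\<Sum>k\<in>{- int R..int R}. f k) = f 0 + (\<Sum>n\<in>{1..R}. f (int n) + f (- int n))"
proof (induction R)
  case (Suc R)
  then show ?case unfolding int_interval_Suc by (simp add: add_ac del: of_nat_Suc)
qed simp

lemma harm_le_1_plus_ln: "n \<ge> 1 \<Longrightarrow> harm n \<le> 1 + ln (real n)"
proof (induction n rule: dec_induct)
  case base
  then show ?case by (simp add: harm_def)
next
  case (step n)
  have n: "real n > 0" using step by simp
  have "ln (real n / real (Suc n)) \<le> real n / real (Suc n) - 1"
    using n by (intro ln_le_minus_one) simp
  also have "\<dots> = - inverse (real (Suc n))" by (simp add: field_simps)
  also have "ln (real n / real (Suc n)) = ln (real n) - ln (real (Suc n))" using n by (simp add: ln_div)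
  finally show ?case using step.IH by (simp add: harm_Suc)
qed

text \<open>The first bound for the terms is used up to \<open>K\<close> and compared with the harmonic sum, the second one beyond
\<open>K\<close>, where \<open>1 / (n + 1)\<^sup>2\<close> telescopes against \<open>1 / n\<close>.\<close>
lemma sum_le_log:
  fixes a :: "nat \<Rightarrow> real"
  assumes K: "K \<ge> 1" and a0: "\<And>n. a n \<ge> 0"
    and a1: "\<And>n. n \<ge> 1 \<Longrightarrow> a n \<le> 1 / (pi * real n)"
    and a2: "\<And>n. n \<ge> 1 \<Longrightarrow> a n \<le> real K / (pi\<^sup>2 * (real n)\<^sup>2)"
  shows "(\<Sum>n\<in>{1..R}. a n) \<le> (1 + ln (real K)) / pi + 1 / pi\<^sup>2"
proof -
  have "(\<Sum>n\<in>{1..K}. a n) \<le> (\<Sum>n\<in>{1..K}. inverse (real n) / pi)"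
    using a1 by (intro sum_mono) (auto simp: field_simps)
  also have "\<dots> = harm K / pi" by (simp add: harm_def sum_divide_distrib)
  also have "harm K \<le> 1 + ln (real K)" using harm_le_1_plus_ln[OF K] .
  finally have base: "(\<Sum>n\<in>{1..K}. a n) \<le> (1 + ln (real K)) / pi" by (simp add: divide_right_mono)
  have tail: "(\<Sum>n\<in>{1..R}. a n) \<le> (1 + ln (real K)) / pi + real K / pi\<^sup>2 * (1 / real K - 1 / real R)" if "K \<le> R" for R
    using that
  proof (induction R rule: dec_induct)
    case base
    then show ?case using \<open>(\<Sum>n\<in>{1..K}. a n) \<le> (1 + ln (real K)) / pi\<close> by simp
  next
    case (step n)
    have n: "n \<ge> 1" using K step by simp
    have "1 / (real (Suc n))\<^sup>2 \<le> 1 / real n - 1 / real (Suc n)"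
    proof -
      have "1 / real n - 1 / real (Suc n) = 1 / (real n * real (Suc n))" using n by (simp add: field_simps)
      moreover have "1 / (real (Suc n) * real (Suc n)) \<le> 1 / (real n * real (Suc n))"
        using n by (intro divide_left_mono mult_right_mono mult_pos_pos) auto
      ultimately show ?thesis by (simp only: power2_eq_square)
    qed
    then have "real K / pi\<^sup>2 * (1 / (real (Suc n))\<^sup>2) \<le> real K / pi\<^sup>2 * (1 / real n - 1 / real (Suc n))"
      by (intro mult_left_mono) auto
    moreover have "a (Suc n) \<le> real K / pi\<^sup>2 * (1 / (real (Suc n))\<^sup>2)" using a2[of "Suc n"] by simp
    moreover have "(\<Sum>n\<in>{1..Suc n}. a n) = (\<Sum>n\<in>{1..n}. a n) + a (Suc n)" by simp
    ultimately have "(\<Sum>n\<in>{1..Suc n}. a n) \<le> (1 + ln (real K)) / pi + (real K / pi\<^sup>2 * (1 / real K - 1 / real n) + real K / pi\<^sup>2 * (1 / real n - 1 / real (Suc n)))"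
      using step.IH by linarith
    also have "real K / pi\<^sup>2 * (1 / real K - 1 / real n) + real K / pi\<^sup>2 * (1 / real n - 1 / real (Suc n)) = real K / pi\<^sup>2 * (1 / real K - 1 / real (Suc n))"
      unfolding distrib_left[symmetric] by simp
    finally show ?case .
  qed
  have "(\<Sum>n\<in>{1..R}. a n) \<le> (\<Sum>n\<in>{1..max R K}. a n)"
    using a0 by (intro sum_mono2) auto
  also have "\<dots> \<le> (1 + ln (real K)) / pi + real K / pi\<^sup>2 * (1 / real K - 1 / real (max R K))"
    by (rule tail) simp
  also have "real K / pi\<^sup>2 * (1 / real K - 1 / real (max R K)) \<le> real K / pi\<^sup>2 * (1 / real K)"
    by (intro mult_left_mono) auto
  finally show ?thesis using K by simp
qed

text \<open>As before, with the telescoping bounds \<open>(n + 1)\<^sup>-\<^sup>1\<^sup>/\<^sup>2 \<le> 2 ((n + 1)\<^sup>1\<^sup>/\<^sup>2 - n\<^sup>1\<^sup>/\<^sup>2)\<close> up to \<open>K\<close> and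
\<open>(n + 1)\<^sup>-\<^sup>3\<^sup>/\<^sup>2 \<le> 2 (n\<^sup>-\<^sup>1\<^sup>/\<^sup>2 - (n + 1)\<^sup>-\<^sup>1\<^sup>/\<^sup>2)\<close> beyond.\<close>
lemma sum_sqrt_le:
  fixes a :: "nat \<Rightarrow> real"
  assumes K: "K \<ge> 1" and a0: "\<And>n. a n \<ge> 0"
    and a1: "\<And>n. n \<ge> 1 \<Longrightarrow> a n \<le> 1 / (pi * real n)"
    and a2: "\<And>n. n \<ge> 1 \<Longrightarrow> a n \<le> real K / (pi\<^sup>2 * (real n)\<^sup>2)"
  shows "(\<Sum>n\<in>{1..R}. a n * sqrt (real n)) \<le> (2 / pi + 2 / pi\<^sup>2) * sqrt (real K)"
proof -
  have step1: "1 / sqrt (real (Suc n)) \<le> 2 * (sqrt (real (Suc n)) - sqrt (real n))" for n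
  proof -
    define u v where "u = sqrt (real n)" and "v = sqrt (real (Suc n))"
    have uv: "0 \<le> u" "u \<le> v" "v > 0" "v * v - u * u = 1" by (auto simp: u_def v_def)
    have "2 * (v * v) - 2 * (u * v) \<ge> 1"
      using uv zero_le_square[of "v - u"] by (simp add: algebra_simps)
    then show ?thesis unfolding u_def[symmetric] v_def[symmetric] using uv by (simp add: field_simps)
  qed
  have step2: "sqrt (real (Suc n)) / (real (Suc n))\<^sup>2 \<le> 2 * (1 / sqrt (real n) - 1 / sqrt (real (Suc n)))" if "n \<ge> 1" for n
  proof -
    define u v where "u = sqrt (real n)" and "v = sqrt (real (Suc n))"
    have uv: "0 < u" "u \<le> v" "v > 0" "v * v - u * u = 1" "(real (Suc n)) = v * v" using that by (auto simp: u_def v_def)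
    have "u * (v + u) \<le> 2 * (v * v)" 
    proof -
      have "u * v \<le> v * v" "u * u \<le> v * v" using uv by (auto intro!: mult_mono)
      then show ?thesis by (simp add: algebra_simps)
    qed
    then have "u * (v + u) * (v - u) \<le> 2 * (v * v) * (v - u)" using uv by (intro mult_right_mono) auto
    moreover have "u * (v + u) * (v - u) = u * (v * v - u * u)" by (simp add: algebra_simps)
    ultimately have "u \<le> 2 * (v * v) * (v - u)" using uv by simp
    then have "u * (1 / (u * v ^ 3)) \<le> 2 * (v * v) * (v - u) * (1 / (u * v ^ 3))"
      using uv by (intro mult_right_mono) auto
    also have "u * (1 / (u * v ^ 3)) = v / (v * v)\<^sup>2" using uv by (simp add: power2_eq_square power3_eq_cube)
    also have "2 * (v * v) * (v - u) * (1 / (u * v ^ 3)) = 2 * (1 / u - 1 / v)"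
    proof -
      have "u \<noteq> 0" "v \<noteq> 0" using uv(1,3) by auto
      then show ?thesis by (simp add: power3_eq_cube field_simps)
    qed
    finally show ?thesis unfolding uv(5) unfolding u_def[symmetric] using uv by simp
  qed
  have base: "(\<Sum>n\<in>{1..R}. a n * sqrt (real n)) \<le> 2 / pi * sqrt (real R)" for R
  proof (induction R)
    case (Suc n)
    have "a (Suc n) * sqrt (real (Suc n)) \<le> 1 / (pi * real (Suc n)) * sqrt (real (Suc n))"
      by (intro mult_right_mono a1) auto
    also have "\<dots> = 1 / pi * (1 / sqrt (real (Suc n)))"
      using real_sqrt_mult_self[of "real (Suc n)"] by (simp add: field_simps del: of_nat_Suc real_sqrt_mult_self)
    also have "\<dots> \<le> 1 / pi * (2 * (sqrt (real (Suc n)) - sqrt (real n)))"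
      by (intro mult_left_mono step1) auto
    finally have "a (Suc n) * sqrt (real (Suc n)) \<le> 2 / pi * sqrt (real (Suc n)) - 2 / pi * sqrt (real n)"
      by (simp only: right_diff_distrib mult_1 times_divide_eq_left mult.assoc)
    moreover have "(\<Sum>n\<in>{1..Suc n}. a n * sqrt (real n)) = (\<Sum>n\<in>{1..n}. a n * sqrt (real n)) + a (Suc n) * sqrt (real (Suc n))" by simp
    ultimately show ?case using Suc.IH by linarith
  qed simp
  define C where "C = 2 * real K / pi\<^sup>2"
  have tail: "(\<Sum>n\<in>{1..R}. a n * sqrt (real n)) \<le> 2 / pi * sqrt (real K) + C * (1 / sqrt (real K) - 1 / sqrt (real R))" if "K \<le> R" for R
    using that
  proof (induction R rule: dec_induct)
    case base
    then show ?case using \<open>\<And>R. (\<Sum>n\<in>{1..R}. a n * sqrt (real n)) \<le> 2 / pi * sqrt (real R)\<close>[of K] by simp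
  next
    case (step n)
    have n: "n \<ge> 1" using K step by simp
    have "a (Suc n) * sqrt (real (Suc n)) \<le> real K / (pi\<^sup>2 * (real (Suc n))\<^sup>2) * sqrt (real (Suc n))"
      by (intro mult_right_mono a2) auto
    also have "\<dots> = real K / pi\<^sup>2 * (sqrt (real (Suc n)) / (real (Suc n))\<^sup>2)" by simp
    also have "\<dots> \<le> real K / pi\<^sup>2 * (2 * (1 / sqrt (real n) - 1 / sqrt (real (Suc n))))"
      by (intro mult_left_mono step2 n) auto
    also have "\<dots> = C * (1 / sqrt (real n)) - C * (1 / sqrt (real (Suc n)))"
      unfolding C_def by (simp only: right_diff_distrib) (simp add: field_simps)
    finally have "a (Suc n) * sqrt (real (Suc n)) \<le> C * (1 / sqrt (real n)) - C * (1 / sqrt (real (Suc n)))" .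
    moreover have "(\<Sum>n\<in>{1..Suc n}. a n * sqrt (real n)) = (\<Sum>n\<in>{1..n}. a n * sqrt (real n)) + a (Suc n) * sqrt (real (Suc n))" by simp
    ultimately show ?case using step.IH unfolding right_diff_distrib by linarith
  qed
  have "(\<Sum>n\<in>{1..R}. a n * sqrt (real n)) \<le> (\<Sum>n\<in>{1..max R K}. a n * sqrt (real n))"
    using a0 by (intro sum_mono2) auto
  also have "\<dots> \<le> 2 / pi * sqrt (real K) + C * (1 / sqrt (real K) - 1 / sqrt (real (max R K)))"
    by (rule tail) simp
  also have "C * (1 / sqrt (real K) - 1 / sqrt (real (max R K))) \<le> C * (1 / sqrt (real K))"
    by (intro mult_left_mono) (auto simp: C_def)
  also have "C * (1 / sqrt (real K)) = 2 / pi\<^sup>2 * sqrt (real K)"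
    unfolding C_def using K real_sqrt_mult_self[of "real K"] by (simp add: field_simps del: real_sqrt_mult_self)
  finally show ?thesis by (simp add: distrib_right)
qed

lemma sum_norm_trap_coeff_le:
  assumes K: "K \<ge> 1" and l: "0 \<le> l"
  shows "(\<Sum>k\<in>{- int R..int R}. cmod (trap_coeff a l (real K) k)) \<le> l + 1 / real K + 2 * ((1 + ln (real K)) / pi + 1 / pi\<^sup>2)"
    and "(\<Sum>k\<in>{- int R..int R}. cmod (trap_coeff a l (real K) k) * sqrt \<bar>of_int k\<bar>) \<le> 2 * ((2 / pi + 2 / pi\<^sup>2) * sqrt (real K))"
proof -
  let ?t = "\<lambda>k. cmod (trap_coeff a l (real K) k)"
  have K': "real K > 0" using K by simp
  have b: "?t (int n) \<le> 1 / (pi * real n)" "?t (int n) \<le> real K / (pi\<^sup>2 * (real n)\<^sup>2)"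
     "?t (- int n) \<le> 1 / (pi * real n)" "?t (- int n) \<le> real K / (pi\<^sup>2 * (real n)\<^sup>2)" if "n \<ge> 1" for n
    using norm_trap_coeff_le[OF K', of "int n" a l] norm_trap_coeff_le[OF K', of "- int n" a l] that by simp_all
  have "(\<Sum>n\<in>{1..R}. ?t (int n)) \<le> (1 + ln (real K)) / pi + 1 / pi\<^sup>2"
    "(\<Sum>n\<in>{1..R}. ?t (- int n)) \<le> (1 + ln (real K)) / pi + 1 / pi\<^sup>2"
    by (rule sum_le_log[OF K]; use b in simp)+
  moreover have "?t 0 = l + 1 / real K" unfolding trap_coeff_0 norm_of_real using l by simp
  moreover have "2 * p = p + p" for p :: real by simp
  ultimately show "(\<Sum>k\<in>{- int R..int R}. ?t k) \<le> l + 1 / real K + 2 * ((1 + ln (real K)) / pi + 1 / pi\<^sup>2)"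
    unfolding sum_int_interval sum.distrib by (simp only:)
  have "(\<Sum>n\<in>{1..R}. ?t (int n) * sqrt (real n)) \<le> (2 / pi + 2 / pi\<^sup>2) * sqrt (real K)"
    "(\<Sum>n\<in>{1..R}. ?t (- int n) * sqrt (real n)) \<le> (2 / pi + 2 / pi\<^sup>2) * sqrt (real K)"
    by (rule sum_sqrt_le[OF K]; use b in simp)+
  then show "(\<Sum>k\<in>{- int R..int R}. ?t k * sqrt \<bar>of_int k\<bar>) \<le> 2 * ((2 / pi + 2 / pi\<^sup>2) * sqrt (real K))"
    unfolding sum_int_interval sum.distrib by simp
qed

section \<open>From averages of characters to boxes\<close>

lemma
  fixes A :: "real set"
  assumes A: "A \<in> sets borel"
  shows frac_image_borel: "frac ` A \<in> sets borel"
    and emeasure_frac_image_le: "emeasure lborel (frac ` A) \<le> emeasure lborel A"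
proof -
  define B where "B n = A \<inter> {of_int (int_decode n)..<of_int (int_decode n) + 1 :: real}" for n
  define C where "C n = (+) (of_int (int_decode n)) -` B n" for n
  have B: "B n \<in> sets borel" for n unfolding B_def using A by (intro sets.Int) simp_all
  have C: "C n \<in> sets borel" for n
  proof -
    have "(+) (of_int (int_decode n) :: real) \<in> borel_measurable borel" by measurable
    then show ?thesis unfolding C_def by (rule measurable_sets_borel[OF _ B])
  qed
  have eC: "emeasure lborel (C n) = emeasure lborel (B n)" for n
    using B[of n] lborel_distr_plus[of "of_int (int_decode n) :: real"] emeasure_distr[of "(+) (of_int (int_decode n))" lborel borel "B n"]
    by (simp add: C_def)
  have eq: "frac ` A = (\<Union>n. C n)"
  proof (intro equalityI subsetI)
    fix y assume "y \<in> frac ` A"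
    then obtain x where x: "x \<in> A" "y = frac x" by blast
    have "y \<in> C (int_encode \<lfloor>x\<rfloor>)" using x by (simp add: C_def B_def frac_def)
    then show "y \<in> (\<Union>n. C n)" by blast
  next
    fix y assume "y \<in> (\<Union>n. C n)"
    then obtain n where n: "of_int (int_decode n) + y \<in> A" "0 \<le> y" "y < 1" by (auto simp: C_def B_def)
    then have "frac (of_int (int_decode n) + y) = y" by (simp add: frac_def floor_eq_iff)
    then show "y \<in> frac ` A" using n(1) by force
  qed
  show "frac ` A \<in> sets borel" unfolding eq using C by (intro sets.countable_UN) auto
  have disj: "disjoint_family B"
    unfolding disjoint_family_on_def
  proof (intro ballI impI)
    fix m n :: nat assume "m \<noteq> n"
    then have "int_decode m \<noteq> int_decode n" by (simp add: inj_int_decode inj_eq)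
    then show "B m \<inter> B n = {}" unfolding B_def by (auto simp: set_eq_iff)
  qed
  have "(\<Union>n. B n) = A"
  proof (intro equalityI subsetI)
    fix x assume "x \<in> A"
    then have "x \<in> B (int_encode \<lfloor>x\<rfloor>)" by (simp add: B_def)
    then show "x \<in> (\<Union>n. B n)" by blast
  qed (auto simp: B_def)
  moreover have "(\<Sum>n. emeasure lborel (B n)) = emeasure lborel (\<Union>n. B n)"
    using B disj by (intro suminf_emeasure) auto
  moreover have "emeasure lborel (\<Union>n. C n) \<le> (\<Sum>n. emeasure lborel (C n))"
    using C by (intro emeasure_subadditive_countably) auto
  ultimately show "emeasure lborel (frac ` A) \<le> emeasure lborel A" unfolding eq eC by simp
qed

lemma measure_frac_Icc_le:
  assumes "a \<le> b"
  shows "measure lborel (frac ` {a..b}) \<le> b - a"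
  using emeasure_frac_image_le[of "{a..b}"] assms by (simp add: measure_def enn2real_leI)

text \<open>An interval of the circle lies in a closed arc of its own length, and its complement lies in the
complementary closed arc. Either the interval \<open>J\<close> on the line contains an open interval of length 1, and
at most one point of the circle is missed; or \<open>J\<close> is empty or has length \<open>b - a \<le> 1\<close>, and since the quotient map does
not increase measures, the lengths of the two arcs bound two measures with sum 1, so both bounds are sharp.\<close>
lemma circle_interval_arcs:
  assumes "circle_interval I"
  obtains a l where "0 \<le> l" "l \<le> 1" "measure lborel I = l"
    "\<And>x. x \<in> I \<Longrightarrow> \<exists>k::int. a \<le> x + of_int k \<and> x + of_int k \<le> a + l"
    "\<And>x. 0 \<le> x \<Longrightarrow> x < 1 \<Longrightarrow> x \<notin> I \<Longrightarrow> \<exists>k::int. a + l \<le> x + of_int k \<and> x + of_int k \<le> a + 1"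
proof -
  obtain J where J: "is_interval J" "I = frac ` J" using assms unfolding circle_interval_def by blast
  have mem: "z \<in> J" if "x \<in> J" "y \<in> J" "x \<le> z" "z \<le> y" for x y z
    using J(1) that unfolding is_interval_1 by blast
  have I01: "I \<subseteq> {0..<1}" using frac_lt_1 by (auto simp: J(2))
  consider "J = {}" | u where "{u<..<u + 1} \<subseteq> J" | "J \<noteq> {}" "\<And>x y. x \<in> J \<Longrightarrow> y \<in> J \<Longrightarrow> y < x + 1"
  proof -
    have "\<exists>u. {u<..<u + 1} \<subseteq> J" if "x \<in> J" "y \<in> J" "\<not> y < x + 1" for x y
      using mem[OF that(1,2)] that(3) by (intro exI[of _ x]) auto
    then show ?thesis using that by blast
  qed
  then show ?thesis
  proof cases
    case 1
    then have "I = {}" by (simp add: J(2))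
    then show ?thesis by (intro that[of 0 0]) (auto intro!: exI[of _ "0::int"])
  next
    case (2 u)
    have miss: "x = frac u" if x: "0 \<le> x" "x < 1" "x \<notin> I" for x
    proof (rule ccontr)
      assume ne: "x \<noteq> frac u"
      have "\<exists>k::int. x + of_int k \<in> J"
      proof (cases "x < frac u")
        case True
        then have "x + of_int (\<lfloor>u\<rfloor> + 1) \<in> {u<..<u + 1}" using x frac_lt_1[of u] unfolding frac_def by auto
        then show ?thesis using 2 by blast
      next
        case False
        then have "u < x + of_int \<lfloor>u\<rfloor>" "x + of_int \<lfloor>u\<rfloor> < u + 1"
          using x ne of_int_floor_le[of u] unfolding frac_def by linarith+
        then have "x + of_int \<lfloor>u\<rfloor> \<in> {u<..<u + 1}" by simp
        then show ?thesis using 2 by blast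
      qed
      then obtain k :: int where "x + of_int k \<in> J" by blast
      moreover have "frac (x + of_int k) = x" using x by (simp add: frac_def floor_eq_iff)
      ultimately have "x \<in> I" unfolding J(2) by force
      with x(3) show False ..
    qed
    then have "{0..<1} - I \<subseteq> {frac u}" by auto
    then have fin: "finite ({0..<1} - I)" by (rule finite_subset) simp
    have "I = {0..<1} - ({0..<1} - I)" using I01 by blast
    then have "emeasure lborel I = emeasure lborel ({0..<1 :: real} - ({0..<1} - I))" by (rule arg_cong)
    also have "\<dots> = emeasure lborel {0..<1 :: real}"
      using fin by (intro emeasure_Diff_null_set) (auto intro: finite_imp_null_set_lborel)
    finally have "measure lborel I = 1" by (simp add: measure_def)
    then show ?thesis
    proof (intro that[of 1 u])
      show "\<exists>k::int. u \<le> x + of_int k \<and> x + of_int k \<le> u + 1" if "x \<in> I" for x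
        by (rule exI[of _ "\<lceil>u - x\<rceil>"]) linarith
      show "\<exists>k::int. u + 1 \<le> x + of_int k \<and> x + of_int k \<le> u + 1" if "0 \<le> x" "x < 1" "x \<notin> I" for x
        unfolding miss[OF that] by (rule exI[of _ "\<lfloor>u\<rfloor> + 1"]) (simp add: frac_def)
    qed auto
  next
    case 3
    then obtain w where w: "w \<in> J" by blast
    have bdd: "bdd_above J" "bdd_below J"
      using 3(2)[OF w] 3(2)[OF _ w] by (auto intro!: bdd_aboveI[of _ "w + 1"] bdd_belowI[of _ "w - 1"] simp: less_imp_le) (smt (verit))
    define a b where "a = Inf J" and "b = Sup J"
    have ab: "a \<le> x" "x \<le> b" if "x \<in> J" for x
      using that bdd by (auto simp: a_def b_def intro: cInf_lower cSup_upper)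
    have le1: "b \<le> a + 1"
    proof -
      have "b \<le> x + 1" if "x \<in> J" for x
        unfolding b_def using 3 that by (intro cSup_least) (auto simp: less_imp_le)
      then have "b - 1 \<le> a" unfolding a_def using 3(1) by (intro cInf_greatest) (auto simp: algebra_simps)
      then show ?thesis by simp
    qed
    have ab': "a \<le> b" using ab[OF w] by simp
    have sub: "{a<..<b} \<subseteq> J"
    proof
      fix z assume z: "z \<in> {a<..<b}"
      obtain x where "x \<in> J" "x < z" using z cInf_less_iff[OF 3(1) bdd(2)] by (auto simp: a_def)
      moreover obtain y where "y \<in> J" "z < y" using z less_cSup_iff[OF 3(1) bdd(1)] by (auto simp: b_def)
      ultimately show "z \<in> J" using mem[of x y z] by simp
    qed
    have Jb: "J \<in> sets borel" by (rule real_interval_borel_measurable[OF J(1)])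
    have Ib: "I \<in> sets borel" unfolding J(2) by (rule frac_image_borel[OF Jb])
    have "J \<subseteq> {a..b}" using ab by auto
    then have "I \<subseteq> frac ` {a..b}" unfolding J(2) by (rule image_mono)
    have fin: "emeasure lborel X \<noteq> \<infinity>" if "X \<subseteq> {0..<1 :: real}" for X
    proof -
      have "emeasure lborel X \<le> emeasure lborel {0..<1 :: real}" using that by (intro emeasure_mono) auto
      then show ?thesis by (auto simp: top_unique)
    qed
    have f01: "frac ` X \<subseteq> {0..<1 :: real}" for X using frac_lt_1 by auto
    have m1: "measure lborel I \<le> b - a"
    proof -
      have "measure lborel I \<le> measure lborel (frac ` {a..b})"
        using \<open>I \<subseteq> frac ` {a..b}\<close> Ib frac_image_borel[of "{a..b}"] fin[OF f01]
        by (intro measure_mono_fmeasurable) (auto simp: fmeasurable_def less_top)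
      then show ?thesis using measure_frac_Icc_le[OF ab'] by simp
    qed
    have compl: "\<exists>k::int. b \<le> x + of_int k \<and> x + of_int k \<le> a + 1" if x: "0 \<le> x" "x < 1" "x \<notin> I" for x
    proof -
      define k where "k = \<lfloor>a + 1 - x\<rfloor>"
      have k: "a < x + of_int k" "x + of_int k \<le> a + 1" unfolding k_def by linarith+
      have "frac (x + of_int k) = x" using x by (simp add: frac_def floor_eq_iff)
      then have "x + of_int k \<notin> J" using x(3) unfolding J(2) by force
      then have "b \<le> x + of_int k" using sub k(1) by (meson greaterThanLessThan_iff not_le subsetD)
      then show ?thesis using k(2) by blast
    qed
    have m2: "measure lborel ({0..<1} - I) \<le> a + 1 - b"
    proof -
      have "{0..<1} - I \<subseteq> frac ` {b..a + 1}"
      proof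
        fix x assume x: "x \<in> {0..<1} - I"
        then obtain k :: int where k: "b \<le> x + of_int k" "x + of_int k \<le> a + 1" using compl[of x] by auto
        have "frac (x + of_int k) = x" using x by (simp add: frac_def floor_eq_iff)
        then show "x \<in> frac ` {b..a + 1}" using k by force
      qed
      then have "measure lborel ({0..<1} - I) \<le> measure lborel (frac ` {b..a + 1})"
        using Ib frac_image_borel[of "{b..a+1}"] fin[OF f01]
        by (intro measure_mono_fmeasurable) (auto simp: fmeasurable_def less_top)
      then show ?thesis using measure_frac_Icc_le[OF le1] by simp
    qed
    have "measure lborel {0..<1 :: real} = measure lborel I + measure lborel ({0..<1} - I)"
    proof -
      have "measure lborel (I \<union> ({0..<1} - I)) = measure lborel I + measure lborel ({0..<1} - I)"
        using Ib fin[OF I01] fin[of "{0..<1} - I"] by (intro measure_Union) auto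
      moreover have "I \<union> ({0..<1} - I) = {0..<1}" using I01 by blast
      ultimately show ?thesis by simp
    qed
    then have "measure lborel I = b - a" using m1 m2 by simp
    then show ?thesis
    proof (intro that[of "b - a" a])
      show "\<exists>k::int. a \<le> x + of_int k \<and> x + of_int k \<le> a + (b - a)" if xI: "x \<in> I" for x
      proof -
        obtain y where y: "y \<in> J" "x = frac y" using xI unfolding J(2) by blast
        then show ?thesis using ab[OF y(1)] by (intro exI[of _ "\<lfloor>y\<rfloor>"]) (simp add: frac_def)
      qed
      show "\<exists>k::int. a + (b - a) \<le> x + of_int k \<and> x + of_int k \<le> a + 1" if "0 \<le> x" "x < 1" "x \<notin> I" for x
        using compl[OF that] by simp
    qed (use ab' le1 in auto)
  qed
qed

text \<open>The error in dimension \<open>m\<close>: the enlargement of the box by \<open>1 / K\<close> in each direction, and the contribution of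
the nontrivial characters, where \<open>V\<close> and \<open>W\<close> bound the sums of the moduli of the Fourier coefficients of a
trapezoid without and with the weights \<open>|k|\<^sup>1\<^sup>/\<^sup>2\<close>.\<close>
definition disc_error :: "real \<Rightarrow> nat \<Rightarrow> real \<Rightarrow> real \<Rightarrow> nat \<Rightarrow> real" where
  "disc_error \<eta> K W V m = (1 + 1 / real K) ^ m - 1 + \<eta> * real m * W * V ^ (m - 1)"

lemma sqrt_sum_le_sum_sqrt:
  "finite A \<Longrightarrow> (\<And>i. i \<in> A \<Longrightarrow> f i \<ge> 0) \<Longrightarrow> sqrt (\<Sum>i\<in>A. f i) \<le> (\<Sum>i\<in>A. sqrt (f i))"
proof (induction A rule: finite_induct)
  case (insert x F)
  have "sqrt (f x + sum f F) \<le> sqrt (f x) + sqrt (sum f F)"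
    using insert.prems by (intro sqrt_add_le_add_sqrt sum_nonneg) auto
  then show ?case using insert by fastforce
qed simp

lemma prod_add_const_le:
  fixes l :: "'i \<Rightarrow> real"
  assumes "finite A" "\<And>i. i \<in> A \<Longrightarrow> 0 \<le> l i \<and> l i \<le> 1" "d \<ge> 0"
  shows "(\<Prod>i\<in>A. l i + d) \<le> (\<Prod>i\<in>A. l i) + ((1 + d) ^ card A - 1)"
  using assms(1,2)
proof (induction A rule: finite_induct)
  case (insert x F)
  have p0: "(\<Prod>i\<in>F. l i) \<le> 1" "0 \<le> (\<Prod>i\<in>F. l i)" using insert.prems by (auto intro!: prod_le_1 prod_nonneg)
  have c: "1 \<le> (1 + d) ^ card F" using assms(3) by (intro one_le_power) simp
  have "(l x + d) * (\<Prod>i\<in>F. l i + d) \<le> (l x + d) * ((\<Prod>i\<in>F. l i) + ((1 + d) ^ card F - 1))"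
    using insert assms(3) by (intro mult_left_mono insert.IH) auto
  also have "\<dots> = l x * (\<Prod>i\<in>F. l i) + (l x * ((1 + d) ^ card F - 1) + d * (\<Prod>i\<in>F. l i) + d * ((1 + d) ^ card F - 1))"
    by (simp add: algebra_simps)
  also have "l x * ((1 + d) ^ card F - 1) \<le> 1 * ((1 + d) ^ card F - 1)"
    using insert.prems c by (intro mult_right_mono) auto
  also have "d * (\<Prod>i\<in>F. l i) \<le> d * 1" using p0 assms(3) by (intro mult_left_mono) auto
  finally show ?case using insert by (simp add: algebra_simps)
qed simp

text \<open>Points of a torus whose character averages are at most \<open>\<eta>\<close> times the square root of the 1-norm of the
character. The set \<open>A\<close> of coordinates is allowed to vary for the induction in \<open>proportion_in_box_ge\<close>.\<close>
locale equidistributed_points =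
  fixes S :: "'v set" and \<theta> :: "'n \<Rightarrow> 'v \<Rightarrow> real" and \<eta> V W :: real and K :: nat
  assumes S: "finite S" and K: "K \<ge> 1" and \<eta>: "\<eta> \<ge> 0"
    and H: "\<And>A n. \<exists>j\<in>A. n j \<noteq> (0 :: int) \<Longrightarrow>
      cmod (\<Sum>\<alpha>\<in>S. \<Prod>j\<in>A. cis2pi (of_int (n j) * \<theta> j \<alpha>)) \<le> real (card S) * (\<eta> * sqrt (\<Sum>j\<in>A. \<bar>of_int (n j)\<bar>))"
    and V: "V \<ge> 2 + 2 * ((1 + ln (real K)) / pi + 1 / pi\<^sup>2)"
    and W: "W \<ge> 2 * ((2 / pi + 2 / pi\<^sup>2) * sqrt (real K))"
begin

text \<open>The product of the partial sums of the Fourier series is a finite sum over integer vectors \<open>n\<close>. The zero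
vector gives the main term. For the others the root of the 1-norm is at most the sum of the roots of the
\<open>|n\<^sub>i|\<close>, and for each \<open>i\<close> the sum over all \<open>n\<close> factors again, into one weighted sum and \<open>card A - 1\<close>
unweighted ones. The bound does not depend on the length of the partial sums.\<close>
lemma mean_prod_trapezoid_le:
  assumes A: "finite A" and l: "\<And>j. j \<in> A \<Longrightarrow> 0 \<le> l j \<and> l j \<le> 1"
  shows "(\<Sum>\<alpha>\<in>S. \<Prod>j\<in>A. trapezoid (a j) (l j) (real K) (\<theta> j \<alpha>))
     \<le> real (card S) * ((\<Prod>j\<in>A. l j + 1 / real K) + \<eta> * real (card A) * W * V ^ (card A - 1))"
proof -
  define Z where "Z R = {- int R..int R}" for R
  have fZ: "finite (Z R)" for R by (simp add: Z_def)
  define t where "t j k = trap_coeff (a j) (l j) (real K) k" for j k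
  have K': "real K > 0" using K by simp
  have V1: "(\<Sum>k\<in>Z R. cmod (t j k)) \<le> V" if "j \<in> A" for j and R :: nat
  proof -
    have "1 / real K \<le> 1" using K by simp
    then show ?thesis
      using sum_norm_trap_coeff_le(1)[OF K, of "l j" "a j" R] l[OF that] V unfolding Z_def t_def by linarith
  qed
  have W1: "(\<Sum>k\<in>Z R. cmod (t j k) * sqrt \<bar>of_int k\<bar>) \<le> W" if "j \<in> A" for j and R :: nat
    using sum_norm_trap_coeff_le(2)[OF K, of "l j" "a j" R] l[OF that] W unfolding Z_def t_def by linarith
  have W0: "0 \<le> W" by (rule order_trans[OF _ W]) simp
  have V0: "0 \<le> V" using V K by (intro order_trans[OF _ V]) (auto intro!: add_nonneg_nonneg divide_nonneg_nonneg)
  define b where "b R = (\<Sum>\<alpha>\<in>S. \<Prod>j\<in>A. \<Sum>k\<in>Z R. t j k * cis2pi (of_int k * \<theta> j \<alpha>))" for R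
  have lim: "b \<longlonglongrightarrow> (\<Sum>\<alpha>\<in>S. \<Prod>j\<in>A. of_real (trapezoid (a j) (l j) (real K) (\<theta> j \<alpha>)))"
    unfolding b_def t_def Z_def by (intro tendsto_sum tendsto_prod trapezoid_lim K')
  define P where "P = (\<Prod>j\<in>A. l j + 1 / real K)"
  let ?bound = "real (card S) * (P + \<eta> * real (card A) * W * V ^ (card A - 1))"
  have le: "Re (b R) \<le> ?bound" for R
  proof -
    let ?N = "A \<rightarrow>\<^sub>E Z R"
    have fN: "finite ?N" using A fZ by (intro finite_PiE) auto
    define z where "z = (\<lambda>j. if j \<in> A then 0 else undefined :: int)"
    have zN: "z \<in> ?N" by (auto simp: z_def Z_def)
    define c where "c n = (\<Prod>j\<in>A. t j (n j)) * (\<Sum>\<alpha>\<in>S. \<Prod>j\<in>A. cis2pi (of_int (n j) * \<theta> j \<alpha>))" for n :: "'n \<Rightarrow> int"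
    have "b R = (\<Sum>\<alpha>\<in>S. \<Sum>n\<in>?N. \<Prod>j\<in>A. t j (n j) * cis2pi (of_int (n j) * \<theta> j \<alpha>))"
      unfolding b_def using A fZ by (intro sum.cong refl prod_sum_PiE) auto
    also have "\<dots> = (\<Sum>n\<in>?N. c n)"
      unfolding c_def by (subst sum.swap) (simp add: prod.distrib sum_distrib_left)
    also have "\<dots> = c z + (\<Sum>n\<in>?N - {z}. c n)" using fN zN by (rule sum.remove)
    finally have "Re (b R) = Re (c z) + Re (\<Sum>n\<in>?N - {z}. c n)" by simp
    also have "c z = of_real (real (card S) * P)"
    proof -
      have "(\<Prod>j\<in>A. t j (z j)) = (\<Prod>j\<in>A. of_real (l j + 1 / real K))"
        by (intro prod.cong refl) (simp add: z_def t_def trap_coeff_0 del: of_real_add)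
      moreover have "(\<Sum>\<alpha>\<in>S. \<Prod>j\<in>A. cis2pi (of_int (z j) * \<theta> j \<alpha>)) = of_nat (card S)"
        by (simp add: z_def)
      ultimately show ?thesis unfolding c_def P_def by (simp only: of_real_mult of_real_prod of_real_of_nat_eq mult.commute)
    qed
    also have "Re (\<Sum>n\<in>?N - {z}. c n) \<le> (\<Sum>n\<in>?N - {z}. cmod (c n))"
      by (rule order_trans[OF complex_Re_le_cmod norm_sum])
    also have "\<dots> \<le> (\<Sum>n\<in>?N - {z}. real (card S) * \<eta> * (\<Sum>i\<in>A. \<Prod>j\<in>A. cmod (t j (n j)) * (if j = i then sqrt \<bar>of_int (n j)\<bar> else 1)))"
    proof (rule sum_mono)
      fix n assume n: "n \<in> ?N - {z}"
      have ex: "\<exists>j\<in>A. n j \<noteq> 0"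
      proof (rule ccontr)
        assume "\<not> (\<exists>j\<in>A. n j \<noteq> 0)"
        then have "n = z" using n by (auto simp: z_def fun_eq_iff PiE_def extensional_def)
        with n show False by simp
      qed
      have "cmod (c n) \<le> (\<Prod>j\<in>A. cmod (t j (n j))) * (real (card S) * (\<eta> * sqrt (\<Sum>j\<in>A. \<bar>of_int (n j)\<bar>)))"
        unfolding c_def norm_mult prod_norm[symmetric] by (intro mult_left_mono H[OF ex] prod_nonneg) auto
      also have "\<dots> \<le> (\<Prod>j\<in>A. cmod (t j (n j))) * (real (card S) * (\<eta> * (\<Sum>i\<in>A. sqrt \<bar>of_int (n i)\<bar>)))"
        using A \<eta> by (intro mult_left_mono sqrt_sum_le_sum_sqrt prod_nonneg) auto
      also have "\<dots> = real (card S) * \<eta> * (\<Sum>i\<in>A. (\<Prod>j\<in>A. cmod (t j (n j))) * sqrt \<bar>of_int (n i)\<bar>)"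
        by (simp add: sum_distrib_left mult_ac)
      also have "(\<Sum>i\<in>A. (\<Prod>j\<in>A. cmod (t j (n j))) * sqrt \<bar>of_int (n i)\<bar>)
          = (\<Sum>i\<in>A. \<Prod>j\<in>A. cmod (t j (n j)) * (if j = i then sqrt \<bar>of_int (n j)\<bar> else 1))"
        using A by (intro sum.cong refl) (simp add: prod.distrib prod.delta)
      finally show "cmod (c n) \<le> real (card S) * \<eta> * (\<Sum>i\<in>A. \<Prod>j\<in>A. cmod (t j (n j)) * (if j = i then sqrt \<bar>of_int (n j)\<bar> else 1))" .
    qed
    also have "\<dots> \<le> (\<Sum>n\<in>?N. real (card S) * \<eta> * (\<Sum>i\<in>A. \<Prod>j\<in>A. cmod (t j (n j)) * (if j = i then sqrt \<bar>of_int (n j)\<bar> else 1)))"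
      using fN \<eta> by (intro sum_mono2 mult_nonneg_nonneg sum_nonneg prod_nonneg) auto
    also have "\<dots> = real (card S) * \<eta> * (\<Sum>i\<in>A. \<Sum>n\<in>?N. \<Prod>j\<in>A. cmod (t j (n j)) * (if j = i then sqrt \<bar>of_int (n j)\<bar> else 1))"
      unfolding sum_distrib_left[symmetric] by (subst sum.swap) simp
    also have "(\<Sum>i\<in>A. \<Sum>n\<in>?N. \<Prod>j\<in>A. cmod (t j (n j)) * (if j = i then sqrt \<bar>of_int (n j)\<bar> else 1))
        = (\<Sum>i\<in>A. \<Prod>j\<in>A. \<Sum>k\<in>Z R. cmod (t j k) * (if j = i then sqrt \<bar>of_int k\<bar> else 1))"
      using A fZ by (intro sum.cong refl prod_sum_PiE[symmetric]) auto
    also have "\<dots> \<le> (\<Sum>i\<in>A. W * V ^ (card A - 1))"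
    proof (rule sum_mono)
      fix i assume i: "i \<in> A"
      have "(\<Prod>j\<in>A. \<Sum>k\<in>Z R. cmod (t j k) * (if j = i then sqrt \<bar>of_int k\<bar> else 1))
        = (\<Sum>k\<in>Z R. cmod (t i k) * sqrt \<bar>of_int k\<bar>) * (\<Prod>j\<in>A - {i}. \<Sum>k\<in>Z R. cmod (t j k))"
        using A i by (simp add: prod.remove)
      also have "\<dots> \<le> W * (\<Prod>j\<in>A - {i}. V)"
        using W1[OF i] V1 W0 by (intro mult_mono prod_mono prod_nonneg conjI sum_nonneg) auto
      also have "\<dots> = W * V ^ (card A - 1)" using A i by simp
      finally show "(\<Prod>j\<in>A. \<Sum>k\<in>Z R. cmod (t j k) * (if j = i then sqrt \<bar>of_int k\<bar> else 1)) \<le> W * V ^ (card A - 1)" .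
    qed
    finally have "Re (b R) \<le> real (card S) * P + real (card S) * \<eta> * (real (card A) * (W * V ^ (card A - 1)))"
      using \<eta> by (simp add: mult_left_mono)
    then show ?thesis by (simp add: ring_distribs mult_ac)
  qed
  have "(\<lambda>R. Re (b R)) \<longlonglongrightarrow> Re (\<Sum>\<alpha>\<in>S. \<Prod>j\<in>A. of_real (trapezoid (a j) (l j) (real K) (\<theta> j \<alpha>)))"
    using lim by (rule tendsto_Re)
  then have "Re (\<Sum>\<alpha>\<in>S. \<Prod>j\<in>A. of_real (trapezoid (a j) (l j) (real K) (\<theta> j \<alpha>))) \<le> ?bound"
    by (rule LIMSEQ_le_const2) (use le in blast)
  then show ?thesis unfolding P_def by (simp flip: of_real_prod)
qed

lemma proportion_in_box_le:
  assumes A: "finite A" and l: "\<And>j. j \<in> A \<Longrightarrow> 0 \<le> l j \<and> l j \<le> 1"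
    and B: "\<And>j \<alpha>. j \<in> A \<Longrightarrow> \<alpha> \<in> S \<Longrightarrow> \<theta> j \<alpha> \<in> B j \<Longrightarrow> \<exists>k::int. a j \<le> \<theta> j \<alpha> + of_int k \<and> \<theta> j \<alpha> + of_int k \<le> a j + l j"
  shows "real (card {\<alpha>\<in>S. \<forall>j\<in>A. \<theta> j \<alpha> \<in> B j}) \<le> real (card S) * ((\<Prod>j\<in>A. l j) + disc_error \<eta> K W V (card A))"
proof -
  have K': "real K > 0" using K by simp
  have "real (card {\<alpha>\<in>S. \<forall>j\<in>A. \<theta> j \<alpha> \<in> B j}) = (\<Sum>\<alpha>\<in>S. if \<forall>j\<in>A. \<theta> j \<alpha> \<in> B j then 1 else 0)"
    using S by (simp add: sum.If_cases Int_def)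
  also have "\<dots> \<le> (\<Sum>\<alpha>\<in>S. \<Prod>j\<in>A. trapezoid (a j) (l j) (real K) (\<theta> j \<alpha>))"
  proof (rule sum_mono)
    fix \<alpha> assume \<alpha>: "\<alpha> \<in> S"
    show "(if \<forall>j\<in>A. \<theta> j \<alpha> \<in> B j then 1 else 0) \<le> (\<Prod>j\<in>A. trapezoid (a j) (l j) (real K) (\<theta> j \<alpha>))"
    proof (cases "\<forall>j\<in>A. \<theta> j \<alpha> \<in> B j")
      case True
      have "1 \<le> trapezoid (a j) (l j) (real K) (\<theta> j \<alpha>)" if j: "j \<in> A" for j
        using B[OF j \<alpha>] True j trapezoid_ge_1[OF K', of "a j" "\<theta> j \<alpha>" _ "l j"] by blast
      then show ?thesis using True by (simp add: prod_ge_1)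
    next
      case False
      have "0 \<le> (\<Prod>j\<in>A. trapezoid (a j) (l j) (real K) (\<theta> j \<alpha>))"
        using l by (intro prod_nonneg trapezoid_nonneg K') auto
      then show ?thesis unfolding if_not_P[OF False] .
    qed
  qed
  also have "\<dots> \<le> real (card S) * ((\<Prod>j\<in>A. l j + 1 / real K) + \<eta> * real (card A) * W * V ^ (card A - 1))"
    by (rule mean_prod_trapezoid_le[OF A l])
  also have "\<dots> \<le> real (card S) * ((\<Prod>j\<in>A. l j) + ((1 + 1 / real K) ^ card A - 1) + \<eta> * real (card A) * W * V ^ (card A - 1))"
    using A l by (intro mult_left_mono add_right_mono prod_add_const_le) auto
  finally show ?thesis by (simp only: disc_error_def add.assoc)
qed

text \<open>Points in the box over \<open>F\<close> are split according to whether the coordinate \<open>i\<close> lies in \<open>B\<^sub>i\<close> or in its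
complement, and the second kind is bounded above by \<open>proportion_in_box_le\<close> with the complementary arc. So
the lower bound collects the errors of all dimensions.\<close>
lemma proportion_in_box_ge:
  assumes l: "\<And>j. 0 \<le> l j \<and> l j \<le> 1"
    and B: "\<And>j \<alpha>. \<alpha> \<in> S \<Longrightarrow> \<theta> j \<alpha> \<in> B j \<Longrightarrow> \<exists>k::int. a j \<le> \<theta> j \<alpha> + of_int k \<and> \<theta> j \<alpha> + of_int k \<le> a j + l j"
    and B': "\<And>j \<alpha>. \<alpha> \<in> S \<Longrightarrow> \<theta> j \<alpha> \<notin> B j \<Longrightarrow> \<exists>k::int. a j + l j \<le> \<theta> j \<alpha> + of_int k \<and> \<theta> j \<alpha> + of_int k \<le> a j + 1"
    and A: "finite A"
  shows "real (card {\<alpha>\<in>S. \<forall>j\<in>A. \<theta> j \<alpha> \<in> B j}) \<ge> real (card S) * ((\<Prod>j\<in>A. l j) - (\<Sum>m\<in>{1..card A}. disc_error \<eta> K W V m))"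
  using A
proof (induction A rule: finite_induct)
  case empty
  then show ?case by simp
next
  case (insert i F)
  let ?C = "\<lambda>j. if j = i then - B i else B j"
  let ?a = "\<lambda>j. if j = i then a i + l i else a j" and ?l = "\<lambda>j. if j = i then 1 - l i else l j"
  have "real (card {\<alpha>\<in>S. \<forall>j\<in>insert i F. \<theta> j \<alpha> \<in> ?C j}) \<le> real (card S) * ((\<Prod>j\<in>insert i F. ?l j) + disc_error \<eta> K W V (card (insert i F)))"
  proof (rule proportion_in_box_le[where a = ?a])
    show "\<exists>k::int. ?a j \<le> \<theta> j \<alpha> + of_int k \<and> \<theta> j \<alpha> + of_int k \<le> ?a j + ?l j" if "\<alpha> \<in> S" "\<theta> j \<alpha> \<in> ?C j" for j \<alpha>
      using that B[of \<alpha> j] B'[of \<alpha> i] by (cases "j = i") auto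
  qed (use insert l in auto)
  also have "(\<Prod>j\<in>insert i F. ?l j) = (1 - l i) * (\<Prod>j\<in>F. l j)"
  proof -
    have "(\<Prod>j\<in>F. ?l j) = (\<Prod>j\<in>F. l j)" using insert by (intro prod.cong) auto
    then show ?thesis using insert by simp
  qed
  finally have up: "real (card {\<alpha>\<in>S. \<forall>j\<in>insert i F. \<theta> j \<alpha> \<in> ?C j}) \<le> real (card S) * ((1 - l i) * (\<Prod>j\<in>F. l j) + disc_error \<eta> K W V (Suc (card F)))"
    using insert by simp
  have "{\<alpha>\<in>S. \<forall>j\<in>F. \<theta> j \<alpha> \<in> B j} = {\<alpha>\<in>S. \<forall>j\<in>insert i F. \<theta> j \<alpha> \<in> B j} \<union> {\<alpha>\<in>S. \<forall>j\<in>insert i F. \<theta> j \<alpha> \<in> ?C j}"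
    using insert(2) by (auto split: if_splits)
  then have "card {\<alpha>\<in>S. \<forall>j\<in>F. \<theta> j \<alpha> \<in> B j} = card {\<alpha>\<in>S. \<forall>j\<in>insert i F. \<theta> j \<alpha> \<in> B j} + card {\<alpha>\<in>S. \<forall>j\<in>insert i F. \<theta> j \<alpha> \<in> ?C j}"
    using S by (simp only:) (rule card_Un_disjoint, auto)
  then have "real (card S) * ((\<Prod>j\<in>F. l j) - (\<Sum>m\<in>{1..card F}. disc_error \<eta> K W V m)) - real (card S) * ((1 - l i) * (\<Prod>j\<in>F. l j) + disc_error \<eta> K W V (Suc (card F)))
     \<le> real (card {\<alpha>\<in>S. \<forall>j\<in>insert i F. \<theta> j \<alpha> \<in> B j})"
    using insert.IH up by linarith
  also have "real (card S) * ((\<Prod>j\<in>F. l j) - (\<Sum>m\<in>{1..card F}. disc_error \<eta> K W V m)) - real (card S) * ((1 - l i) * (\<Prod>j\<in>F. l j) + disc_error \<eta> K W V (Suc (card F)))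
     = real (card S) * ((\<Prod>j\<in>insert i F. l j) - (\<Sum>m\<in>{1..card (insert i F)}. disc_error \<eta> K W V m))"
    using insert by (simp add: algebra_simps)
  finally show ?case .
qed

end

section \<open>The discrepancy bound\<close>

text \<open>The function \<open>log (2 t) / t\<close> decreases only from \<open>t = e / 2\<close> on, but its values at 1 and 2 agree.\<close>
lemma ln_double_over_antimono:
  assumes "1 \<le> a" "a \<le> b"
  shows "ln (2 * real b) / real b \<le> ln (2 * real a) / real a"
  using assms(2)
proof (induction b rule: dec_induct)
  case (step n)
  have n: "n \<ge> 1" using assms(1) step by simp
  have "real n * ln (real (Suc n) / real n) \<le> ln (2 * real n)"
  proof (cases "n = 1")
    case False
    then have n2: "real n \<ge> 2" using n by simp
    have "ln (real (Suc n) / real n) \<le> real (Suc n) / real n - 1" using n by (intro ln_le_minus_one) simp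
    then have "real n * ln (real (Suc n) / real n) \<le> real n * (real (Suc n) / real n - 1)" by (intro mult_left_mono) auto
    also have "\<dots> = 1" using n by (simp add: field_simps)
    also have "1 \<le> 2 * ln (2::real)" using ln2_ge_two_thirds by simp
    also have "\<dots> = ln (2 ^ 2 :: real)" using ln_realpow[of "2 :: real" 2] by simp
    also have "\<dots> \<le> ln (2 * real n)" using n2 by (intro ln_mono) auto
    finally show ?thesis .
  qed simp
  moreover have "ln (2 * real (Suc n)) = ln (2 * real n) + ln (real (Suc n) / real n)"
  proof -
    have "2 * real (Suc n) = (2 * real n) * (real (Suc n) / real n)" using n by simp
    then show ?thesis using n by (simp only:) (intro ln_mult_pos, auto)
  qed
  ultimately have "real n * ln (2 * real (Suc n)) \<le> real (Suc n) * ln (2 * real n)"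
    by (simp add: algebra_simps)
  then have "ln (2 * real (Suc n)) / real (Suc n) \<le> ln (2 * real n) / real n"
    using n by (simp add: field_simps del: of_nat_Suc)
  then show ?case using step.IH by simp
qed simp

lemma cis2pi_frac: "cis2pi (of_int k * frac u) = cis2pi (of_int k * u)"
proof -
  have "cis2pi (of_int k * u) = cis2pi (of_int k * frac u) * cis2pi (of_int (k * \<lfloor>u\<rfloor>))"
    by (simp add: cis2pi_add[symmetric] frac_def algebra_simps)
  moreover have "cis2pi (of_int i) = 1" for i
    using cos_int_2pin[of i] sin_int_2pin[of i] by (simp add: cis2pi_def complex_eq_iff)
  ultimately show ?thesis by (simp only: mult_1_right)
qed

lemma cis2pi_torus_angle:
  fixes \<alpha> :: "complex ^ 'n"
  assumes "\<alpha> $ j \<noteq> 0"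
  shows "cis2pi (of_int k * (torus_angle \<alpha> $ j)) = (\<alpha> $ j) powi k / of_real (cmod ((\<alpha> $ j) powi k))"
proof -
  have "cis2pi (of_int k * (torus_angle \<alpha> $ j)) = cis (of_int k * Arg (\<alpha> $ j))"
    by (simp add: torus_angle_def cis2pi_frac) (simp add: cis2pi_def)
  also have "\<dots> = cis (Arg (\<alpha> $ j)) powi k" by (simp add: cis_power_int)
  also have "\<dots> = (\<alpha> $ j / of_real (cmod (\<alpha> $ j))) powi k"
    using assms by (simp add: cis_Arg sgn_div_norm scaleR_conv_of_real divide_inverse mult.commute)
  finally show ?thesis by (simp add: power_int_divide_distrib norm_power_int)
qed

context
  fixes \<xi> :: "complex ^ 'n"
  assumes xi: "\<And>j. algebraic (\<xi> $ j)" and xi0: "\<And>j. \<xi> $ j \<noteq> 0"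
begin

lemma gen_degree_le:
  assumes "n \<noteq> 0"
  shows "gen_degree \<xi> \<le> norm1 n * alg_degree (torus_char n \<xi>)"
  unfolding gen_degree_def using assms by (intro cINF_lower) auto

lemma norm1_pos: "n \<noteq> 0 \<Longrightarrow> norm1 n \<ge> 1"
proof -
  assume "n \<noteq> 0"
  then obtain j where "n $ j \<noteq> 0" by (auto simp: Finite_Cartesian_Product.vec_eq_iff)
  then have "1 \<le> nat \<bar>n $ j\<bar>" by simp
  also have "\<dots> \<le> norm1 n" unfolding norm1_def by (rule member_le_sum) auto
  finally show ?thesis .
qed

lemma gen_degree_pos: "gen_degree \<xi> \<ge> 1"
proof -
  let ?K = "(\<lambda>n. norm1 n * alg_degree (torus_char n \<xi>)) ` {n :: int ^ 'n. n \<noteq> 0}"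
  have "((\<chi> j. 1) :: int ^ 'n) \<noteq> 0" by (simp add: Finite_Cartesian_Product.vec_eq_iff)
  then have "?K \<noteq> {}" by blast
  then have "Inf ?K \<in> ?K" by (rule Inf_nat_def1)
  then obtain n :: "int ^ 'n" where n: "n \<noteq> 0" "gen_degree \<xi> = norm1 n * alg_degree (torus_char n \<xi>)"
    unfolding gen_degree_def by auto
  have "alg_degree (torus_char n \<xi>) \<ge> 1"
    using alg_degree_pos[OF torus_char_algebraic[OF xi xi0 orbit_self[OF xi]], of n] by simp
  then show ?thesis using norm1_pos[OF n(1)] unfolding n(2) by (metis mult_le_mono nat_mult_1)
qed

lemma weil_height_vec_nonneg: "weil_height_vec \<xi> \<ge> 0"
  unfolding weil_height_vec_def using weil_height_nonneg[OF xi xi0] by (intro sum_nonneg) auto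

lemma height_D_pos: "height_D \<xi> > 0"
proof -
  have "ln (2 * real (gen_degree \<xi>)) > 0" using gen_degree_pos by simp
  then have "ln (2 * real (gen_degree \<xi>)) / (3 * real (gen_degree \<xi>)) > 0"
    using gen_degree_pos by (intro divide_pos_pos) auto
  then show ?thesis unfolding height_D_def using weil_height_vec_nonneg by linarith
qed

text \<open>By definition of the generalized degree \<open>D \<le> \<parallel>n\<parallel> d\<close>, and since \<open>log (2 t) / t\<close> decreases this turns
the term \<open>log (2 d) / d\<close> of \<open>mean_character_bound\<close> into a multiple of \<open>\<parallel>n\<parallel> log (2 D) / D\<close>. The
constant 6 absorbs the factor \<open>1/3\<close> in the definition of \<open>height_D\<close>.\<close>
lemma fourier_coefficient_bound:
  fixes A :: "'n set" and n :: "'n \<Rightarrow> int"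
  assumes ex: "\<exists>j\<in>A. n j \<noteq> 0"
  shows "cmod (\<Sum>\<alpha>\<in>galois_orbit \<xi>. \<Prod>j\<in>A. cis2pi (of_int (n j) * (torus_angle \<alpha> $ j)))
    \<le> real (card (galois_orbit \<xi>)) * (sqrt (6 * height_D \<xi>) * sqrt (\<Sum>j\<in>A. \<bar>of_int (n j)\<bar>))"
proof -
  \<comment> \<open>Coordinates outside \<open>A\<close> get the exponent 0.\<close>
  define n' :: "int ^ 'n" where "n' = (\<chi> j. if j \<in> A then n j else 0)"
  have n'0: "n' \<noteq> 0" using ex by (auto simp: n'_def Finite_Cartesian_Product.vec_eq_iff)
  have norm1: "real (norm1 n') = (\<Sum>j\<in>A. \<bar>of_int (n j)\<bar>)"
  proof -
    have "real (norm1 n') = (\<Sum>j\<in>UNIV. if j \<in> A then \<bar>of_int (n j)\<bar> else 0)"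
      unfolding norm1_def of_nat_sum by (intro sum.cong refl) (simp add: n'_def)
    then show ?thesis by (simp add: sum.If_cases)
  qed
  let ?x = "torus_char n'" and ?S = "galois_orbit \<xi>"
  define m where "m = real (card ?S)"
  define d where "d = alg_degree (torus_char n' \<xi>)"
  define D where "D = gen_degree \<xi>"
  define H where "H = (\<Sum>j\<in>UNIV. real (nat \<bar>n' $ j\<bar>) * weil_height (\<xi> $ j))"
  have eq: "(\<Prod>j\<in>A. cis2pi (of_int (n j) * (torus_angle \<alpha> $ j))) = ?x \<alpha> / of_real (cmod (?x \<alpha>))" if a: "\<alpha> \<in> ?S" for \<alpha>
  proof -
    have "(\<Prod>j\<in>A. cis2pi (of_int (n j) * (torus_angle \<alpha> $ j))) = (\<Prod>j\<in>UNIV. cis2pi (of_int (n' $ j) * (torus_angle \<alpha> $ j)))"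
      by (rule prod.mono_neutral_cong_left) (auto simp: n'_def)
    also have "\<dots> = (\<Prod>j\<in>UNIV. (\<alpha> $ j) powi (n' $ j) / of_real (cmod ((\<alpha> $ j) powi (n' $ j))))"
      using orbit_nonzero[OF xi xi0 a] by (intro prod.cong refl cis2pi_torus_angle)
    finally show ?thesis by (simp add: torus_char_def prod_dividef prod_norm[symmetric])
  qed
  have "(cmod (\<Sum>\<alpha>\<in>?S. ?x \<alpha> / of_real (cmod (?x \<alpha>))))\<^sup>2 \<le> m\<^sup>2 * (6 * H + 2 * ln (2 * real d) / real d)"
    unfolding m_def H_def d_def by (rule mean_character_bound[OF xi xi0])
  also have "\<dots> \<le> m\<^sup>2 * (6 * height_D \<xi> * real (norm1 n'))"
  proof (rule mult_left_mono)
    have "H \<le> (\<Sum>j\<in>UNIV. real (norm1 n') * weil_height (\<xi> $ j))"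
      unfolding H_def
    proof (intro sum_mono mult_right_mono weil_height_nonneg[OF xi xi0])
      fix j show "real (nat \<bar>n' $ j\<bar>) \<le> real (norm1 n')"
        unfolding norm1_def by (subst of_nat_le_iff, rule member_le_sum) auto
    qed
    then have H: "H \<le> real (norm1 n') * weil_height_vec \<xi>"
      by (simp add: weil_height_vec_def sum_distrib_left)
    have p: "norm1 n' \<ge> 1" "d \<ge> 1" "D \<ge> 1" "D \<le> norm1 n' * d"
      using norm1_pos[OF n'0] alg_degree_pos[OF torus_char_algebraic[OF xi xi0 orbit_self[OF xi]], of n']
        gen_degree_pos gen_degree_le[OF n'0] by (simp_all add: d_def D_def)
    have "ln (2 * real d) / real d \<le> ln (2 * real (norm1 n' * d)) / real d"
      using p by (intro divide_right_mono ln_mono) auto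
    also have "\<dots> = real (norm1 n') * (ln (2 * real (norm1 n' * d)) / real (norm1 n' * d))"
      using p by simp
    also have "\<dots> \<le> real (norm1 n') * (ln (2 * real D) / real D)"
      using p by (intro mult_left_mono ln_double_over_antimono) auto
    finally have "ln (2 * real d) / real d \<le> real (norm1 n') * (ln (2 * real D) / real D)" .
    then have "2 * (ln (2 * real d) / real d) \<le> 2 * (real (norm1 n') * (ln (2 * real D) / real D))"
      by (intro mult_left_mono) auto
    also have "\<dots> = real (norm1 n') * (6 * (ln (2 * real D) / (3 * real D)))" by simp
    finally have "2 * (ln (2 * real d) / real d) \<le> real (norm1 n') * (6 * (ln (2 * real D) / (3 * real D)))" .
    then have "6 * H + 2 * (ln (2 * real d) / real d) \<le> 6 * (real (norm1 n') * weil_height_vec \<xi>) + real (norm1 n') * (6 * (ln (2 * real D) / (3 * real D)))"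
      using H by (intro add_mono mult_left_mono) auto
    then show "6 * H + 2 * ln (2 * real d) / real d \<le> 6 * height_D \<xi> * real (norm1 n')"
      unfolding height_D_def D_def by (simp add: algebra_simps)
  qed simp
  also have "\<dots> = (m * (sqrt (6 * height_D \<xi>) * sqrt (real (norm1 n'))))\<^sup>2"
    using height_D_pos by (simp add: power_mult_distrib)
  finally have "cmod (\<Sum>\<alpha>\<in>?S. ?x \<alpha> / of_real (cmod (?x \<alpha>))) \<le> m * (sqrt (6 * height_D \<xi>) * sqrt (real (norm1 n')))"
    by (rule power2_le_imp_le) (use height_D_pos in \<open>auto simp: m_def\<close>)
  then show ?thesis using eq by (simp add: m_def norm1)
qed

end

lemma twice_square_le: "2 * (real n)\<^sup>2 \<le> 9 * (3 / 2) ^ n"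
proof (induction n rule: less_induct)
  case (less n)
  show ?case
  proof (cases "n \<le> 5")
    case True
    then consider "n = 0" | "n = 1" | "n = 2" | "n = 3" | "n = 4" | "n = 5" by linarith
    then show ?thesis by cases (simp_all add: power_numeral_reduce eval_nat_numeral)
  next
    case False
    then obtain k where k: "n = Suc k" "k \<ge> 5" by (cases n) auto
    have "2 * (real k + 1)\<^sup>2 \<le> 3 / 2 * (2 * (real k)\<^sup>2)"
    proof -
      have k5: "5 \<le> real k" using k(2) by simp
      then have "5 * real k \<le> real k * real k" by (intro mult_right_mono) auto
      then have "2 + real k * 4 \<le> real k * real k" using k5 by linarith
      then show ?thesis by (simp add: power2_eq_square algebra_simps)
    qed
    also have "\<dots> \<le> 3 / 2 * (9 * (3 / 2) ^ k)" using less.IH[of k] k(1) by (intro mult_left_mono) auto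
    finally show ?thesis by (simp add: k(1) add.commute)
  qed
qed

lemma sum_weighted_powers_le:
  fixes L :: real
  assumes "L \<ge> 2"
  shows "(\<Sum>m\<in>{1..N}. real m * L ^ (m - 1)) \<le> 2 * real N * L ^ (N - 1)"
proof (induction N)
  case (Suc N)
  show ?case
  proof (cases N)
    case (Suc M)
    have "2 * L ^ (N - 1) \<le> L ^ N" using assms by (simp add: Suc mult_right_mono)
    then have "real N * (2 * L ^ (N - 1)) \<le> real N * L ^ N" by (intro mult_left_mono) auto
    moreover have "0 \<le> L ^ N" using assms by simp
    ultimately have "2 * real N * L ^ (N - 1) + real (Suc N) * L ^ N \<le> 2 * real (Suc N) * L ^ N"
      by (simp add: algebra_simps)
    then show ?thesis using Suc.IH by simp
  qed simp
qed simp

text \<open>By the choice of \<open>T\<close> one has \<open>h L\<^sup>2\<^sup>(\<^sup>N\<^sup>-\<^sup>1\<^sup>) = T\<^sup>3\<close>, so \<open>(h K)\<^sup>1\<^sup>/\<^sup>2 L\<^sup>N\<^sup>-\<^sup>1\<close> is about \<open>T\<close> for \<open>K\<close> about \<open>1 / T\<close>. The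
assumption that the bound is below 1 forces \<open>27 T \<le> 1\<close> and \<open>L \<ge> 9\<close>; then \<open>V \<le> L\<close>, because
\<open>log K\<close> is at most about \<open>L / 3\<close>, and the sums over the dimensions are dominated by their last terms.\<close>
lemma total_disc_error_le:
  fixes h L T :: real and N :: nat
  assumes N: "N \<ge> 1" and h: "0 < h" and L: "L = - ln h" "L \<ge> 1"
    and T: "T = h powr (1 / 3) * L powr (2 * (real N - 1) / 3)"
    and small: "(9 * (3 / 2) ^ N + 14 * real N) * T < 1"
  defines "K \<equiv> nat \<lceil>1 / T\<rceil>"
  defines "V \<equiv> 2 + 2 * ((1 + ln (real K)) / pi + 1 / pi\<^sup>2)"
  defines "W \<equiv> 2 * ((2 / pi + 2 / pi\<^sup>2) * sqrt (real K))"
  shows "K \<ge> 1" "(\<Sum>m\<in>{1..N}. disc_error (sqrt (6 * h)) K W V m) \<le> (9 * (3 / 2) ^ N + 14 * real N) * T"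
    and "\<And>m. disc_error (sqrt (6 * h)) K W V m \<ge> 0"
proof -
  have T0: "T > 0" unfolding T using h L(2) by (intro mult_pos_pos) simp_all
  have p32: "(3 / 2 :: real) ^ N \<ge> 3 / 2" using N power_increasing[of 1 N "3/2::real"] by simp
  have NT: "real N * T \<le> 1 / 14"
  proof -
    have "14 * (real N * T) \<le> (9 * (3 / 2) ^ N + 14 * real N) * T" using T0 by (simp add: distrib_right)
    then show ?thesis using small by linarith
  qed
  have T27: "27 * T \<le> 1"
  proof -
    have "27 * T \<le> (9 * (3 / 2) ^ N + 14 * real N) * T" using T0 p32 N by (intro mult_right_mono) auto
    then show ?thesis using small by linarith
  qed
  have K_ge: "1 / T \<le> real K" unfolding K_def by linarith
  have K_le: "real K \<le> 1 / T + 1" unfolding K_def using T0 by (simp add: le_of_int_ceiling)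
  have T_inv: "27 \<le> 1 / T" using T27 T0 by (simp add: field_simps)
  show K1: "K \<ge> 1" using K_ge T_inv by linarith
  have K_le2: "real K \<le> 28 / 27 * (1 / T)" using K_le T_inv by linarith
  have invT: "1 / T \<le> h powr (- (1 / 3))"
  proof -
    have "L powr (2 * (real N - 1) / 3) \<ge> 1" using L N by (intro ge_one_powr_ge_zero) auto
    then have "h powr (1 / 3) * 1 \<le> T" unfolding T by (intro mult_left_mono) auto
    then have "1 / T \<le> 1 / h powr (1 / 3)" using h by (intro divide_left_mono mult_pos_pos T0) auto
    then show ?thesis by (simp add: powr_minus_divide)
  qed
  have lninv: "ln (1 / T) \<le> L / 3"
  proof -
    have "ln (1 / T) \<le> ln (h powr (- (1 / 3)))" using invT T0 by (intro ln_mono) auto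
    then show ?thesis using h L by (simp add: ln_powr)
  qed
  have L9: "L \<ge> 9"
  proof -
    have "exp (3::real) = exp 1 ^ 3" by (simp add: exp_of_nat_mult[symmetric])
    also have "\<dots> \<le> 3 ^ 3" using exp_le by (intro power_mono) auto
    finally have "exp 3 \<le> (27 :: real)" by simp
    then have "exp 3 \<le> 1 / T" using T_inv by linarith
    then have "3 \<le> ln (1 / T)" using T0 by (subst ln_ge_iff) auto
    then show ?thesis using lninv by linarith
  qed
  have pi1: "1 / pi \<le> 1 / 3" using pi_gt3 by (intro divide_left_mono) auto
  have pi2: "1 / pi\<^sup>2 \<le> 1 / 9"
  proof -
    have "3\<^sup>2 \<le> pi\<^sup>2" using pi_gt3 by (intro power_mono) auto
    then show ?thesis by (intro divide_left_mono) auto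
  qed
  have lnK0: "0 \<le> ln (real K)" using K1 by simp
  have VL: "V \<le> L"
  proof -
    have "ln (real K) \<le> ln (2 * (1 / T))" using K_le T_inv K1 by (intro ln_mono) auto
    also have "\<dots> = ln 2 + ln (1 / T)" using T0 by (intro ln_mult_pos) auto
    finally have lnK: "ln (real K) \<le> 1 + L / 3" using lninv ln_le_minus_one[of "2::real"] by linarith
    have "(1 + ln (real K)) / pi \<le> (1 + ln (real K)) / 3" using lnK0 pi_gt3 by (intro divide_left_mono) auto
    then have "V \<le> 2 + 2 * ((1 + ln (real K)) / 3 + 1 / 9)"
      unfolding V_def using pi2 by (intro add_left_mono mult_left_mono add_mono) auto
    also have "\<dots> \<le> 2 + 2 * ((2 + L / 3) / 3 + 1 / 9)" using lnK by simp
    also have "\<dots> \<le> L" using L9 by (simp add: field_simps)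
    finally show ?thesis .
  qed
  have V0: "0 \<le> V" unfolding V_def using lnK0 by (intro add_nonneg_nonneg mult_nonneg_nonneg divide_nonneg_nonneg) auto
  have W0: "0 \<le> W" unfolding W_def by simp
  show err0: "disc_error (sqrt (6 * h)) K W V m \<ge> 0" for m
    unfolding disc_error_def using h V0 W0 by (intro add_nonneg_nonneg mult_nonneg_nonneg) auto
  have first: "(1 + 1 / real K) ^ m - 1 \<le> 2 * real N * T" if "m \<le> N" for m
  proof -
    have iK: "1 / real K \<le> T" using K_ge T0 K1 by (simp add: field_simps)
    have "(1 + 1 / real K) ^ m \<le> (1 + T) ^ m" using iK by (intro power_mono) auto
    also have "\<dots> \<le> (1 + T) ^ N" using T0 that by (intro power_increasing) auto
    also have "\<dots> \<le> exp T ^ N" using T0 by (intro power_mono exp_ge_add_one_self) auto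
    also have "\<dots> = exp (real N * T)" by (simp add: exp_of_nat_mult)
    also have "\<dots> \<le> 1 + real N * T + (real N * T)\<^sup>2" using NT T0 by (intro exp_bound) auto
    also have "(real N * T)\<^sup>2 \<le> 1 * (real N * T)"
      unfolding power2_eq_square using NT T0 by (intro mult_right_mono) auto
    finally show ?thesis by (simp add: mult_ac)
  qed
  have second: "sqrt (6 * h) * W * L ^ (N - 1) \<le> 7 * T"
  proof -
    have T3: "T ^ 3 = h * (L ^ (N - 1))\<^sup>2"
    proof -
      have "T ^ 3 = T powr 3" using T0 by (simp add: powr_numeral)
      also have "\<dots> = h powr (1 / 3 * 3) * L powr (2 * (real N - 1) / 3 * 3)"
        unfolding T using h L by (simp add: powr_mult powr_powr)
      also have "2 * (real N - 1) / 3 * 3 = real (2 * (N - 1))" using N by (simp add: of_nat_diff)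
      also have "L powr real (2 * (N - 1)) = L ^ (2 * (N - 1))" using L by (intro powr_realpow) auto
      also have "L ^ (2 * (N - 1)) = (L ^ (N - 1))\<^sup>2" by (simp only: mult.commute[of 2] power_mult)
      also have "h powr (1 / 3 * 3) = h" using h by simp
      finally show ?thesis .
    qed
    have "W \<le> 2 * (8 / 9 * sqrt (real K))"
    proof -
      have "2 / pi + 2 / pi\<^sup>2 = 2 * (1 / pi) + 2 * (1 / pi\<^sup>2)" by simp
      also have "\<dots> \<le> 2 * (1 / 3) + 2 * (1 / 9)" by (intro add_mono mult_left_mono pi1 pi2) auto
      finally have "2 / pi + 2 / pi\<^sup>2 \<le> 8 / 9" by simp
      then show ?thesis unfolding W_def by (intro mult_left_mono mult_right_mono) auto
    qed
    then have "sqrt (6 * h) * W * L ^ (N - 1) \<le> sqrt (6 * h) * (2 * (8 / 9 * sqrt (real K))) * L ^ (N - 1)"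
      using h L9 by (intro mult_right_mono mult_left_mono) auto
    also have "\<dots> \<le> 7 * T"
    proof (rule power2_le_imp_le)
      have "(sqrt (6 * h) * (2 * (8 / 9 * sqrt (real K))) * L ^ (N - 1))\<^sup>2 = 512 / 27 * (h * (L ^ (N - 1))\<^sup>2) * real K"
      proof -
        have "(sqrt (6 * h))\<^sup>2 = 6 * h" "(sqrt (real K))\<^sup>2 = real K" using h by simp_all
        then show ?thesis unfolding power_mult_distrib by (simp add: power_divide)
      qed
      also have "\<dots> = 512 / 27 * T ^ 3 * real K" by (simp only: T3)
      also have "\<dots> \<le> 512 / 27 * T ^ 3 * (28 / 27 * (1 / T))"
        using K_le2 T0 by (intro mult_left_mono) auto
      also have "\<dots> = 14336 / 729 * T\<^sup>2" using T0 by (simp add: power2_eq_square power3_eq_cube)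
      also have "\<dots> \<le> 49 * T\<^sup>2" by (intro mult_right_mono) auto
      also have "\<dots> = (7 * T)\<^sup>2" by (simp add: power_mult_distrib)
      finally show "(sqrt (6 * h) * (2 * (8 / 9 * sqrt (real K))) * L ^ (N - 1))\<^sup>2 \<le> (7 * T)\<^sup>2" .
    qed (use T0 in simp)
    finally show ?thesis .
  qed
  have "(\<Sum>m\<in>{1..N}. disc_error (sqrt (6 * h)) K W V m)
      \<le> (\<Sum>m\<in>{1..N}. 2 * real N * T + sqrt (6 * h) * W * (real m * L ^ (m - 1)))"
  proof (rule sum_mono)
    fix m assume m: "m \<in> {1..N}"
    have "V ^ (m - 1) \<le> L ^ (m - 1)" using V0 VL by (intro power_mono)
    then have "sqrt (6 * h) * real m * W * V ^ (m - 1) \<le> sqrt (6 * h) * real m * W * L ^ (m - 1)"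
      using h W0 by (intro mult_left_mono) auto
    then show "disc_error (sqrt (6 * h)) K W V m \<le> 2 * real N * T + sqrt (6 * h) * W * (real m * L ^ (m - 1))"
      unfolding disc_error_def using first[of m] m by (simp add: mult_ac)
  qed
  also have "\<dots> = 2 * (real N)\<^sup>2 * T + sqrt (6 * h) * W * (\<Sum>m\<in>{1..N}. real m * L ^ (m - 1))"
    by (simp add: sum.distrib sum_distrib_left power2_eq_square)
  also have "sqrt (6 * h) * W * (\<Sum>m\<in>{1..N}. real m * L ^ (m - 1)) \<le> sqrt (6 * h) * W * (2 * real N * L ^ (N - 1))"
    using h W0 L9 by (intro mult_left_mono sum_weighted_powers_le) auto
  also have "\<dots> = 2 * real N * (sqrt (6 * h) * W * L ^ (N - 1))" by simp
  also have "\<dots> \<le> 2 * real N * (7 * T)" by (intro mult_left_mono second) auto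
  also have "2 * (real N)\<^sup>2 * T \<le> 9 * (3 / 2) ^ N * T" using T0 by (intro mult_right_mono twice_square_le) auto
  finally show "(\<Sum>m\<in>{1..N}. disc_error (sqrt (6 * h)) K W V m) \<le> (9 * (3 / 2) ^ N + 14 * real N) * T"
    by (simp add: distrib_right)
qed

theorem theorem10:
  fixes \<xi> :: "complex ^ 'n"
  assumes "\<And>j. \<xi> $ j \<in> Qbar - {0}"
    and "height_D \<xi> \<le> exp (- 1)"
  shows "angular_discrepancy \<xi> \<le>
    (9 * (3 / 2) ^ CARD('n) + 14 * real CARD('n)) * height_D \<xi> powr (1 / 3) *
      \<bar>ln (height_D \<xi>)\<bar> powr (2 * (real CARD('n) - 1) / 3)"
proof -
  have xi: "algebraic (\<xi> $ j)" and xi0: "\<xi> $ j \<noteq> 0" for j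
    using assms(1)[of j] by (auto simp: Qbar_def)
  define N where "N = CARD('n)"
  define h where "h = height_D \<xi>"
  define L where "L = - ln h"
  define T where "T = h powr (1 / 3) * L powr (2 * (real N - 1) / 3)"
  let ?S = "galois_orbit \<xi>"
  have fS: "finite ?S" by (rule finite_orbit[OF xi])
  have m0: "real (card ?S) > 0" using card_orbit_pos[OF xi xi0] by simp
  have N1: "N \<ge> 1" unfolding N_def by (simp add: Suc_leI)
  have h0: "h > 0" unfolding h_def by (rule height_D_pos[OF xi xi0])
  have L1: "L \<ge> 1"
  proof -
    have "ln h \<le> ln (exp (- 1))" using assms(2) h0 unfolding h_def by (intro ln_mono) auto
    then show ?thesis by (simp add: L_def)
  qed
  have main: "\<bar>(\<Sum>\<alpha>\<in>?S. indicator {\<theta>. \<forall>j. \<theta> $ j \<in> I j} (torus_angle \<alpha>)) / real (card ?S)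
      - (\<Prod>j\<in>UNIV. measure lborel (I j))\<bar> \<le> (9 * (3 / 2) ^ N + 14 * real N) * T"
    if I: "\<forall>j. circle_interval (I j)" for I :: "'n \<Rightarrow> real set"
  proof -
    define Q where "Q j q \<longleftrightarrow> (0 \<le> snd q \<and> snd q \<le> 1) \<and> measure lborel (I j) = snd q \<and>
      (\<forall>x\<in>I j. \<exists>k::int. fst q \<le> x + of_int k \<and> x + of_int k \<le> fst q + snd q) \<and>
      (\<forall>x. 0 \<le> x \<longrightarrow> x < 1 \<longrightarrow> x \<notin> I j \<longrightarrow> (\<exists>k::int. fst q + snd q \<le> x + of_int k \<and> x + of_int k \<le> fst q + 1))"
      for j and q :: "real \<times> real"
    have "\<forall>j. \<exists>q. Q j q"
    proof
      fix j
      have "circle_interval (I j)" using I by simp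
      then show "\<exists>q. Q j q"
      proof (rule circle_interval_arcs)
        fix a l :: real
        assume *: "0 \<le> l" "l \<le> 1" "measure lborel (I j) = l"
          "\<And>x. x \<in> I j \<Longrightarrow> \<exists>k::int. a \<le> x + of_int k \<and> x + of_int k \<le> a + l"
          "\<And>x. 0 \<le> x \<Longrightarrow> x < 1 \<Longrightarrow> x \<notin> I j \<Longrightarrow> \<exists>k::int. a + l \<le> x + of_int k \<and> x + of_int k \<le> a + 1"
        show ?thesis unfolding Q_def by (intro exI[of _ "(a, l)"]) (simp add: *)
      qed
    qed
    then have "\<exists>f. \<forall>j. Q j (f j)" by (rule choice)
    then obtain f where f: "\<And>j. Q j (f j)" by blast
    define a l where "a j = fst (f j)" and "l j = snd (f j)" for j
    have al: "\<And>j. 0 \<le> l j \<and> l j \<le> 1" "\<And>j. measure lborel (I j) = l j"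
      "\<And>j x. x \<in> I j \<Longrightarrow> \<exists>k::int. a j \<le> x + of_int k \<and> x + of_int k \<le> a j + l j"
      "\<And>j x. 0 \<le> x \<Longrightarrow> x < 1 \<Longrightarrow> x \<notin> I j \<Longrightarrow> \<exists>k::int. a j + l j \<le> x + of_int k \<and> x + of_int k \<le> a j + 1"
      using f unfolding Q_def a_def l_def by simp_all
    define C where "C = {\<alpha>\<in>?S. \<forall>j\<in>UNIV. torus_angle \<alpha> $ j \<in> I j}"
    define p where "p = real (card C) / real (card ?S)"
    define P where "P = (\<Prod>j\<in>UNIV. l j)"
    have sum_eq: "(\<Sum>\<alpha>\<in>?S. indicator {\<theta>. \<forall>j. \<theta> $ j \<in> I j} (torus_angle \<alpha>)) = real (card C)"
      using fS by (simp add: indicator_def C_def sum.If_cases Int_def)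
    have p01: "0 \<le> p" "p \<le> 1"
    proof -
      have "card C \<le> card ?S" unfolding C_def using fS by (intro card_mono) auto
      then show "0 \<le> p" "p \<le> 1" unfolding p_def using m0 by (auto simp: divide_le_eq_1)
    qed
    have P01: "0 \<le> P" "P \<le> 1" unfolding P_def using al(1) by (auto intro!: prod_nonneg prod_le_1)
    have "\<bar>p - P\<bar> \<le> (9 * (3 / 2) ^ N + 14 * real N) * T"
    proof (cases "(9 * (3 / 2) ^ N + 14 * real N) * T < 1")
      case False
      then show ?thesis using p01 P01 by linarith
    next
      case True
      define K where "K = nat \<lceil>1 / T\<rceil>"
      define V where "V = 2 + 2 * ((1 + ln (real K)) / pi + 1 / pi\<^sup>2)"
      define W where "W = 2 * ((2 / pi + 2 / pi\<^sup>2) * sqrt (real K))"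
      let ?\<eta> = "sqrt (6 * h)"
      note err = total_disc_error_le[OF N1 h0 L_def L1 T_def True, folded K_def, folded V_def W_def]
      have H: "cmod (\<Sum>\<alpha>\<in>?S. \<Prod>j\<in>A. cis2pi (of_int (n j) * (torus_angle \<alpha> $ j)))
          \<le> real (card ?S) * (?\<eta> * sqrt (\<Sum>j\<in>A. \<bar>of_int (n j)\<bar>))"
        if "\<exists>j\<in>A. n j \<noteq> 0" for A :: "'n set" and n
        unfolding h_def by (rule fourier_coefficient_bound[OF xi xi0 that])
      interpret equidistributed_points ?S "\<lambda>j \<alpha>. torus_angle \<alpha> $ j" ?\<eta> V W K
        by standard (use fS err(1) h0 H in \<open>auto simp: V_def W_def\<close>)
      have up: "real (card C) \<le> real (card ?S) * (P + disc_error ?\<eta> K W V N)"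
        unfolding C_def P_def N_def
        by (rule proportion_in_box_le[OF _ al(1), where a = a]) (use al(3) in auto)
      have lo: "real (card C) \<ge> real (card ?S) * (P - (\<Sum>m\<in>{1..N}. disc_error ?\<eta> K W V m))"
        unfolding C_def P_def N_def
      proof (rule proportion_in_box_ge[OF al(1), where a = a])
        show "\<exists>k::int. a j + l j \<le> torus_angle \<alpha> $ j + of_int k \<and> torus_angle \<alpha> $ j + of_int k \<le> a j + 1"
          if "torus_angle \<alpha> $ j \<notin> I j" for j \<alpha>
          using al(4)[OF _ _ that] by (simp add: torus_angle_def frac_lt_1)
      qed (use al(3) in auto)
      have "disc_error ?\<eta> K W V N \<le> (\<Sum>m\<in>{1..N}. disc_error ?\<eta> K W V m)"
        using N1 err(3) by (intro member_le_sum) auto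
      moreover have "p \<le> P + disc_error ?\<eta> K W V N" unfolding p_def using up m0 by (simp add: field_simps)
      moreover have "P - (\<Sum>m\<in>{1..N}. disc_error ?\<eta> K W V m) \<le> p" unfolding p_def using lo m0 by (simp add: field_simps)
      ultimately show ?thesis using err(2) by linarith
    qed
    then show ?thesis unfolding sum_eq al(2) p_def P_def .
  qed
  have "angular_discrepancy \<xi> \<le> (9 * (3 / 2) ^ N + 14 * real N) * T"
    unfolding angular_discrepancy_def
  proof (rule cSUP_least)
    show "{I :: 'n \<Rightarrow> real set. \<forall>j. circle_interval (I j)} \<noteq> {}"
      by (auto intro!: exI[of _ "\<lambda>_. {}"] simp: circle_interval_def)
  qed (use main in auto)
  moreover have "\<bar>ln (height_D \<xi>)\<bar> = L" using L1 by (simp add: L_def h_def)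
  ultimately show ?thesis by (simp add: T_def h_def N_def mult.assoc)
qed

end
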